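(* Let $(\xi_j)_{j\ge0}$ be independent real random variables with $\mathbb{E}\,\xi_j=0$, $\mathrm{Var}(\xi_j)=1$ for all $j$, and $\sup_j\mathbb{E}|\xi_j|^{2+\epsilon_0}<\infty$ for some $\epsilon_0>0$. Let $p_n(x)=\sum_{j=0}^n\xi_jx^j$. Let $\epsilon>0$ and $c>1$. Then there are constants $c_1>0$ and $A>0$, independent of $n$, such that for all integers $n\ge1$ $$\mathbf{P}\Big(\max_{n\le k\le cn}\big|N_k([0,1])-N_n([0,1])\big|\ge \epsilon\log n\Big)\le A\,n^{-c_1},$$ where the maximum is over integers $k$.
   Context: For $I\subset\mathbb{R}$, $N_n(I)$ denotes the number of real roots of $p_n$ in $I$, counted with multiplicity, with the convention $N_n(I)=0$ if $p_n$ is identically zero. The sequence $(\xi_j)_{j\ge0}$ is fixed and does not depend on the degree $n$. *)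

theory Defs
  imports
    "HOL-Probability.Probability"
    "HOL-Computational_Algebra.Computational_Algebra"
begin

definition rand_poly :: "(nat \<Rightarrow> 'a \<Rightarrow> real) \<Rightarrow> nat \<Rightarrow> 'a \<Rightarrow> real poly" where
  "rand_poly \<xi> n \<omega> = (\<Sum>j\<le>n. monom (\<xi> j \<omega>) j)"

text \<open>The multiset \<open>proots p\<close> contains each root as often as its multiplicity, and
  \<open>proots 0\<close> is empty, so a polynomial that is identically zero has root count 0.\<close>

definition num_real_roots :: "(nat \<Rightarrow> 'a \<Rightarrow> real) \<Rightarrow> nat \<Rightarrow> real set \<Rightarrow> 'a \<Rightarrow> nat" where
  "num_real_roots \<xi> n I \<omega> = size {#x \<in># proots (rand_poly \<xi> n \<omega>). x \<in> I#}"

end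

theory Submission
  imports Defs "HOL-Complex_Analysis.Complex_Analysis" "HOL-Real_Asymp.Real_Asymp"
begin

text \<open>Write \<open>p\<^sub>k\<close> for the polynomial of degree \<open>k\<close>, let \<open>S\<^sub>j = \<xi>\<^sub>0 + \<dots> + \<xi>\<^sub>j\<close>, and let \<open>\<alpha>\<close> be a small multiple of
\<open>\<epsilon>\<close>. For \<open>k\<close> between \<open>n\<close> and \<open>cn\<close>, summation by parts shows that \<open>p\<^sub>k\<close> and \<open>p\<^sub>n\<close> differ at \<open>x \<in> [0,1]\<close>
by at most \<open>2 x\<^sup>n max \<bar>S\<^sub>j\<bar>\<close>, whereas \<open>p\<^sub>n(x)\<close> has typical size \<open>(1 - x) powr (-1/2)\<close>. As long as
\<open>1 - x \<ge> u\<^sub>* = \<alpha> ln n / n\<close>, the difference is smaller than the typical size by a power of \<open>n\<close>. The interval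
\<open>[0,1]\<close> is cut at \<open>1 - u\<^sub>*\<close> and near a constant below 1; on the middle piece the two polynomials turn out to
have the same number of roots, and on the outer pieces each has at most \<open>\<epsilon>/4 ln n\<close> roots.

The deterministic tool on all three pieces is Jensen's inequality, \<open>jensen_root_bound\<close>: with \<open>N\<close> roots in a
real interval, a polynomial near the centre is at most \<open>q\<^sup>N\<close> times its maximum on a larger concentric circle.
Maxima are bounded through the partial sums \<open>S\<^sub>j\<close>, so one maximal inequality
(\<open>kolmogorov_maximal\<close>, \<open>partial_sums_growth\<close>) serves all \<open>k\<close> at once, where a union
bound over \<open>k\<close> would cost too much; lower bounds for \<open>p\<^sub>n\<close> at finitely many points carry over to \<open>p\<^sub>k\<close>.

  \<^item> On \<open>[1 - u\<^sub>*, 1]\<close> one disc of radius \<open>2 u\<^sub>*\<close> about \<open>1 - u\<^sub>*\<close> suffices. Since \<open>(1 + u\<^sub>*)\<^sup>k\<close> is at most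
    \<open>n powr (\<alpha> c)\<close>, the maximum exceeds the value at the centre by a factor \<open>n powr O(\<alpha>)\<close>, which leaves room
    for \<open>O(\<alpha> ln n)\<close> roots (\<open>root_count_right\<close>).
  \<^item> On the middle piece a grid is used whose cells have length \<open>\<delta> u\<close> at distance \<open>u\<close> from 1, with
    \<open>\<delta> = n powr (-b)\<close>. Two roots of \<open>p\<^sub>k\<close> in one cell force \<open>p\<^sub>k\<close> at a grid point down to about
    \<open>\<delta>\<^sup>2 u powr (-1/2)\<close>. When \<open>p\<^sub>n\<close> is larger than that at every grid point, all cells hold at most one root
    of either polynomial, its presence is read off from the signs at the end points, and these signs agree
    (\<open>root_count_eq_of_signs\<close>, \<open>root_count_difference\<close>).
  \<^item> On the first piece, at distance at least a constant from 1, Jensen's inequality is applied in a disc about 0,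
    and the lower bound comes from some coefficient of index \<open>O(ln n)\<close> that is at least \<open>1/2\<close> in absolute value
    (\<open>root_count_left\<close>).

The probabilistic heart is the small ball estimate \<open>small_ball\<close>:
\<open>P(\<bar>p\<^sub>n(x)\<bar> \<le> \<tau> (1 - x) powr (-1/2)) \<le> C \<tau> powr (3/5)\<close>. There are about \<open>1/\<delta>\<close> grid points, up to a
logarithm, and \<open>\<tau>\<close> is close to \<open>\<delta>\<^sup>2\<close>, so the union bound over the grid works because the exponent \<open>3/5\<close> exceeds
\<open>1/2\<close>. To prove the estimate, the coefficients are cut into blocks of length \<open>D\<close> with \<open>x\<^sup>D\<close> near a tiny constant
\<open>r\<close>. The normalised sum satisfies \<open>X = U + x\<^sup>D X'\<close> with independent \<open>U\<close> (first block) and \<open>X'\<close> (a sum of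
the same form over the later coefficients), and the characteristic
function of \<open>U\<close> has a Gaussian bound on a long interval. Each block gains a factor of order
\<open>r powr (2/3)\<close>, provided that the concentration of \<open>X'\<close> near \<open>v\<close> is tracked with a weight
\<open>1 / (1 + (v/s)\<^sup>2)\<close> that remembers the second moment (\<open>small_ball_step\<close>).\<close>

section \<open>Few real roots where the polynomial is not small\<close>

definition root_count :: "real set \<Rightarrow> real poly \<Rightarrow> nat" where
  "root_count I p = size {#x \<in># proots p. x \<in> I#}"

abbreviation cpoly :: "real poly \<Rightarrow> complex \<Rightarrow> complex" where
  "cpoly p z \<equiv> poly (map_poly complex_of_real p) z"

lemma cpoly_linear_mult: "cpoly ([:-x, 1:] * q) z = (z - of_real x) * cpoly q z"
proof -
  have "map_poly complex_of_real ([:-x, 1:] * q) = [:-of_real x, 1:] * map_poly complex_of_real q"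
    by (rule poly_eqI) (auto simp: coeff_map_poly coeff_pCons split: nat.splits)
  then have "cpoly ([:-x, 1:] * q) z = poly ([:-of_real x, 1:] * map_poly complex_of_real q) z"
    by (rule arg_cong)
  also have "\<dots> = poly [:-complex_of_real x, 1:] z * cpoly q z"
    by (rule poly_mult)
  finally show ?thesis by (simp only: poly_pCons poly_0) (simp add: algebra_simps)
qed

lemma cpoly_of_real: "cpoly p (of_real x) = of_real (poly p x)"
  by (induction p) (auto simp: map_poly_pCons)

lemma root_count_linear_mult:
  assumes "q \<noteq> 0"
  shows "root_count I ([:-x, 1:] * q) = (if x \<in> I then 1 else 0) + root_count I q"
  using assms unfolding root_count_def by (subst proots_mult) auto

text \<open>The quotient of \<open>w - x\<close> and the second factor is, up to scaling, the Blaschke factor of the disc of radius \<open>R\<close>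
about \<open>c\<close> with its zero at \<open>x\<close>. The hypothesis on \<open>q\<close> compares the largest possible numerator with the
smallest possible denominator.\<close>

lemma blaschke_factor_bound:
  fixes x c r R \<rho> q :: real and w :: complex
  assumes "0 \<le> r" "r < R" "0 \<le> \<rho>" "\<rho> < R" "\<bar>x - c\<bar> \<le> r" "norm (w - of_real c) \<le> \<rho>"
    and q: "R * (r + \<rho>) \<le> q * (R\<^sup>2 - r * \<rho>)"
  shows "norm (w - of_real x) \<le> q * norm (of_real R - of_real (x - c) * (w - of_real c) / of_real R)"
proof -
  have q0: "q \<ge> 0"
  proof (rule ccontr)
    assume "\<not> q \<ge> 0"
    moreover have "R\<^sup>2 - r * \<rho> > 0"
      using mult_strict_mono'[of r R \<rho> R] assms by (simp add: power2_eq_square)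
    ultimately have "q * (R\<^sup>2 - r * \<rho>) < 0" by (simp add: mult_neg_pos)
    moreover have "R * (r + \<rho>) \<ge> 0" using assms by simp
    ultimately show False using q by linarith
  qed
  have "norm (w - of_real x) \<le> norm (w - of_real c) + norm (of_real c - complex_of_real x)"
    using norm_triangle_ineq[of "w - of_real c" "of_real c - complex_of_real x"] by simp
  also have "norm (of_real c - complex_of_real x) = \<bar>x - c\<bar>"
    by (metis norm_minus_commute norm_of_real of_real_diff)
  finally have 1: "norm (w - of_real x) \<le> \<rho> + r" using assms by linarith
  have "norm (complex_of_real (x - c) * (w - of_real c) / of_real R) = \<bar>x - c\<bar> * norm (w - of_real c) / R"
    using assms by (simp add: norm_mult norm_divide del: of_real_diff)
  also have "\<dots> \<le> r * \<rho> / R"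
    using assms by (intro divide_right_mono mult_mono) auto
  finally have "norm (complex_of_real R - of_real (x - c) * (w - of_real c) / of_real R) \<ge> R - r * \<rho> / R"
    using norm_triangle_ineq2[of "complex_of_real R" "of_real (x - c) * (w - of_real c) / of_real R"] assms by simp
  then have "q * norm (complex_of_real R - of_real (x - c) * (w - of_real c) / of_real R) \<ge> q * (R - r * \<rho> / R)"
    using q0 by (intro mult_left_mono) auto
  moreover have "q * (R - r * \<rho> / R) \<ge> r + \<rho>"
  proof -
    have "q * (R - r * \<rho> / R) = q * (R\<^sup>2 - r * \<rho>) / R"
      using assms by (simp add: field_simps power2_eq_square)
    also have "\<dots> \<ge> R * (r + \<rho>) / R" using q assms by (intro divide_right_mono) auto
    finally show ?thesis using assms by simp
  qed
  ultimately show ?thesis using 1 by linarith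
qed

lemma blaschke_factor_on_circle:
  fixes x c R :: real and z :: complex
  assumes "R > 0" "norm (z - of_real c) = R"
  shows "norm (of_real R - of_real (x - c) * (z - of_real c) / of_real R) = norm (z - of_real x)"
proof -
  define u where "u = z - of_real c"
  have u: "u * cnj u = of_real R * of_real R"
    using assms complex_norm_square[of u] by (simp add: u_def power2_eq_square)
  have "norm (of_real R - of_real (x - c) * u / of_real R) * R = norm ((of_real R - of_real (x - c) * u / of_real R) * of_real R)"
    using assms by (simp add: norm_mult)
  also have "(of_real R - of_real (x - c) * u / of_real R) * of_real R = of_real R * of_real R - of_real (x - c) * u"
    using assms(1) by (simp add: left_diff_distrib del: of_real_diff)
  also have "\<dots> = u * (cnj (u - of_real (x - c)))"
    unfolding u[symmetric] complex_cnj_diff complex_cnj_complex_of_real right_diff_distrib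
    by (simp add: mult.commute)
  also have "norm \<dots> = R * norm (u - of_real (x - c))"
    unfolding norm_mult complex_mod_cnj using assms(2) by (simp add: u_def)
  finally have "norm (of_real R - of_real (x - c) * u / of_real R) = norm (u - of_real (x - c))"
    using assms(1) by (metis mult.commute mult_left_cancel less_irrefl)
  also have "u - of_real (x - c) = z - of_real x" by (simp add: u_def)
  finally show ?thesis unfolding u_def .
qed

text \<open>Dividing \<open>p\<close> by the Blaschke factors of its roots in \<open>I\<close> leaves a polynomial with the same modulus on the circle,
to which the maximum principle applies; each Blaschke factor is at most \<open>q\<close> in modulus at \<open>w\<close>. For
\<open>\<rho> = 0\<close> this is the classical statement at the centre, with \<open>q = r/R\<close>. A point \<open>w\<close> off the centre is needed
where only a coefficient of \<open>p\<close>, not a value, is known to be large.\<close>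

lemma jensen_root_bound:
  fixes p :: "real poly" and c r R \<rho> q B :: real and w :: complex
  assumes p: "p \<noteq> 0" and I: "I \<subseteq> {c - r..c + r}"
    and r: "0 \<le> r" "r < R" and \<rho>: "0 \<le> \<rho>" "\<rho> < R" "norm (w - of_real c) \<le> \<rho>"
    and q: "0 \<le> q" "R * (r + \<rho>) \<le> q * (R\<^sup>2 - r * \<rho>)"
    and B: "\<And>z. norm (z - of_real c) = R \<Longrightarrow> norm (cpoly p z) \<le> B"
  shows "norm (cpoly p w) \<le> q ^ root_count I p * B"
proof -
  have "\<exists>g. (\<forall>z. norm (z - of_real c) = R \<longrightarrow> norm (poly g z) = norm (cpoly p z))
          \<and> norm (cpoly p w) \<le> q ^ root_count I p * norm (poly g w)"
    using p
  proof (induction "root_count I p" arbitrary: p)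
    case 0
    then show ?case by (intro exI[of _ "map_poly complex_of_real p"]) auto
  next
    case (Suc N)
    have "{#x \<in># proots p. x \<in> I#} \<noteq> {#}"
    proof
      assume "{#x \<in># proots p. x \<in> I#} = {#}"
      then have "root_count I p = 0" unfolding root_count_def by simp
      then show False using Suc.hyps(2) by simp
    qed
    then obtain x where "x \<in># {#x \<in># proots p. x \<in> I#}" by (rule multiset_nonemptyE)
    then have x: "x \<in> I" "poly p x = 0" using Suc.prems by simp_all
    from x(2) have "[:-x, 1:] dvd p" by (simp add: poly_eq_0_iff_dvd)
    then obtain s where s: "p = [:-x, 1:] * s" by (elim dvdE)
    have s0: "s \<noteq> 0" using s Suc.prems by fastforce
    have rc: "root_count I p = Suc (root_count I s)"
      unfolding s root_count_linear_mult[OF s0, of I x] using x(1) by simp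
    then obtain g where g: "\<And>z. norm (z - of_real c) = R \<Longrightarrow> norm (poly g z) = norm (cpoly s z)"
       "norm (cpoly s w) \<le> q ^ root_count I s * norm (poly g w)"
      using Suc.hyps(1)[of s] Suc.hyps(2) s0 by auto
    (* The numerator of the reflected factor; it replaces the linear factor of the root x. *)
    define b :: "complex poly" where "b = [:of_real R + of_real (x - c) * of_real c / of_real R, - of_real (x - c) / of_real R:]"
    have b: "poly b z = of_real R - of_real (x - c) * (z - of_real c) / of_real R" for z
      using r by (simp add: b_def field_simps)
    show ?case
    proof (intro exI[of _ "b * g"] conjI allI impI)
      fix z :: complex assume z: "norm (z - of_real c) = R"
      show "norm (poly (b * g) z) = norm (cpoly p z)"
        unfolding s cpoly_linear_mult poly_mult norm_mult b
        using blaschke_factor_on_circle[of R z c x] g(1)[OF z] z r by simp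
    next
      have "\<bar>x - c\<bar> \<le> r" using subsetD[OF I x(1)] by (simp add: abs_le_iff)
      from blaschke_factor_bound[OF r \<rho>(1,2) this \<rho>(3) q(2)]
      have "norm (w - of_real x) \<le> q * norm (poly b w)" unfolding b .
      then have "norm (w - of_real x) * norm (cpoly s w) \<le> (q * norm (poly b w)) * (q ^ root_count I s * norm (poly g w))"
        using g(2) q by (intro mult_mono) auto
      then show "norm (cpoly p w) \<le> q ^ root_count I p * norm (poly (b * g) w)"
        unfolding rc unfolding s cpoly_linear_mult by (simp add: norm_mult mult_ac)
    qed
  qed
  then obtain g where g: "\<And>z. norm (z - of_real c) = R \<Longrightarrow> norm (poly g z) = norm (cpoly p z)"
       "norm (cpoly p w) \<le> q ^ root_count I p * norm (poly g w)" by blast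
  have "norm (poly g w) \<le> B"
  proof (rule maximum_modulus_frontier[of "poly g" "cball (of_real c) R"])
    show "norm (poly g z) \<le> B" if "z \<in> frontier (cball (complex_of_real c) R)" for z
    proof -
      have "norm (z - of_real c) = R"
        using that by (simp add: frontier_cball dist_norm norm_minus_commute)
      then show ?thesis using B g by simp
    qed
  qed (use r \<rho> in \<open>auto intro!: holomorphic_intros continuous_intros simp: dist_norm norm_minus_commute poly_holomorphic_on\<close>)
  then have "q ^ root_count I p * norm (poly g w) \<le> q ^ root_count I p * B"
    using q by (intro mult_left_mono) auto
  then show ?thesis using g(2) by linarith
qed

lemma higher_deriv_poly: "(deriv ^^ n) (poly g) = poly ((pderiv ^^ n) (g :: complex poly))"
proof (induction n)
  case (Suc n)
  have "deriv (poly h) = poly (pderiv h)" for h :: "complex poly"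
    by (rule ext) (rule DERIV_imp_deriv, rule poly_DERIV)
  then show ?case by (simp add: Suc)
qed simp

text \<open>Cauchy's estimate for the coefficients of a polynomial.\<close>

lemma coeff_bound_on_circle:
  fixes p :: "real poly"
  assumes "\<rho> > 0" and B: "\<And>w. norm w = \<rho> \<Longrightarrow> norm (cpoly p w) \<le> B"
  shows "\<bar>coeff p J\<bar> * \<rho> ^ J \<le> B"
proof -
  let ?g = "map_poly complex_of_real p"
  have h: "(deriv ^^ J) (poly ?g) 0 = of_nat (fact J) * of_real (coeff p J)"
    by (simp add: higher_deriv_poly poly_0_coeff_0 coeff_higher_pderiv pochhammer_fact[symmetric] coeff_map_poly)
  have "norm ((deriv ^^ J) (poly ?g) 0) \<le> fact J * B / \<rho> ^ J"
    by (rule Cauchy_inequality) (use assms in \<open>auto intro!: poly_holomorphic_on continuous_intros\<close>)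
  then show ?thesis using assms by (simp add: h norm_mult field_simps)
qed

section \<open>Roots in small cells and sign changes\<close>

lemma root_count_union:
  assumes "I \<inter> J = {}"
  shows "root_count (I \<union> J) p = root_count I p + root_count J p"
proof -
  have "size {#x \<in># X. x \<in> I \<union> J#} = size {#x \<in># X. x \<in> I#} + size {#x \<in># X. x \<in> J#}" for X :: "real multiset"
    using assms by (induction X) auto
  then show ?thesis unfolding root_count_def by blast
qed

lemma root_count_eq_0:
  assumes "p \<noteq> 0" "\<And>x. x \<in> I \<Longrightarrow> poly p x \<noteq> 0"
  shows "root_count I p = 0"
proof -
  have "{#x \<in># proots p. x \<in> I#} = {#}"
    by (rule multiset_eqI) (use assms in \<open>auto simp: order_root\<close>)
  then show ?thesis unfolding root_count_def by simp
qed

lemma root_count_pos_obtain: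
  assumes "p \<noteq> 0" "root_count I p \<noteq> 0"
  obtains x where "x \<in> I" "poly p x = 0"
  using root_count_eq_0[of p I] assms by blast

lemma root_count_pos:
  assumes "p \<noteq> 0" "x \<in> I" "poly p x = 0"
  shows "root_count I p > 0"
proof -
  have "x \<in># {#x \<in># proots p. x \<in> I#}" using assms by simp
  then show ?thesis unfolding root_count_def
    by (metis size_eq_0_iff_empty empty_not_add_mset multi_member_split gr0I)
qed

text \<open>With at most one root, counted with multiplicity, the root count is determined by the signs at the end
points: a simple root contributes one sign change, and without a root the intermediate value theorem excludes one.\<close>

lemma root_count_one_iff_sign_change:
  assumes "a < b" "p \<noteq> 0" and le: "root_count {a<..b} p \<le> 1" and nz: "poly p a \<noteq> 0" "poly p b \<noteq> 0"
  shows "root_count {a<..b} p = (if poly p a * poly p b < 0 then 1 else 0)"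
proof (cases "root_count {a<..b} p = 0")
  case True
  have "\<not> poly p a * poly p b < 0"
  proof
    assume "poly p a * poly p b < 0"
    from poly_IVT[OF \<open>a < b\<close> this] obtain x where "a < x" "x < b" "poly p x = 0" by blast
    then have "root_count {a<..b} p > 0" using assms(2) by (intro root_count_pos) auto
    then show False using True by simp
  qed
  then show ?thesis using True by simp
next
  case False
  then obtain x where x: "x \<in> {a<..b}" "poly p x = 0" using root_count_pos_obtain[OF assms(2) False] by blast
  then obtain s where s: "p = [:-x, 1:] * s" by (metis dvdE poly_eq_0_iff_dvd)
  have s0: "s \<noteq> 0" using s assms(2) by fastforce
  have "root_count {a<..b} p = 1 + root_count {a<..b} s"
    unfolding s root_count_linear_mult[OF s0] using x(1) by simp
  then have rs: "root_count {a<..b} s = 0" using le by simp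
  have e: "poly p y = (y - x) * poly s y" for y unfolding s poly_mult by simp
  have "\<not> poly s a * poly s b < 0"
  proof
    assume "poly s a * poly s b < 0"
    from poly_IVT[OF \<open>a < b\<close> this] obtain y where "a < y" "y < b" "poly s y = 0" by blast
    then have "root_count {a<..b} s > 0" using s0 by (intro root_count_pos) auto
    then show False using rs by simp
  qed
  moreover have "poly s a * poly s b \<noteq> 0" using nz e by auto
  ultimately have ss: "poly s a * poly s b > 0" by linarith
  have "x \<noteq> b" using nz e[of b] by auto
  then have "(a - x) * (b - x) < 0" using x(1) by (intro mult_neg_pos) auto
  from mult_neg_pos[OF this ss] have "((a - x) * (b - x)) * (poly s a * poly s b) < 0" .
  then have "poly p a * poly p b < 0" unfolding e by (simp add: mult_ac)
  then show ?thesis using False le by simp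
qed

lemma root_count_eq_of_signs:
  assumes "a < b" "p \<noteq> 0" "q \<noteq> 0"
    and "root_count {a<..b} p \<le> 1" "root_count {a<..b} q \<le> 1"
    and a: "poly p a * poly q a > 0" and b: "poly p b * poly q b > 0"
  shows "root_count {a<..b} p = root_count {a<..b} q"
proof -
  have nz: "poly p a \<noteq> 0" "poly q a \<noteq> 0" "poly p b \<noteq> 0" "poly q b \<noteq> 0" using a b by auto
  have "(poly p a * poly p b) * (poly q a * poly q b) > 0"
    using mult_pos_pos[OF a b] by (simp add: mult_ac)
  then have "poly p a * poly p b < 0 \<longleftrightarrow> poly q a * poly q b < 0"
    by (smt (verit) zero_less_mult_iff)
  then show ?thesis
    using root_count_one_iff_sign_change[of a b p] root_count_one_iff_sign_change[of a b q] assms nz by auto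
qed

lemma root_count_eq_on_grid:
  fixes e :: "nat \<Rightarrow> real"
  assumes "\<And>i. i < K \<Longrightarrow> e (Suc i) < e i"
    and "\<And>i. i < K \<Longrightarrow> root_count {e (Suc i)<..e i} p = root_count {e (Suc i)<..e i} q"
  shows "e K \<le> e 0 \<and> root_count {e K<..e 0} p = root_count {e K<..e 0} q"
  using assms
proof (induction K)
  case 0
  then show ?case by (simp add: root_count_def)
next
  case (Suc K)
  then have IH: "e K \<le> e 0" "root_count {e K<..e 0} p = root_count {e K<..e 0} q" by auto
  have lt: "e (Suc K) < e K" using Suc.prems(1)[of K] by simp
  have u: "{e (Suc K)<..e 0} = {e (Suc K)<..e K} \<union> {e K<..e 0}" using lt IH(1) by auto
  have d: "{e (Suc K)<..e K} \<inter> {e K<..e 0} = {}" by auto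
  show ?case using lt IH Suc.prems(2)[of K] unfolding u root_count_union[OF d] by simp
qed

section \<open>Power sums bounded through their partial sums\<close>

lemma abel_summation:
  fixes a :: "nat \<Rightarrow> complex" and z :: complex
  shows "(\<Sum>j\<le>k. a j * z ^ j) = (\<Sum>j<k. (\<Sum>i\<le>j. a i) * (z ^ j - z ^ Suc j)) + (\<Sum>i\<le>k. a i) * z ^ k"
  by (induction k) (auto simp: algebra_simps)

text \<open>Summation by parts: independent coefficients enter only through their partial sums, which are much smaller
than sums of absolute values.\<close>

lemma abel_norm_bound:
  fixes a :: "nat \<Rightarrow> real" and z :: complex
  shows "norm (\<Sum>j\<le>k. of_real (a j) * z ^ j) \<le>
     norm (1 - z) * (\<Sum>j<k. \<bar>\<Sum>i\<le>j. a i\<bar> * norm z ^ j) + \<bar>\<Sum>i\<le>k. a i\<bar> * norm z ^ k"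
proof -
  have S: "(\<Sum>i\<le>j. complex_of_real (a i)) = of_real (\<Sum>i\<le>j. a i)" for j by simp
  have "norm (\<Sum>j\<le>k. of_real (a j) * z ^ j) \<le>
      norm (\<Sum>j<k. of_real (\<Sum>i\<le>j. a i) * (z ^ j - z ^ Suc j)) + norm (of_real (\<Sum>i\<le>k. a i) * z ^ k)"
    unfolding abel_summation S by (rule norm_triangle_ineq)
  also have "norm (\<Sum>j<k. of_real (\<Sum>i\<le>j. a i) * (z ^ j - z ^ Suc j)) \<le>
      (\<Sum>j<k. norm (of_real (\<Sum>i\<le>j. a i) * (z ^ j - z ^ Suc j)))"
    by (rule norm_sum)
  also have "\<dots> = (\<Sum>j<k. norm (1 - z) * (\<bar>\<Sum>i\<le>j. a i\<bar> * norm z ^ j))"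
  proof (rule sum.cong[OF refl])
    fix j
    have "z ^ j - z ^ Suc j = (1 - z) * z ^ j" by (simp add: algebra_simps)
    then show "norm (of_real (\<Sum>i\<le>j. a i) * (z ^ j - z ^ Suc j)) = norm (1 - z) * (\<bar>\<Sum>i\<le>j. a i\<bar> * norm z ^ j)"
      by (simp only: norm_mult norm_of_real norm_power mult_ac)
  qed
  also have "\<dots> = norm (1 - z) * (\<Sum>j<k. \<bar>\<Sum>i\<le>j. a i\<bar> * norm z ^ j)"
    by (simp add: sum_distrib_left)
  finally show ?thesis by (simp only: norm_mult norm_power norm_of_real)
qed

lemma geometric_partial_sum_le:
  fixes t :: real assumes "0 \<le> t" "t < 1"
  shows "(\<Sum>j<k. t ^ j) \<le> 1 / (1 - t)"
  using assms by (simp add: sum_gp_strict divide_simps)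

lemma arith_geometric_partial_sum_le:
  fixes t :: real assumes "0 \<le> t" "t < 1"
  shows "(\<Sum>j<k. real (j + 1) * t ^ j) \<le> (1 / (1 - t))\<^sup>2"
proof -
  have "(1 - t) * (\<Sum>j<k. real (j + 1) * t ^ j) = (\<Sum>j<k. t ^ j) - real k * t ^ k"
  proof (induction k)
    case (Suc k)
    show ?case unfolding sum.lessThan_Suc distrib_left Suc.IH by (simp add: algebra_simps)
  qed simp
  also have "\<dots> \<le> (\<Sum>j<k. t ^ j)" using assms(1) by simp
  also have "\<dots> \<le> 1 / (1 - t)" by (rule geometric_partial_sum_le[OF assms])
  finally have "(\<Sum>j<k. real (j + 1) * t ^ j) * (1 - t) \<le> 1 / (1 - t)" by (simp only: mult.commute)
  then have "(\<Sum>j<k. real (j + 1) * t ^ j) \<le> 1 / (1 - t) / (1 - t)"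
    using assms by (subst pos_le_divide_eq) auto
  moreover have "1 / (1 - t) / (1 - t) = (1 / (1 - t))\<^sup>2" by (simp add: power2_eq_square)
  ultimately show ?thesis by (rule ord_le_eq_trans)
qed

lemma last_term_le:
  fixes t :: real assumes "0 \<le> t" "t < 1"
  shows "real (k + 1) * t ^ k \<le> 1 / (1 - t)"
proof -
  have "real (k + 1) * t ^ k = (\<Sum>j<k+1. t ^ k)" by simp
  also have "\<dots> \<le> (\<Sum>j<k+1. t ^ j)" using assms by (intro sum_mono power_decreasing) auto
  also have "\<dots> \<le> 1 / (1 - t)" by (rule geometric_partial_sum_le[OF assms])
  finally show ?thesis .
qed

text \<open>The square roots are replaced by linear functions through \<open>2 sqrt (j m) \<le> j + m\<close> with \<open>m = 1/(1 - t)\<close>, the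
effective length of the series, so that only geometric and arithmetic-geometric sums remain. The result has the
typical order \<open>sqrt m\<close> of a random sum as soon as \<open>\<bar>1 - z\<bar>\<close> is comparable with \<open>1 - t\<close>.\<close>

lemma power_sum_bound_inside_disc:
  fixes a :: "nat \<Rightarrow> real" and z :: complex and \<Lambda> t :: real
  assumes S: "\<And>j. j \<le> k \<Longrightarrow> \<bar>\<Sum>i\<le>j. a i\<bar> \<le> \<Lambda> * sqrt (real (j + 1))"
    and \<Lambda>: "\<Lambda> \<ge> 0" and t: "norm z \<le> t" "t < 1"
  shows "norm (\<Sum>j\<le>k. of_real (a j) * z ^ j) \<le> \<Lambda> * sqrt (1 / (1 - t)) * (norm (1 - z) / (1 - t) + 1)"
proof -
  define m where "m = 1 / (1 - t)"
  have t0: "0 \<le> t" using t norm_ge_zero[of z] by linarith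
  have m: "m \<ge> 1" using t t0 by (simp add: m_def)
  have sq: "sqrt (real (j + 1)) \<le> (real (j + 1) + m) / (2 * sqrt m)" for j
  proof -
    have "sqrt (real (j + 1) * m) \<le> (real (j + 1) + m) / 2" using m by (intro arith_geo_mean_sqrt) auto
    then have "sqrt (real (j + 1)) * (2 * sqrt m) \<le> real (j + 1) + m"
      unfolding real_sqrt_mult by (simp add: algebra_simps)
    then show ?thesis using m by (simp add: pos_le_divide_eq)
  qed
  have A: "\<bar>\<Sum>i\<le>j. a i\<bar> * norm z ^ j \<le> \<Lambda> / (2 * sqrt m) * (real (j + 1) * t ^ j + m * t ^ j)" if "j \<le> k" for j
  proof -
    have "\<bar>\<Sum>i\<le>j. a i\<bar> * norm z ^ j \<le> (\<Lambda> * ((real (j + 1) + m) / (2 * sqrt m))) * t ^ j"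
    proof (rule mult_mono)
      have "\<Lambda> * sqrt (real (j + 1)) \<le> \<Lambda> * ((real (j + 1) + m) / (2 * sqrt m))"
        by (rule mult_left_mono[OF sq \<Lambda>])
      then show "\<bar>\<Sum>i\<le>j. a i\<bar> \<le> \<Lambda> * ((real (j + 1) + m) / (2 * sqrt m))"
        using S[OF that] by linarith
      show "norm z ^ j \<le> t ^ j" using t by (intro power_mono) auto
    qed (use \<Lambda> m in auto)
    also have "\<dots> = \<Lambda> / (2 * sqrt m) * (real (j + 1) * t ^ j + m * t ^ j)"
      by (simp add: algebra_simps add_divide_distrib)
    finally show ?thesis .
  qed
  have c: "\<Lambda> / (2 * sqrt m) \<ge> 0" using \<Lambda> m by simp
  have "(\<Sum>j<k. \<bar>\<Sum>i\<le>j. a i\<bar> * norm z ^ j) \<le> (\<Sum>j<k. \<Lambda> / (2 * sqrt m) * (real (j + 1) * t ^ j + m * t ^ j))"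
    by (intro sum_mono A) auto
  also have "\<dots> = \<Lambda> / (2 * sqrt m) * ((\<Sum>j<k. real (j + 1) * t ^ j) + m * (\<Sum>j<k. t ^ j))"
    by (simp only: sum_distrib_left[symmetric] sum.distrib)
  also have "\<dots> \<le> \<Lambda> / (2 * sqrt m) * (m\<^sup>2 + m * m)"
    using arith_geometric_partial_sum_le[OF t0 t(2), of k] geometric_partial_sum_le[OF t0 t(2), of k] m c
    unfolding m_def[symmetric] by (intro mult_left_mono add_mono) auto
  also have "\<dots> = \<Lambda> * sqrt m * m"
    using m by (simp add: field_simps power2_eq_square)
  finally have 1: "(\<Sum>j<k. \<bar>\<Sum>i\<le>j. a i\<bar> * norm z ^ j) \<le> \<Lambda> * sqrt m * m" .
  have "\<bar>\<Sum>i\<le>k. a i\<bar> * norm z ^ k \<le> \<Lambda> / (2 * sqrt m) * (real (k + 1) * t ^ k + m * t ^ k)"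
    by (rule A) simp
  also have "\<dots> \<le> \<Lambda> / (2 * sqrt m) * (m + m * 1)"
    using last_term_le[OF t0 t(2), of k] m c t t0
    unfolding m_def[symmetric] by (intro mult_left_mono add_mono power_le_one) auto
  also have "\<dots> = \<Lambda> * sqrt m"
    using m by (simp add: field_simps)
  finally have 2: "\<bar>\<Sum>i\<le>k. a i\<bar> * norm z ^ k \<le> \<Lambda> * sqrt m" .
  have "norm (\<Sum>j\<le>k. of_real (a j) * z ^ j) \<le> norm (1 - z) * (\<Lambda> * sqrt m * m) + \<Lambda> * sqrt m"
    using abel_norm_bound[of a z k] mult_left_mono[OF 1 norm_ge_zero[of "1 - z"]] 2 by linarith
  also have "\<dots> = \<Lambda> * sqrt m * (norm (1 - z) * m + 1)" by (simp add: algebra_simps)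
  finally show ?thesis by (simp add: m_def)
qed

text \<open>The version for discs that reach slightly beyond the unit circle, where the finite degree bounds the sum.\<close>

lemma power_sum_bound_near_disc:
  fixes a :: "nat \<Rightarrow> real" and z :: complex and \<Lambda> u :: real
  assumes S: "\<And>j. j \<le> k \<Longrightarrow> \<bar>\<Sum>i\<le>j. a i\<bar> \<le> \<Lambda> * sqrt (real (j + 1))"
    and \<Lambda>: "\<Lambda> \<ge> 0" and z: "norm z \<le> 1 + u" and u: "u \<ge> 0"
  shows "norm (\<Sum>j\<le>k. of_real (a j) * z ^ j) \<le> \<Lambda> * sqrt (real (k + 1)) * (1 + u) ^ k * (norm (1 - z) * real k + 1)"
proof -
  have A: "\<bar>\<Sum>i\<le>j. a i\<bar> * norm z ^ j \<le> \<Lambda> * sqrt (real (k + 1)) * (1 + u) ^ k" if "j \<le> k" for j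
  proof (rule mult_mono)
    have "\<Lambda> * sqrt (real (j + 1)) \<le> \<Lambda> * sqrt (real (k + 1))"
      using \<Lambda> that by (intro mult_left_mono) auto
    then show "\<bar>\<Sum>i\<le>j. a i\<bar> \<le> \<Lambda> * sqrt (real (k + 1))" using S[OF that] by linarith
    have "norm z ^ j \<le> (1 + u) ^ j" using z by (intro power_mono) auto
    also have "\<dots> \<le> (1 + u) ^ k" using u that by (intro power_increasing) auto
    finally show "norm z ^ j \<le> (1 + u) ^ k" .
  qed (use \<Lambda> in auto)
  have "(\<Sum>j<k. \<bar>\<Sum>i\<le>j. a i\<bar> * norm z ^ j) \<le> (\<Sum>j<k. \<Lambda> * sqrt (real (k + 1)) * (1 + u) ^ k)"
    by (intro sum_mono A) auto
  also have "\<dots> = real k * (\<Lambda> * sqrt (real (k + 1)) * (1 + u) ^ k)" by simp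
  finally have 1: "(\<Sum>j<k. \<bar>\<Sum>i\<le>j. a i\<bar> * norm z ^ j) \<le> real k * (\<Lambda> * sqrt (real (k + 1)) * (1 + u) ^ k)" .
  have "norm (\<Sum>j\<le>k. of_real (a j) * z ^ j) \<le>
      norm (1 - z) * (real k * (\<Lambda> * sqrt (real (k + 1)) * (1 + u) ^ k)) + \<Lambda> * sqrt (real (k + 1)) * (1 + u) ^ k"
    using abel_norm_bound[of a z k] mult_left_mono[OF 1 norm_ge_zero[of "1 - z"]] A[of k] by linarith
  then show ?thesis by (simp add: algebra_simps)
qed

text \<open>Summation by parts against the monotone sequence \<open>x\<^sup>j\<close>.\<close>

lemma tail_bound:
  fixes a :: "nat \<Rightarrow> real" and x L :: real
  assumes S: "\<And>j. j \<le> k \<Longrightarrow> \<bar>\<Sum>i\<le>j. a i\<bar> \<le> L" and x: "0 \<le> x" "x \<le> 1" and nk: "n \<le> k"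
  shows "\<bar>(\<Sum>j\<le>k. a j * x ^ j) - (\<Sum>j\<le>n. a j * x ^ j)\<bar> \<le> 2 * L * x ^ n"
proof -
  define s where "s = (\<lambda>j. \<Sum>i\<le>j. a i)"
  have L: "L \<ge> 0" using S[of 0] by linarith
  (* Removing the boundary terms of the summation by parts makes the induction on k telescope. *)
  have D: "\<bar>(\<Sum>j\<le>k. a j * x ^ j) - (\<Sum>j\<le>n. a j * x ^ j) - s k * x ^ k + s n * x ^ n\<bar> \<le> L * (x ^ n - x ^ k)"
    using nk S
  proof (induction k rule: dec_induct)
    case base
    then show ?case by simp
  next
    case (step k)
    have IH: "\<bar>(\<Sum>j\<le>k. a j * x ^ j) - (\<Sum>j\<le>n. a j * x ^ j) - s k * x ^ k + s n * x ^ n\<bar> \<le> L * (x ^ n - x ^ k)"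
      using step by auto
    have mono: "x ^ Suc k \<le> x ^ k" using x by (intro power_decreasing) auto
    have sk: "\<bar>s k\<bar> \<le> L" using step.prems[of k] unfolding s_def by simp
    have e: "(\<Sum>j\<le>Suc k. a j * x ^ j) - (\<Sum>j\<le>n. a j * x ^ j) - s (Suc k) * x ^ Suc k + s n * x ^ n
       = ((\<Sum>j\<le>k. a j * x ^ j) - (\<Sum>j\<le>n. a j * x ^ j) - s k * x ^ k + s n * x ^ n) + s k * (x ^ k - x ^ Suc k)"
      by (simp add: s_def algebra_simps)
    have "\<bar>s k * (x ^ k - x ^ Suc k)\<bar> \<le> L * (x ^ k - x ^ Suc k)"
      unfolding abs_mult using sk mono by (intro mult_mono) auto
    with IH show ?case unfolding e right_diff_distrib by linarith
  qed
  have "\<bar>s k * x ^ k\<bar> \<le> L * x ^ k" "\<bar>s n * x ^ n\<bar> \<le> L * x ^ n"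
    unfolding abs_mult s_def using S[of k] S[of n] nk x by (auto intro!: mult_right_mono)
  with D show ?thesis unfolding right_diff_distrib by linarith
qed

section \<open>Comparing the real roots of two initial segments\<close>

definition initial_poly :: "(nat \<Rightarrow> real) \<Rightarrow> nat \<Rightarrow> real poly" where
  "initial_poly a k = (\<Sum>j\<le>k. monom (a j) j)"

lemma poly_initial_poly: "poly (initial_poly a k) x = (\<Sum>j\<le>k. a j * x ^ j)"
  by (simp add: initial_poly_def poly_sum poly_monom)

lemma coeff_initial_poly: "j \<le> k \<Longrightarrow> coeff (initial_poly a k) j = a j"
  by (simp add: initial_poly_def coeff_sum)

lemma cpoly_initial_poly: "cpoly (initial_poly a k) z = (\<Sum>j\<le>k. of_real (a j) * z ^ j)"
proof (induction k)
  case 0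
  then show ?case by (simp add: initial_poly_def map_poly_monom poly_monom)
next
  case (Suc k)
  have "map_poly complex_of_real (p + q) = map_poly complex_of_real p + map_poly complex_of_real q" for p q
    by (rule poly_eqI) (simp add: coeff_map_poly)
  then have "cpoly (initial_poly a (Suc k)) z = cpoly (initial_poly a k) z + of_real (a (Suc k)) * z ^ Suc k"
    by (simp add: initial_poly_def map_poly_monom poly_monom)
  then show ?case by (simp add: Suc)
qed

text \<open>At \<open>\<rho> = 0\<close> the condition allows every \<open>q \<ge> r/R\<close>; taking \<open>q\<close> halfway between \<open>r/R\<close> and 1 leaves room for a
positive \<open>\<rho>\<close>.\<close>

lemma jensen_constants:
  fixes r R :: real
  assumes "0 \<le> r" "r < R"
  obtains \<rho> q where "0 < \<rho>" "\<rho> < R" "0 < q" "q < 1" "R * (r + \<rho>) \<le> q * (R\<^sup>2 - r * \<rho>)"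
proof -
  define q where "q = (1 + r / R) / 2"
  define \<rho> where "\<rho> = (R * (R - r) / 2) / (R + q * r)"
  have R: "R > 0" using assms by simp
  have q: "0 < q" "q < 1" using assms R by (auto simp: q_def field_simps add_pos_nonneg)
  have d: "R + q * r > 0" using R q assms by (intro add_pos_nonneg) auto
  have \<rho>: "\<rho> > 0" using R d assms by (simp add: \<rho>_def)
  have "\<rho> \<le> (R * (R - r) / 2) / R" unfolding \<rho>_def
    using R q assms d by (intro divide_left_mono) auto
  also have "\<dots> < R" using R assms by simp
  finally have \<rho>R: "\<rho> < R" .
  have "\<rho> * (R + q * r) = R * (R - r) / 2" using \<rho>_def d by (metis nonzero_eq_divide_eq less_irrefl)
  moreover have "q * R\<^sup>2 - R * r = R * (R - r) / 2"
    using R by (simp add: q_def power2_eq_square field_simps)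
  ultimately have "R * (r + \<rho>) \<le> q * (R\<^sup>2 - r * \<rho>)" by (simp add: algebra_simps)
  then show ?thesis using that \<rho> \<rho>R q by blast
qed

text \<open>Jensen's inequality bounds \<open>p\<close> on the whole circle of radius \<open>\<rho>\<close>, hence all its coefficients. Used with a
coefficient that is not small, this bounds the number of roots at distance at least \<open>w\<close> from 1 without any lower
bound for the values of \<open>p\<close>.\<close>

lemma root_count_left:
  fixes a :: "nat \<Rightarrow> real"
  assumes S: "\<And>j. j \<le> k \<Longrightarrow> \<bar>\<Sum>i\<le>j. a i\<bar> \<le> \<Lambda> * sqrt (real (j + 1))" and \<Lambda>: "\<Lambda> \<ge> 0"
    and w: "0 < w" "w \<le> 1" and e: "e \<le> 1 - w"
    and q: "0 < \<rho>" "\<rho> < 1 - w / 2" "0 < q" "(1 - w / 2) * ((1 - w) + \<rho>) \<le> q * ((1 - w / 2)\<^sup>2 - (1 - w) * \<rho>)"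
    and J: "J \<le> k" "\<bar>a J\<bar> \<ge> 1 / 2" and nz: "initial_poly a k \<noteq> 0"
  shows "1 / 2 * \<rho> ^ J \<le> q ^ root_count {0..e} (initial_poly a k) * (\<Lambda> * sqrt (2 / w) * (4 / w + 1))"
proof -
  let ?p = "initial_poly a k"
  let ?B = "\<Lambda> * sqrt (2 / w) * (4 / w + 1)"
  have "norm (cpoly ?p v) \<le> q ^ root_count {0..e} ?p * ?B" if v: "norm v = \<rho>" for v
  proof (rule jensen_root_bound[where c = 0 and r = "1 - w" and R = "1 - w / 2" and \<rho> = \<rho>])
    fix z :: complex assume "norm (z - of_real 0) = 1 - w / 2"
    then have z: "norm z = 1 - w / 2" by simp
    have "norm (cpoly ?p z) \<le> \<Lambda> * sqrt (1 / (1 - (1 - w / 2))) * (norm (1 - z) / (1 - (1 - w / 2)) + 1)"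
      unfolding cpoly_initial_poly using z w by (intro power_sum_bound_inside_disc[OF S \<Lambda>]) auto
    also have "\<dots> = \<Lambda> * sqrt (2 / w) * (norm (1 - z) * (2 / w) + 1)" by simp
    also have "\<dots> \<le> \<Lambda> * sqrt (2 / w) * (2 * (2 / w) + 1)"
    proof -
      have "norm (1 - z) \<le> 2" using norm_triangle_ineq4[of 1 z] z w by simp
      then show ?thesis using w \<Lambda> by (intro mult_left_mono add_mono mult_right_mono) auto
    qed
    finally show "norm (cpoly ?p z) \<le> ?B" by simp
  qed (use nz e w q v in auto)
  then have "\<bar>coeff ?p J\<bar> * \<rho> ^ J \<le> q ^ root_count {0..e} ?p * ?B"
    by (rule coeff_bound_on_circle[OF q(1)])
  moreover have "1 / 2 * \<rho> ^ J \<le> \<bar>coeff ?p J\<bar> * \<rho> ^ J"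
    using J q by (intro mult_right_mono) (auto simp: coeff_initial_poly)
  ultimately show ?thesis by linarith
qed

text \<open>The disc of radius \<open>2u\<close> about \<open>1 - u\<close> leaves the unit disc only by \<open>u\<close>.\<close>

lemma root_count_right:
  fixes a :: "nat \<Rightarrow> real"
  assumes S: "\<And>j. j \<le> k \<Longrightarrow> \<bar>\<Sum>i\<le>j. a i\<bar> \<le> \<Lambda> * sqrt (real (j + 1))" and \<Lambda>: "\<Lambda> \<ge> 0"
    and u: "0 < u" "u \<le> 1" and nz: "initial_poly a k \<noteq> 0"
  shows "2 ^ root_count {1 - u<..1} (initial_poly a k) * \<bar>poly (initial_poly a k) (1 - u)\<bar>
     \<le> \<Lambda> * sqrt (real (k + 1)) * (1 + u) ^ k * (3 * u * real k + 1)"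
proof -
  let ?p = "initial_poly a k"
  let ?B = "\<Lambda> * sqrt (real (k + 1)) * (1 + u) ^ k * (3 * u * real k + 1)"
  let ?N = "root_count {1 - u<..1} ?p"
  have "norm (cpoly ?p (of_real (1 - u))) \<le> (1 / 2) ^ ?N * ?B"
  proof (rule jensen_root_bound[where c = "1 - u" and r = u and R = "2 * u" and \<rho> = 0])
    fix z :: complex assume z: "norm (z - of_real (1 - u)) = 2 * u"
    have n1: "norm (complex_of_real (1 - u)) = 1 - u" using u by (simp only: norm_of_real)
    have n2: "norm (complex_of_real u) = u" using u by simp
    have "norm z \<le> norm (z - of_real (1 - u)) + norm (complex_of_real (1 - u))"
      using norm_triangle_ineq[of "z - of_real (1 - u)" "of_real (1 - u)"] by simp
    then have z1: "norm z \<le> 1 + u" using z n1 by linarith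
    have "1 - z = of_real u - (z - of_real (1 - u))" by simp
    then have "norm (1 - z) \<le> norm (complex_of_real u) + norm (z - of_real (1 - u))"
      by (metis norm_triangle_ineq4)
    then have z2: "norm (1 - z) \<le> 3 * u" using z n2 by linarith
    have "norm (cpoly ?p z) \<le> \<Lambda> * sqrt (real (k + 1)) * (1 + u) ^ k * (norm (1 - z) * real k + 1)"
      unfolding cpoly_initial_poly using z1 u by (intro power_sum_bound_near_disc[OF S \<Lambda>]) auto
    also have "\<dots> \<le> ?B"
      using z2 \<Lambda> u by (intro mult_left_mono add_mono mult_right_mono) auto
    finally show "norm (cpoly ?p z) \<le> ?B" .
  qed (use nz u in \<open>auto simp: power2_eq_square\<close>)
  then have "\<bar>poly ?p (1 - u)\<bar> \<le> (1 / 2) ^ ?N * ?B"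
    unfolding cpoly_of_real norm_of_real .
  then have "2 ^ ?N * \<bar>poly ?p (1 - u)\<bar> \<le> 2 ^ ?N * ((1 / 2) ^ ?N * ?B)"
    by (intro mult_left_mono) auto
  also have "\<dots> = ?B" by (simp add: power_one_over)
  finally show ?thesis .
qed

text \<open>The disc of radius \<open>u/2\<close> about \<open>1 - u\<close> lies in the unit disc, at distance \<open>u/2\<close> from its boundary. Relative to
it the cell has size \<open>2\<delta>\<close>, so two roots would make the value at the centre smaller than the maximum by
\<open>(2\<delta>)\<^sup>2\<close>.\<close>

lemma root_count_cell:
  fixes a :: "nat \<Rightarrow> real"
  assumes S: "\<And>j. j \<le> k \<Longrightarrow> \<bar>\<Sum>i\<le>j. a i\<bar> \<le> \<Lambda> * sqrt (real (j + 1))" and \<Lambda>: "\<Lambda> \<ge> 0"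
    and u: "0 < u" "u \<le> 1" and \<delta>: "0 < \<delta>" "\<delta> < 1 / 2" and I: "I \<subseteq> {1 - u..1 - u + \<delta> * u}"
    and \<tau>: "48 * \<delta>\<^sup>2 * \<Lambda> \<le> \<tau>" and big: "\<bar>poly (initial_poly a k) (1 - u)\<bar> > \<tau> / (2 * sqrt u)"
  shows "root_count I (initial_poly a k) \<le> 1"
proof (rule ccontr)
  let ?p = "initial_poly a k"
  let ?N = "root_count I ?p"
  assume "\<not> ?N \<le> 1"
  then have N: "2 \<le> ?N" by simp
  have \<tau>0: "\<tau> \<ge> 0" using \<tau> \<Lambda> by (auto intro: order_trans[rotated])
  then have "\<tau> / (2 * sqrt u) \<ge> 0" using u by simp
  then have nz: "?p \<noteq> 0" using big by auto
  let ?B = "\<Lambda> * sqrt (2 / u) * 4"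
  have B0: "?B \<ge> 0" using \<Lambda> u by simp
  have "norm (cpoly ?p (of_real (1 - u))) \<le> (2 * \<delta>) ^ ?N * ?B"
  proof (rule jensen_root_bound[where c = "1 - u" and r = "\<delta> * u" and R = "u / 2" and \<rho> = 0])
    fix z :: complex assume z: "norm (z - of_real (1 - u)) = u / 2"
    have n1: "norm (complex_of_real (1 - u)) = 1 - u" using u by (simp only: norm_of_real)
    have n2: "norm (complex_of_real u) = u" using u by simp
    have "norm z \<le> norm (z - of_real (1 - u)) + norm (complex_of_real (1 - u))"
      using norm_triangle_ineq[of "z - of_real (1 - u)" "of_real (1 - u)"] by simp
    then have z1: "norm z \<le> 1 - u / 2" using z n1 by linarith
    have "1 - z = of_real u - (z - of_real (1 - u))" by simp
    then have "norm (1 - z) \<le> norm (complex_of_real u) + norm (z - of_real (1 - u))"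
      by (metis norm_triangle_ineq4)
    then have z2: "norm (1 - z) \<le> 3 / 2 * u" using z n2 by linarith
    have "norm (cpoly ?p z) \<le> \<Lambda> * sqrt (1 / (1 - (1 - u / 2))) * (norm (1 - z) / (1 - (1 - u / 2)) + 1)"
      unfolding cpoly_initial_poly using z1 u by (intro power_sum_bound_inside_disc[OF S \<Lambda>]) auto
    also have "\<dots> = \<Lambda> * sqrt (2 / u) * (norm (1 - z) * (2 / u) + 1)" by simp
    also have "\<dots> \<le> \<Lambda> * sqrt (2 / u) * ((3 / 2 * u) * (2 / u) + 1)"
      using z2 \<Lambda> u by (intro mult_left_mono add_mono mult_right_mono) auto
    also have "\<dots> = ?B" using u by simp
    finally show "norm (cpoly ?p z) \<le> ?B" .
  next
    show "I \<subseteq> {1 - u - \<delta> * u..1 - u + \<delta> * u}"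
      using I \<delta> u by (auto intro: order_trans[rotated])
  qed (use nz u \<delta> in \<open>auto simp: power2_eq_square mult_strict_right_mono\<close>)
  then have "\<bar>poly ?p (1 - u)\<bar> \<le> (2 * \<delta>) ^ ?N * ?B"
    unfolding cpoly_of_real norm_of_real .
  also have "\<dots> \<le> (2 * \<delta>)\<^sup>2 * ?B"
    using N \<delta> B0 by (intro mult_right_mono power_decreasing) auto
  also have "\<dots> = (16 * sqrt 2 * \<delta>\<^sup>2 * \<Lambda>) / sqrt u"
    by (simp add: real_sqrt_divide power_mult_distrib)
  also have "\<dots> \<le> (\<tau> / 2) / sqrt u"
  proof (rule divide_right_mono)
    have "sqrt 2 \<le> sqrt ((3 / 2)\<^sup>2)" by (intro real_sqrt_le_mono) (simp add: power2_eq_square)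
    also have "\<dots> = 3 / 2" by (simp only: real_sqrt_abs)
    finally have "16 * sqrt 2 * (\<delta>\<^sup>2 * \<Lambda>) \<le> 24 * (\<delta>\<^sup>2 * \<Lambda>)" using \<Lambda> by (intro mult_right_mono) auto
    also have "\<dots> \<le> \<tau> / 2" using \<tau> by simp
    finally show "16 * sqrt 2 * \<delta>\<^sup>2 * \<Lambda> \<le> \<tau> / 2" by (simp only: mult.assoc)
  qed (use u in auto)
  finally show False using big by simp
qed

text \<open>The grid points are \<open>1 - u i\<close>, running from \<open>1 - us\<close> down to \<open>1 - u K\<close>. At these points \<open>p\<^sub>n\<close> is at least
twice as large as the tail, so \<open>p\<^sub>k\<close> has the same sign and is not small either. The numbers \<open>NL\<close> and \<open>NR\<close>
bound the roots to the left and to the right of the grid.\<close>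

lemma root_count_difference:
  fixes a :: "nat \<Rightarrow> real"
  assumes nk: "n \<le> k"
    and S: "\<And>j. j \<le> k \<Longrightarrow> \<bar>\<Sum>i\<le>j. a i\<bar> \<le> \<Lambda> * sqrt (real (j + 1))" and \<Lambda>: "\<Lambda> \<ge> 0"
    and us: "0 < us" and \<delta>: "0 < \<delta>" "\<delta> < 1 / 2"
    and u_def: "u = (\<lambda>i. us * (1 + \<delta>) ^ i)" and uK: "u K \<le> 1 / 2"
    and big: "\<And>i. i \<le> K \<Longrightarrow> \<bar>poly (initial_poly a n) (1 - u i)\<bar> > \<tau> / sqrt (u i)"
    and \<tau>: "\<tau> > 0" "48 * \<delta>\<^sup>2 * \<Lambda> \<le> \<tau>"
    and tail: "\<And>i. i \<le> K \<Longrightarrow> 2 * (\<Lambda> * sqrt (real (k + 1))) * (1 - u i) ^ n \<le> \<tau> / (2 * sqrt (u i))"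
    and left: "\<And>l. l = n \<or> l = k \<Longrightarrow> initial_poly a l \<noteq> 0 \<Longrightarrow> real (root_count {0..1 - u K} (initial_poly a l)) \<le> NL"
    and right: "\<Lambda> * sqrt (real (k + 1)) * (1 + us) ^ k * (3 * us * real k + 1) \<le> 2 powr NR * (\<tau> / (2 * sqrt us))"
  shows "\<bar>real (root_count {0..1} (initial_poly a k)) - real (root_count {0..1} (initial_poly a n))\<bar> \<le> NL + NR"
proof -
  have upos: "0 < u i" for i using us \<delta> by (simp add: u_def)
  have umono: "u i \<le> u j" if "i \<le> j" for i j
    unfolding u_def using us \<delta> that by (intro mult_left_mono power_increasing) auto
  have ule: "u i \<le> 1 / 2" if "i \<le> K" for i using umono[OF that] uK by linarith
  have diff: "\<bar>poly (initial_poly a k) (1 - u i) - poly (initial_poly a n) (1 - u i)\<bar> \<le> \<tau> / (2 * sqrt (u i))" if "i \<le> K" for i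
  proof -
    have "\<bar>\<Sum>i\<le>j. a i\<bar> \<le> \<Lambda> * sqrt (real (k + 1))" if "j \<le> k" for j
    proof -
      have "\<Lambda> * sqrt (real (j + 1)) \<le> \<Lambda> * sqrt (real (k + 1))" using that \<Lambda> by (intro mult_left_mono) auto
      then show ?thesis using S[OF that] by linarith
    qed
    then have "\<bar>(\<Sum>j\<le>k. a j * (1 - u i) ^ j) - (\<Sum>j\<le>n. a j * (1 - u i) ^ j)\<bar> \<le> 2 * (\<Lambda> * sqrt (real (k + 1))) * (1 - u i) ^ n"
      using ule[OF that] upos[of i] nk by (intro tail_bound) auto
    then show ?thesis using tail[OF that] unfolding poly_initial_poly by linarith
  qed
  have half: "\<tau> / (2 * sqrt (u i)) > 0" "\<tau> / sqrt (u i) = 2 * (\<tau> / (2 * sqrt (u i)))" for i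
    using \<tau> upos[of i] by auto
  have bigl: "\<bar>poly (initial_poly a l) (1 - u i)\<bar> > \<tau> / (2 * sqrt (u i))" if "i \<le> K" "l = n \<or> l = k" for i l
  proof -
    have "\<bar>poly (initial_poly a n) (1 - u i)\<bar> > \<tau> / (2 * sqrt (u i))"
      "\<bar>poly (initial_poly a k) (1 - u i)\<bar> > \<tau> / (2 * sqrt (u i))"
      using big[OF that(1)] diff[OF that(1)] half[of i] by linarith+
    then show ?thesis using that(2) by blast
  qed
  have sign: "poly (initial_poly a k) (1 - u i) * poly (initial_poly a n) (1 - u i) > 0" if "i \<le> K" for i
  proof -
    have "poly (initial_poly a n) (1 - u i) > 0 \<and> poly (initial_poly a k) (1 - u i) > 0 \<or>
          poly (initial_poly a n) (1 - u i) < 0 \<and> poly (initial_poly a k) (1 - u i) < 0"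
      using big[OF that] diff[OF that] half[of i] by linarith
    then show ?thesis by (auto simp: mult_neg_neg)
  qed
  have nz: "initial_poly a l \<noteq> 0" if "l = n \<or> l = k" for l
    using bigl[OF le0 that] half(1)[of 0] by auto
  have lk: "l \<le> k" if "l = n \<or> l = k" for l using that nk by auto
  have Sl: "\<bar>\<Sum>i\<le>j. a i\<bar> \<le> \<Lambda> * sqrt (real (j + 1))" if "l = n \<or> l = k" "j \<le> l" for l j
    using S[of j] lk[OF that(1)] that(2) by simp
  have "1 - u K \<le> 1 - u 0 \<and> root_count {1 - u K<..1 - u 0} (initial_poly a k) = root_count {1 - u K<..1 - u 0} (initial_poly a n)"
  proof (rule root_count_eq_on_grid)
    fix i assume i: "i < K"
    have su: "u (Suc i) = u i + \<delta> * u i" by (simp add: u_def algebra_simps)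
    then show lt: "1 - u (Suc i) < 1 - u i" using upos[of i] \<delta> by simp
    have cell: "root_count {1 - u (Suc i)<..1 - u i} (initial_poly a l) \<le> 1" if l: "l = n \<or> l = k" for l
    proof (rule root_count_cell[OF Sl[OF l] \<Lambda> upos[of "Suc i"] _ \<delta> _ \<tau>(2)])
      show "u (Suc i) \<le> 1" using ule[of "Suc i"] i by simp
      show "\<tau> / (2 * sqrt (u (Suc i))) < \<bar>poly (initial_poly a l) (1 - u (Suc i))\<bar>"
        using bigl[OF _ l, of "Suc i"] i by simp
      have "u i \<le> u (Suc i)" by (rule umono) simp
      then have "\<delta> * u i \<le> \<delta> * u (Suc i)" using \<delta> by (intro mult_left_mono) auto
      then show "{1 - u (Suc i)<..1 - u i} \<subseteq> {1 - u (Suc i)..1 - u (Suc i) + \<delta> * u (Suc i)}"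
        using su by auto
    qed
    show "root_count {1 - u (Suc i)<..1 - u i} (initial_poly a k) = root_count {1 - u (Suc i)<..1 - u i} (initial_poly a n)"
      using lt sign[of i] sign[of "Suc i"] i by (intro root_count_eq_of_signs nz cell) auto
  qed
  then have mid: "root_count {1 - u K<..1 - u 0} (initial_poly a k) = root_count {1 - u K<..1 - u 0} (initial_poly a n)" by simp
  have u0: "u 0 = us" by (simp add: u_def)
  have rightl: "real (root_count {1 - us<..1} (initial_poly a l)) \<le> NR" if l: "l = n \<or> l = k" for l
  proof -
    let ?N = "root_count {1 - us<..1} (initial_poly a l)"
    have us1: "us \<le> 1" using ule[of 0] u0 by simp
    have "2 ^ ?N * (\<tau> / (2 * sqrt us)) \<le> 2 ^ ?N * \<bar>poly (initial_poly a l) (1 - us)\<bar>"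
      using bigl[OF le0 l] u0 by (intro mult_left_mono) auto
    also have "\<dots> \<le> \<Lambda> * sqrt (real (l + 1)) * (1 + us) ^ l * (3 * us * real l + 1)"
      by (rule root_count_right[OF Sl[OF l] \<Lambda> us us1 nz[OF l]])
    also have "\<dots> \<le> \<Lambda> * sqrt (real (k + 1)) * (1 + us) ^ k * (3 * us * real k + 1)"
      using lk[OF l] \<Lambda> us by (intro mult_mono power_increasing add_mono mult_left_mono) auto
    also have "\<dots> \<le> 2 powr NR * (\<tau> / (2 * sqrt us))" by (rule right)
    finally have "2 ^ ?N \<le> 2 powr NR" using \<tau> us by (simp add: divide_le_cancel)
    then have "2 powr real ?N \<le> 2 powr NR" by (simp add: powr_realpow)
    then show ?thesis by simp
  qed
  have split: "root_count {0..1} p = root_count {0..1 - u K} p + (root_count {1 - u K<..1 - u 0} p + root_count {1 - us<..1} p)" for p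
  proof -
    have "u 0 \<le> u K" by (rule umono) simp
    then have s: "{0..1} = {0..1 - u K} \<union> ({1 - u K<..1 - u 0} \<union> {1 - us<..1})"
      using ule[of K] upos[of 0] u0 by auto
    show ?thesis unfolding s using u0 \<open>u 0 \<le> u K\<close>
      by (subst root_count_union; (subst root_count_union)?) auto
  qed
  have ll: "real (root_count {0..1 - u K} (initial_poly a l)) \<le> NL" if "l = n \<or> l = k" for l
    by (rule left[OF that nz[OF that]])
  show ?thesis
    using ll[of n] ll[of k] rightl[of n] rightl[of k] mid
    unfolding split by (simp add: abs_le_iff)
qed

text \<open>The choice of scales. All error terms are powers of \<open>n\<close> whose exponents are multiples of \<open>\<alpha>\<close>. The tail at the
grid is below \<open>n powr (-\<alpha>/4 + s)\<close> relative to the typical size, and two roots in a cell correspond to the relative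
size \<open>n powr (-2b + s)\<close>; both lie below \<open>\<tau> = n powr (-19b/10)\<close> for \<open>b = \<alpha>/10\<close> and \<open>s \<le> b/20\<close>. The hypotheses
that compare constants and logarithms with powers of \<open>n\<close>, or with \<open>\<kappa> L\<close>, hold for all large \<open>n\<close>.\<close>

lemma root_count_comparison:
  fixes a :: "nat \<Rightarrow> real" and n k K J :: nat
    and \<epsilon> c \<alpha> b s us \<delta> \<tau> w \<rho> q \<eta> \<kappa> L :: real and u :: "nat \<Rightarrow> real"
  assumes L: "L = ln (real n)" "n \<ge> 2"
    and \<epsilon>: "\<epsilon> > 0" and c: "c > 1" and \<alpha>: "0 < \<alpha>" "\<alpha> * c \<le> \<epsilon> / 16" and b: "b = \<alpha> / 10"
    and s: "0 < s" "s \<le> b / 20" "s \<le> \<kappa>"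
    and us: "us = \<alpha> * L / real n" and \<delta>: "\<delta> = real n powr (- b)" and \<tau>: "\<tau> = real n powr (- (19 / 10 * b))"
    and u: "u = (\<lambda>i. us * (1 + \<delta>) ^ i)" "u K \<le> 1 / 2" "w \<le> u K" "0 < w"
    and q: "0 < \<rho>" "\<rho> < 1 - w / 2" "0 < q" "q < 1" "(1 - w / 2) * ((1 - w) + \<rho>) \<le> q * ((1 - w / 2)\<^sup>2 - (1 - w) * \<rho>)"
    and \<kappa>: "\<kappa> = \<epsilon> * ln (1 / q) / 16" and \<eta>: "\<eta> * ln (1 / \<rho>) \<le> \<kappa>"
    and n1: "48 \<le> real n powr (b / 20)" and n2: "4 * sqrt (c + 1) \<le> real n powr (\<alpha> / 4)"
    and n3: "2 * sqrt (\<alpha> * (c + 1) * L) * (3 * \<alpha> * c * L + 1) \<le> real n powr (\<epsilon> / 16)"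
    and n4: "ln (2 * (sqrt (2 / w) * (4 / w + 1))) \<le> \<kappa> * L"
    and nk: "n \<le> k" "real k \<le> c * real n"
    and S: "\<And>j. j \<le> k \<Longrightarrow> \<bar>\<Sum>i\<le>j. a i\<bar> \<le> real n powr s * sqrt (real (j + 1))"
    and big: "\<And>i. i \<le> K \<Longrightarrow> \<bar>poly (initial_poly a n) (1 - u i)\<bar> > \<tau> / sqrt (u i)"
    and J: "J \<le> n" "real J \<le> \<eta> * L" "\<bar>a J\<bar> \<ge> 1 / 2"
  shows "\<bar>real (root_count {0..1} (initial_poly a k)) - real (root_count {0..1} (initial_poly a n))\<bar> \<le> \<epsilon> / 2 * L"
proof -
  define \<Lambda> where "\<Lambda> = real n powr s"
  have n: "real n \<ge> 2" "real n > 0" "real n \<ge> 1" using L by auto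
  have L0: "L > 0" using L by simp
  have us0: "us > 0" using us \<alpha> L0 n by simp
  have b0: "b > 0" using b \<alpha> by simp
  have nL: "real n powr y = exp (y * L)" for y using n L by (simp add: powr_def)
  have mono: "real n powr x \<le> real n powr y" if "x \<le> y" for x y using that n by (intro powr_mono) auto
  have k1: "real (k + 1) \<le> (c + 1) * real n" using nk n by (simp add: algebra_simps)
  have "real n powr (b / 20) \<le> real n powr b" using b0 by (intro mono) simp
  then have "48 \<le> real n powr b" using n1 by linarith
  then have "1 / real n powr b \<le> 1 / 48" using n by (intro divide_left_mono) auto
  then have \<delta>2: "\<delta> < 1 / 2" unfolding \<delta> powr_minus_divide by linarith
  have \<delta>0: "\<delta> > 0" using \<delta> n by simp
  have \<tau>0: "\<tau> > 0" using \<tau> n by simp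
  have umono: "us \<le> u i" "u i \<le> u K" if "i \<le> K" for i
  proof -
    have "us * 1 \<le> us * (1 + \<delta>) ^ i" using us0 \<delta>0 by (intro mult_left_mono one_le_power) auto
    then show "us \<le> u i" by (simp add: u(1))
    show "u i \<le> u K" unfolding u(1) using us0 \<delta>0 that by (intro mult_left_mono power_increasing) auto
  qed
  have tau: "48 * \<delta>\<^sup>2 * \<Lambda> \<le> \<tau>"
  proof -
    have "\<delta>\<^sup>2 * \<Lambda> = real n powr (s - 2 * b)"
      by (simp add: \<delta> \<Lambda>_def power2_eq_square powr_add[symmetric])
    then have "48 * (\<delta>\<^sup>2 * \<Lambda>) \<le> real n powr (b / 20) * real n powr (s - 2 * b)"
      using n1 by (simp add: mult_right_mono)
    also have "\<dots> = real n powr (b / 20 + (s - 2 * b))" by (rule powr_add[symmetric])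
    also have "\<dots> \<le> \<tau>" unfolding \<tau> using s by (intro mono) linarith
    finally show ?thesis by simp
  qed
  have tail: "2 * (\<Lambda> * sqrt (real (k + 1))) * (1 - u i) ^ n \<le> \<tau> / (2 * sqrt (u i))" if i: "i \<le> K" for i
  proof -
    define y where "y = real n * u i"
    have ui: "0 < u i" "u i \<le> 1 / 2" using umono[OF i] us0 u(2) by auto
    have y: "y > 0" using ui n by (simp add: y_def)
    have yl: "\<alpha> * L \<le> y"
    proof -
      have "real n * us \<le> real n * u i" using umono(1)[OF i] by (intro mult_left_mono) auto
      then show ?thesis using n by (simp add: us y_def)
    qed
    have "(1 - u i) ^ n \<le> exp (- u i) ^ n"
      using ui exp_ge_add_one_self[of "- u i"] by (intro power_mono) auto
    also have "\<dots> = exp (- y)" by (simp add: y_def exp_of_nat_mult[symmetric])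
    finally have e1: "(1 - u i) ^ n \<le> exp (- y)" .
    (* Half of the decay exp (-y) pays for the factor sqrt (u i). *)
    have "sqrt y \<le> sqrt (exp y)"
      using exp_ge_add_one_self[of y] by (intro real_sqrt_le_mono) linarith
    also have "sqrt (exp y) = exp (y / 2)" by (rule real_sqrt_unique) (simp_all add: power2_eq_square exp_add[symmetric])
    finally have e2: "sqrt y \<le> exp (y / 2)" .
    have "sqrt (real (k + 1)) * sqrt (u i) = sqrt (real (k + 1) * u i)" by (simp only: real_sqrt_mult)
    also have "\<dots> \<le> sqrt ((c + 1) * y)"
    proof (rule real_sqrt_le_mono)
      have "real (k + 1) * u i \<le> ((c + 1) * real n) * u i" using k1 ui by (intro mult_right_mono) auto
      then show "real (k + 1) * u i \<le> (c + 1) * y" by (simp add: y_def mult.assoc)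
    qed
    also have "\<dots> = sqrt (c + 1) * sqrt y" by (rule real_sqrt_mult)
    also have "\<dots> \<le> sqrt (c + 1) * exp (y / 2)" using e2 c by (intro mult_left_mono) auto
    finally have e3: "sqrt (real (k + 1)) * sqrt (u i) \<le> sqrt (c + 1) * exp (y / 2)" .
    have "4 * \<Lambda> * ((sqrt (real (k + 1)) * sqrt (u i)) * (1 - u i) ^ n) \<le> 4 * \<Lambda> * ((sqrt (c + 1) * exp (y / 2)) * exp (- y))"
    proof (rule mult_left_mono)
      show "(sqrt (real (k + 1)) * sqrt (u i)) * (1 - u i) ^ n \<le> (sqrt (c + 1) * exp (y / 2)) * exp (- y)"
        by (rule mult_mono[OF e3 e1]) (use ui c in auto)
    qed (simp add: \<Lambda>_def)
    also have "\<dots> = \<Lambda> * (4 * sqrt (c + 1)) * exp (- (y / 2))"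
      by (simp add: exp_add[symmetric] mult_ac)
    also have "\<dots> \<le> \<Lambda> * real n powr (\<alpha> / 4) * exp (- (\<alpha> * L / 2))"
      using n2 yl by (intro mult_mono mult_left_mono) (auto simp: \<Lambda>_def)
    also have "\<dots> = real n powr (s + \<alpha> / 4 - \<alpha> / 2)"
      unfolding \<Lambda>_def nL by (simp add: exp_add[symmetric] algebra_simps)
    also have "\<dots> \<le> \<tau>" unfolding \<tau> using s b \<alpha> by (intro mono) linarith
    finally have "4 * \<Lambda> * ((sqrt (real (k + 1)) * sqrt (u i)) * (1 - u i) ^ n) \<le> \<tau>" .
    then show ?thesis using ui by (simp add: pos_le_divide_eq mult_ac)
  qed
  have left: "real (root_count {0..1 - u K} (initial_poly a l)) \<le> \<epsilon> / 4 * L"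
    if l: "l = n \<or> l = k" and nz: "initial_poly a l \<noteq> 0" for l
  proof -
    let ?N = "root_count {0..1 - u K} (initial_poly a l)"
    define C where "C = sqrt (2 / w) * (4 / w + 1)"
    have w1: "w \<le> 1" using u by linarith
    have C: "C > 0" unfolding C_def using u(4) by (intro mult_pos_pos add_pos_pos) auto
    have "1 / 2 * \<rho> ^ J \<le> q ^ ?N * (\<Lambda> * sqrt (2 / w) * (4 / w + 1))"
    proof (rule root_count_left[where w = w and a = a and k = l])
      show "\<bar>\<Sum>i\<le>j. a i\<bar> \<le> \<Lambda> * sqrt (real (j + 1))" if "j \<le> l" for j
        unfolding \<Lambda>_def using l nk that by (intro S) auto
    qed (use u w1 q J l nk nz in \<open>auto simp: \<Lambda>_def\<close>)
    moreover have "q ^ ?N * (\<Lambda> * (2 * C)) = 2 * (q ^ ?N * (\<Lambda> * sqrt (2 / w) * (4 / w + 1)))"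
      by (simp only: C_def mult_ac)
    ultimately have "\<rho> ^ J \<le> q ^ ?N * (\<Lambda> * (2 * C))" by linarith
    then have "ln (\<rho> ^ J) \<le> ln (q ^ ?N * (\<Lambda> * (2 * C)))" using q by (intro ln_mono) auto
    also have "\<dots> = real ?N * ln q + (s * L + ln (2 * C))"
      using q C n L by (simp add: ln_mult ln_realpow \<Lambda>_def ln_powr)
    finally have "real J * ln \<rho> \<le> real ?N * ln q + (s * L + ln (2 * C))"
      using q by (simp add: ln_realpow)
    then have "real ?N * ln (1 / q) \<le> real J * ln (1 / \<rho>) + s * L + ln (2 * C)"
      using q by (simp add: ln_div)
    also have "real J * ln (1 / \<rho>) \<le> \<kappa> * L"
    proof -
      have "0 \<le> ln (1 / \<rho>)" using q u(4) by simp
      then have "real J * ln (1 / \<rho>) \<le> (\<eta> * L) * ln (1 / \<rho>)" using J by (intro mult_right_mono) auto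
      also have "\<dots> = (\<eta> * ln (1 / \<rho>)) * L" by simp
      also have "\<dots> \<le> \<kappa> * L" using \<eta> L0 by (intro mult_right_mono) auto
      finally show ?thesis .
    qed
    also have "s * L \<le> \<kappa> * L" using s L0 by (intro mult_right_mono) auto
    also have "ln (2 * C) \<le> \<kappa> * L" using n4 by (simp add: C_def)
    finally have "real ?N * ln (1 / q) \<le> 3 * (\<kappa> * L)" by linarith
    also have "\<dots> = (3 / 16 * \<epsilon> * L) * ln (1 / q)" by (simp add: \<kappa>)
    finally have "real ?N \<le> 3 / 16 * \<epsilon> * L"
      using q by (subst (asm) mult_le_cancel_right_pos) auto
    also have "\<dots> \<le> \<epsilon> / 4 * L" using \<epsilon> L0 by simp
    finally show ?thesis .
  qed
  have right: "\<Lambda> * sqrt (real (k + 1)) * (1 + us) ^ k * (3 * us * real k + 1) \<le> 2 powr (\<epsilon> / 4 * L) * (\<tau> / (2 * sqrt us))"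
  proof -
    have usk: "us * real k \<le> \<alpha> * c * L"
    proof -
      have "us * real k \<le> us * (c * real n)" using nk us0 by (intro mult_left_mono) auto
      then show ?thesis using n by (simp add: us mult_ac)
    qed
    have "(1 + us) ^ k \<le> exp us ^ k" using us0 exp_ge_add_one_self[of us] by (intro power_mono) auto
    also have "\<dots> = exp (us * real k)" by (simp add: exp_of_nat_mult[symmetric] mult.commute)
    also have "\<dots> \<le> exp (\<alpha> * c * L)" using usk by simp
    finally have e1: "(1 + us) ^ k \<le> real n powr (\<alpha> * c)" unfolding nL .
    have "sqrt (real (k + 1)) * sqrt us = sqrt (real (k + 1) * us)" by (simp only: real_sqrt_mult)
    also have "\<dots> \<le> sqrt (\<alpha> * (c + 1) * L)"
    proof (rule real_sqrt_le_mono)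
      have "real (k + 1) * us \<le> ((c + 1) * real n) * us" using k1 us0 by (intro mult_right_mono) auto
      then show "real (k + 1) * us \<le> \<alpha> * (c + 1) * L" using n by (simp add: us mult_ac)
    qed
    finally have e2: "sqrt (real (k + 1)) * sqrt us \<le> sqrt (\<alpha> * (c + 1) * L)" .
    have e3: "3 * us * real k + 1 \<le> 3 * \<alpha> * c * L + 1" using usk by simp
    have "\<Lambda> * sqrt (real (k + 1)) * (1 + us) ^ k * (3 * us * real k + 1) * (2 * sqrt us)
        = \<Lambda> * (1 + us) ^ k * (2 * (sqrt (real (k + 1)) * sqrt us) * (3 * us * real k + 1))"
      by (simp only: mult_ac)
    also have "\<dots> \<le> \<Lambda> * real n powr (\<alpha> * c) * (2 * sqrt (\<alpha> * (c + 1) * L) * (3 * \<alpha> * c * L + 1))"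
      using e1 e2 e3 us0 \<alpha> c L0 by (intro mult_mono mult_left_mono mult_nonneg_nonneg add_nonneg_nonneg) (auto simp: \<Lambda>_def)
    also have "\<dots> \<le> \<Lambda> * real n powr (\<alpha> * c) * real n powr (\<epsilon> / 16)"
      using n3 by (intro mult_left_mono) (auto simp: \<Lambda>_def)
    also have "\<dots> = real n powr (s + \<alpha> * c + \<epsilon> / 16)"
      unfolding \<Lambda>_def by (simp only: powr_add)
    also have "\<dots> \<le> real n powr (ln 2 * (\<epsilon> / 4) + - (19 / 10 * b))"
    proof (rule mono)
      have "2 / 3 * (\<epsilon> / 4) \<le> ln 2 * (\<epsilon> / 4)" using ln2_ge_two_thirds \<epsilon> by (intro mult_right_mono) auto
      moreover have "\<alpha> \<le> \<alpha> * c" using \<alpha> c by (simp add: mult_left_le)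
      ultimately show "s + \<alpha> * c + \<epsilon> / 16 \<le> ln 2 * (\<epsilon> / 4) + - (19 / 10 * b)"
        using s b \<alpha> \<epsilon> by linarith
    qed
    also have "\<dots> = 2 powr (\<epsilon> / 4 * L) * \<tau>"
      unfolding \<tau> powr_add by (simp add: powr_def L(1)[symmetric] mult_ac)
    finally show ?thesis using us0 by (simp add: pos_le_divide_eq)
  qed
  have "\<bar>real (root_count {0..1} (initial_poly a k)) - real (root_count {0..1} (initial_poly a n))\<bar> \<le> \<epsilon> / 4 * L + \<epsilon> / 4 * L"
    by (rule root_count_difference[OF nk(1) S[folded \<Lambda>_def] _ us0 \<delta>0 \<delta>2 u(1,2) big \<tau>0 tau tail left right])
       (auto simp: \<Lambda>_def)
  then show ?thesis by linarith
qed

section \<open>The Cauchy kernel and characteristic functions\<close>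

abbreviation exp_measure :: "real measure" where
  "exp_measure \<equiv> density lborel (exponential_density 1)"

lemma exp_cos_antideriv:
  fixes l z g :: real assumes "l > 0"
  shows "((\<lambda>g. exp (- l * g) * (z * sin (g * z) - l * cos (g * z)) / (l\<^sup>2 + z\<^sup>2)) has_real_derivative exp (- l * g) * cos (g * z)) (at g)"
proof -
  have nz: "l\<^sup>2 + z\<^sup>2 \<noteq> 0" using assms by (simp add: sum_power2_eq_zero_iff)
  have "((\<lambda>g. exp (- l * g) * (z * sin (g * z) - l * cos (g * z))) has_real_derivative
      exp (- l * g) * cos (g * z) * (l\<^sup>2 + z\<^sup>2)) (at g)"
    by (auto intro!: derivative_eq_intros) (simp add: algebra_simps power2_eq_square)
  from DERIV_cdivide[OF this, of "l\<^sup>2 + z\<^sup>2"] show ?thesis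
    unfolding nonzero_mult_div_cancel_right[OF nz] .
qed

text \<open>Integrals against the standard exponential distribution. For \<open>l = 0\<close> this exhibits the Cauchy kernel
\<open>1/(1 + z\<^sup>2)\<close> as a mixture of cosines; for \<open>z = 0\<close> it is the Laplace transform.\<close>

lemma exp_cos_integral:
  fixes l z :: real assumes l: "l > -1"
  shows "integrable exp_measure (\<lambda>g. exp (- l * g) * cos (g * z))"
    and "(\<integral>g. exp (- l * g) * cos (g * z) \<partial>exp_measure) = (l + 1) / ((l + 1)\<^sup>2 + z\<^sup>2)"
proof -
  define L where "L = l + 1"
  have L: "L > 0" using l by (simp add: L_def)
  have ie: "set_integrable lborel {0<..} (\<lambda>g. exp (- L * g))"
  proof -
    have "integrable lborel (exponential_density L)"
      using prob_space_exponential_density[OF L]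
      by (intro integrableI_nonneg) (auto simp: exponential_density_nonneg L prob_space_def prob_space_axioms_def emeasure_density dest!: prob_space.emeasure_space_1)
    then have "integrable lborel (\<lambda>g. (1 / L) * (indicator {0<..} g *\<^sub>R exponential_density L g))"
      by (intro integrable_mult_right integrable_mult_indicator) auto
    moreover have "(1 / L) * (indicator {0<..} g *\<^sub>R exponential_density L g) = indicator {0<..} g *\<^sub>R exp (- L * g)" for g
      using L by (auto simp: exponential_density_def indicator_def)
    ultimately show ?thesis unfolding set_integrable_def by simp
  qed
  have ic: "set_integrable lborel {0<..} (\<lambda>g. exp (- L * g) * cos (g * z))"
  proof (rule set_integrable_bound[OF ie])
    show "AE x in lborel. x \<in> {0<..} \<longrightarrow> norm (exp (- L * x) * cos (x * z)) \<le> norm (exp (- L * x))"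
      by (auto simp: abs_mult mult_left_le)
  qed (auto simp: set_borel_measurable_def)
  have ee: "einterval 0 \<infinity> = {0<..}" by (auto simp: einterval_def)
  have fundamental: "(LBINT g=0..\<infinity>. exp (- L * g) * cos (g * z)) = 0 - (- L / (L\<^sup>2 + z\<^sup>2))"
  proof (rule interval_integral_FTC_integrable)
    show "((\<lambda>g. exp (- L * g) * (z * sin (g * z) - L * cos (g * z)) / (L\<^sup>2 + z\<^sup>2)) has_vector_derivative exp (- L * x) * cos (x * z)) (at x)" for x
      using exp_cos_antideriv[OF L, of z x] by (simp add: has_real_derivative_iff_has_vector_derivative)
    show "set_integrable lborel (einterval 0 \<infinity>) (\<lambda>x. exp (- L * x) * cos (x * z))"
      unfolding ee by (rule ic)
    have "((\<lambda>g. exp (- L * g) * (z * sin (g * z) - L * cos (g * z)) / (L\<^sup>2 + z\<^sup>2)) \<longlongrightarrow> exp (- L * 0) * (z * sin (0 * z) - L * cos (0 * z)) / (L\<^sup>2 + z\<^sup>2)) (at_right 0)"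
      using L by (intro tendsto_intros) (auto simp: sum_power2_eq_zero_iff)
    then show "(((\<lambda>g. exp (- L * g) * (z * sin (g * z) - L * cos (g * z)) / (L\<^sup>2 + z\<^sup>2)) \<circ> real_of_ereal) \<longlongrightarrow> - L / (L\<^sup>2 + z\<^sup>2)) (at_right 0)"
      by (simp add: zero_ereal_def ereal_tendsto_simps)
    have lim: "((\<lambda>g. (\<bar>z\<bar> + L) / (L\<^sup>2 + z\<^sup>2) * exp (- L * g)) \<longlongrightarrow> 0) at_top"
      using L by real_asymp
    have bound: "norm (exp (- L * g) * (z * sin (g * z) - L * cos (g * z)) / (L\<^sup>2 + z\<^sup>2)) \<le> (\<bar>z\<bar> + L) / (L\<^sup>2 + z\<^sup>2) * exp (- L * g)" for g
    proof -
      have "\<bar>z * sin (g * z)\<bar> \<le> \<bar>z\<bar> * 1" "\<bar>L * cos (g * z)\<bar> \<le> L * 1"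
        using mult_left_mono[OF abs_sin_le_one abs_ge_zero] mult_left_mono[OF abs_cos_le_one abs_ge_zero[of L]] L
        by (auto simp: abs_mult)
      then have "\<bar>z * sin (g * z) - L * cos (g * z)\<bar> \<le> \<bar>z\<bar> + L" by linarith
      then have "exp (- L * g) * \<bar>z * sin (g * z) - L * cos (g * z)\<bar> / (L\<^sup>2 + z\<^sup>2) \<le> exp (- L * g) * (\<bar>z\<bar> + L) / (L\<^sup>2 + z\<^sup>2)"
        by (intro divide_right_mono mult_left_mono) auto
      then show ?thesis by (simp add: abs_mult mult.commute)
    qed
    have "((\<lambda>g. exp (- L * g) * (z * sin (g * z) - L * cos (g * z)) / (L\<^sup>2 + z\<^sup>2)) \<longlongrightarrow> 0) at_top"
      by (rule Lim_null_comparison[OF always_eventually[OF allI[OF bound]] lim])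
    then show "(((\<lambda>g. exp (- L * g) * (z * sin (g * z) - L * cos (g * z)) / (L\<^sup>2 + z\<^sup>2)) \<circ> real_of_ereal) \<longlongrightarrow> 0) (at_left \<infinity>)"
      by (simp add: ereal_tendsto_simps)
  qed (auto intro!: continuous_intros)
  have dens: "AE g in lborel. exponential_density 1 g *\<^sub>R (exp (- l * g) * cos (g * z)) = indicator {0<..} g *\<^sub>R (exp (- L * g) * cos (g * z))"
  proof -
    have "AE g in lborel. g \<noteq> (0::real)" by (rule AE_lborel_singleton)
    then show ?thesis
    proof eventually_elim
      case (elim g)
      have "exp (- g) * exp (- l * g) = exp (- L * g)"
        unfolding exp_add[symmetric] L_def by (simp add: algebra_simps)
      then show ?case using elim by (simp add: exponential_density_def indicator_def mult.assoc[symmetric])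
    qed
  qed
  have m: "(\<lambda>g. exp (- l * g) * cos (g * z)) \<in> borel_measurable lborel" by measurable
  have int0: "integrable lborel (\<lambda>g. indicator {0<..} g *\<^sub>R (exp (- L * g) * cos (g * z)))"
    using ic unfolding set_integrable_def .
  show "integrable exp_measure (\<lambda>g. exp (- l * g) * cos (g * z))"
    using int0 dens by (subst integrable_density) (auto simp: exponential_density_nonneg intro: integrable_cong_AE_imp)
  have "(\<integral>g. exp (- l * g) * cos (g * z) \<partial>exp_measure) = (\<integral>g. exponential_density 1 g *\<^sub>R (exp (- l * g) * cos (g * z)) \<partial>lborel)"
    by (subst integral_density) (auto simp: exponential_density_nonneg)
  also have "\<dots> = (\<integral>g. indicator {0<..} g *\<^sub>R (exp (- L * g) * cos (g * z)) \<partial>lborel)"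
    using dens by (intro integral_cong_AE) auto
  also have "\<dots> = (LBINT g=0..\<infinity>. exp (- L * g) * cos (g * z))"
    by (simp add: interval_lebesgue_integral_def ee set_lebesgue_integral_def)
  finally show "(\<integral>g. exp (- l * g) * cos (g * z) \<partial>exp_measure) = (l + 1) / ((l + 1)\<^sup>2 + z\<^sup>2)"
    unfolding fundamental by (simp only: L_def diff_0 minus_divide_left minus_minus)
qed

text \<open>By Fubini, integrating the mixture of cosines against a distribution gives a mixture of values of its
characteristic function.\<close>

lemma (in real_distribution) cauchy_kernel_le_char:
  fixes \<sigma> a :: real
  assumes "\<sigma> > 0"
  shows "(\<integral>x. 1 / (1 + ((x - a) / \<sigma>)\<^sup>2) \<partial>M) \<le> (\<integral>g. norm (char M (g / \<sigma>)) \<partial>exp_measure)"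
proof -
  interpret E: prob_space exp_measure by (rule prob_space_exponential_density) simp
  interpret P: pair_prob_space M exp_measure ..
  have c: "1 / (1 + ((x - a) / \<sigma>)\<^sup>2) = (\<integral>g. cos (g * ((x - a) / \<sigma>)) \<partial>exp_measure)" for x
    using exp_cos_integral(2)[of 0 "(x - a) / \<sigma>"] by simp
  have int: "integrable (M \<Otimes>\<^sub>M exp_measure) (\<lambda>(x, g). cos (g * ((x - a) / \<sigma>)))"
    by (rule P.integrable_const_bound[of _ 1]) (auto simp: split_beta)
  have "(\<integral>x. 1 / (1 + ((x - a) / \<sigma>)\<^sup>2) \<partial>M) = (\<integral>g. (\<integral>x. cos (g * ((x - a) / \<sigma>)) \<partial>M) \<partial>exp_measure)"
    unfolding c using P.Fubini_integral[OF int] by simp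
  also have "\<dots> \<le> (\<integral>g. norm (char M (g / \<sigma>)) \<partial>exp_measure)"
  proof (rule integral_mono)
    show "integrable exp_measure (\<lambda>g. \<integral>x. cos (g * ((x - a) / \<sigma>)) \<partial>M)"
      using P.integrable_snd[OF int] by simp
    show "integrable exp_measure (\<lambda>g. norm (char M (g / \<sigma>)))"
      by (rule E.integrable_const_bound[of _ 1]) (auto simp: cmod_char_le_1)
    fix g :: real
    have "(\<integral>x. cos (g * ((x - a) / \<sigma>)) \<partial>M) = (\<integral>x. Re (iexp (- (g * a / \<sigma>)) * iexp (g / \<sigma> * x)) \<partial>M)"
      by (intro Bochner_Integration.integral_cong) (auto simp: exp_add[symmetric] Re_exp diff_divide_distrib algebra_simps)
    also have "\<dots> = Re (\<integral>x. iexp (- (g * a / \<sigma>)) * iexp (g / \<sigma> * x) \<partial>M)"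
      by (intro integral_Re integrable_mult_right integrable_iexp) auto
    also have "\<dots> = Re (iexp (- (g * a / \<sigma>)) * char M (g / \<sigma>))"
      unfolding char_def by simp
    also have "\<dots> \<le> norm (iexp (- (g * a / \<sigma>)) * char M (g / \<sigma>))" by (rule complex_Re_le_cmod)
    also have "\<dots> = norm (char M (g / \<sigma>))" by (simp add: norm_mult)
    finally show "(\<integral>x. cos (g * ((x - a) / \<sigma>)) \<partial>M) \<le> norm (char M (g / \<sigma>))" .
  qed
  finally show ?thesis .
qed

text \<open>A Gaussian bound on a long interval of frequencies spreads the distribution out at every scale \<open>\<sigma>\<close> that is not
too small.\<close>

lemma (in real_distribution) cauchy_kernel_bound:
  fixes \<sigma> a T :: real
  assumes \<sigma>: "\<sigma> > 0" and T: "T > 0" and ch: "\<And>t. \<bar>t\<bar> \<le> T \<Longrightarrow> norm (char M t) \<le> exp (- t\<^sup>2 / 16)"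
  shows "(\<integral>x. 1 / (1 + ((x - a) / \<sigma>)\<^sup>2) \<partial>M) \<le> 8 * \<sigma> + 4 / (T * \<sigma>)"
proof -
  interpret E: prob_space exp_measure by (rule prob_space_exponential_density) simp
  have i1: "integrable exp_measure (\<lambda>g. exp (- l * g))" "(\<integral>g. exp (- l * g) \<partial>exp_measure) = 1 / (l + 1)" if "l > -1" for l :: real
    using exp_cos_integral[OF that, of 0] that by (auto simp: power2_eq_square)
  (* Below the frequency T the Gaussian is majorised by an exponential, using (y - 1/2)^2 >= 0; above T the
     trivial bound 1 is majorised by an increasing exponential. Both have explicit Laplace transforms. *)
  have pw: "norm (char M (g / \<sigma>)) \<le> 2 * exp (- (1 / (4 * \<sigma>)) * g) + exp (- (T * \<sigma>) / 2) * exp (- (-1/2) * g)" if "g \<ge> 0" for g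
  proof (cases "g \<le> T * \<sigma>")
    case True
    define y where "y = g / (4 * \<sigma>)"
    have "\<bar>g / \<sigma>\<bar> \<le> T" using True that \<sigma> by (simp add: field_simps)
    then have "norm (char M (g / \<sigma>)) \<le> exp (- (g / \<sigma>)\<^sup>2 / 16)" by (rule ch)
    also have "\<dots> = exp (- y\<^sup>2)" by (simp add: y_def power_divide power_mult_distrib)
    also have "\<dots> \<le> exp (1 / 4 + (- y))"
    proof -
      have "(y - 1 / 2)\<^sup>2 \<ge> 0" by simp
      then show ?thesis by (simp add: power2_eq_square algebra_simps)
    qed
    also have "\<dots> = exp (1/4) * exp (- y)" by (rule exp_add)
    also have "\<dots> \<le> 2 * exp (- y)"
    proof -
      have "exp (1 / 4 :: real) \<le> 1 + 1/4 + (1/4)\<^sup>2" by (rule exp_bound) auto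
      also have "\<dots> \<le> (2::real)" by (simp add: power2_eq_square)
      finally show ?thesis by simp
    qed
    finally show ?thesis by (simp add: y_def add_increasing2)
  next
    case False
    have "norm (char M (g / \<sigma>)) \<le> 1" by (rule cmod_char_le_1)
    also have "1 \<le> exp (- (T * \<sigma>) / 2 + - (-1/2) * g)" using False by simp
    also have "\<dots> = exp (- (T * \<sigma>) / 2) * exp (- (-1/2) * g)" by (rule exp_add)
    finally show ?thesis by (simp add: add_increasing)
  qed
  have "(\<integral>x. 1 / (1 + ((x - a) / \<sigma>)\<^sup>2) \<partial>M) \<le> (\<integral>g. norm (char M (g / \<sigma>)) \<partial>exp_measure)"
    by (rule cauchy_kernel_le_char[OF \<sigma>])
  also have "\<dots> \<le> (\<integral>g. 2 * exp (- (1 / (4 * \<sigma>)) * g) + exp (- (T * \<sigma>) / 2) * exp (- (-1/2) * g) \<partial>exp_measure)"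
  proof (rule integral_mono_AE)
    show "integrable exp_measure (\<lambda>g. norm (char M (g / \<sigma>)))"
      by (rule E.integrable_const_bound[of _ 1]) (auto simp: cmod_char_le_1)
    have "-1 < 1 / (4 * \<sigma>)" using \<sigma> by (smt (verit) divide_pos_pos)
    then show "integrable exp_measure (\<lambda>g. 2 * exp (- (1 / (4 * \<sigma>)) * g) + exp (- (T * \<sigma>) / 2) * exp (- (-1/2) * g))"
      by (intro Bochner_Integration.integrable_add integrable_mult_right i1) auto
    have "AE g in exp_measure. g \<ge> 0"
      by (subst AE_density) (auto simp: exponential_density_def)
    then show "AE g in exp_measure. norm (char M (g / \<sigma>)) \<le> 2 * exp (- (1 / (4 * \<sigma>)) * g) + exp (- (T * \<sigma>) / 2) * exp (- (-1/2) * g)"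
      by eventually_elim (rule pw)
  qed
  also have "\<dots> = 2 * (1 / (1 / (4 * \<sigma>) + 1)) + exp (- (T * \<sigma>) / 2) * 2"
  proof -
    have l: "-1 < 1 / (4 * \<sigma>)" using \<sigma> by (smt (verit) divide_pos_pos)
    show ?thesis
      using i1(1)[OF l] i1(1)[of "-1/2"] i1(2)[OF l] i1(2)[of "-1/2"] by (simp del: mult_minus_left)
  qed
  also have "2 * (1 / (1 / (4 * \<sigma>) + 1)) \<le> 8 * \<sigma>"
    using \<sigma> by (simp add: field_simps)
  also have "exp (- (T * \<sigma>) / 2) * 2 \<le> 4 / (T * \<sigma>)"
  proof -
    have "T * \<sigma> / 2 \<le> exp (T * \<sigma> / 2)" using exp_ge_add_one_self[of "T * \<sigma> / 2"] by linarith
    then show ?thesis using \<sigma> T by (simp add: exp_minus field_simps)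
  qed
  finally show ?thesis by simp
qed

section \<open>Consequences of the moment condition\<close>

lemma (in prob_space)
  fixes X :: "'a \<Rightarrow> real" and e0 K :: real
  assumes rv [measurable]: "random_variable borel X" and e0: "e0 > 0"
    and int: "integrable M (\<lambda>\<omega>. \<bar>X \<omega>\<bar> powr (2 + e0))"
  shows square_integrable_of_moment: "integrable M (\<lambda>\<omega>. (X \<omega>)\<^sup>2)"
    and integrable_of_moment: "integrable M X"
proof -
  have b: "y\<^sup>2 \<le> 1 + \<bar>y\<bar> powr (2 + e0)" for y :: real
  proof (cases "\<bar>y\<bar> \<le> 1")
    case True
    then have "y\<^sup>2 \<le> 1" by (simp add: abs_square_le_1)
    then show ?thesis by (simp add: add_increasing2)
  next
    case False
    then have "\<bar>y\<bar> powr 2 \<le> \<bar>y\<bar> powr (2 + e0)" using e0 by (intro powr_mono) auto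
    then show ?thesis using False by (simp add: powr_numeral)
  qed
  show 1: "integrable M (\<lambda>\<omega>. (X \<omega>)\<^sup>2)"
  proof (rule Bochner_Integration.integrable_bound[of M "\<lambda>\<omega>. 1 + \<bar>X \<omega>\<bar> powr (2 + e0)"])
    show "AE \<omega> in M. norm ((X \<omega>)\<^sup>2) \<le> norm (1 + \<bar>X \<omega>\<bar> powr (2 + e0))"
      using b by (auto simp: abs_of_nonneg)
  qed (use int in auto)
  show "integrable M X" by (rule square_integrable_imp_integrable[OF rv 1])
qed

text \<open>In the second order expansion of the characteristic function the remainder is
\<open>E min (6 X\<^sup>2) (\<bar>t\<bar> \<bar>X\<bar>\<^sup>3)\<close> up to \<open>t\<^sup>2/6\<close>, and the moment of order \<open>2 + e0\<close> makes it a small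
multiple of 1 for small \<open>t\<close>, uniformly in the law of \<open>X\<close>.\<close>

lemma (in prob_space) char_bound_near_zero:
  fixes X :: "'a \<Rightarrow> real" and e0 K t :: real
  assumes rv [measurable]: "random_variable borel X" and e0: "e0 > 0"
    and int: "integrable M (\<lambda>\<omega>. \<bar>X \<omega>\<bar> powr (2 + e0))" and K: "expectation (\<lambda>\<omega>. \<bar>X \<omega>\<bar> powr (2 + e0)) \<le> K"
    and mean: "expectation X = 0" and var: "variance X = 1"
    and t1: "\<bar>t\<bar> \<le> 1" and t: "\<bar>t\<bar> powr min e0 1 * (1 + K) \<le> 1 / 4"
  shows "norm (char (distr M borel X) t) \<le> exp (- t\<^sup>2 / 4)"
proof -
  define e where "e = min e0 1"
  have e: "0 < e" "e \<le> 1" "e \<le> e0" using e0 by (auto simp: e_def)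
  have m: "min (6 * x\<^sup>2) (\<bar>t\<bar> * \<bar>x\<bar> ^ 3) \<le> 6 * \<bar>t\<bar> powr e * (1 + \<bar>x\<bar> powr (2 + e0))" for x :: real
  proof -
    define y where "y = \<bar>t\<bar> * \<bar>x\<bar>"
    have y0: "y \<ge> 0" by (simp add: y_def)
    have "min (6 * x\<^sup>2) (\<bar>t\<bar> * \<bar>x\<bar> ^ 3) \<le> 6 * x\<^sup>2 * y powr e"
    proof (cases "y \<le> 1")
      case True
      have "y \<le> y powr e"
      proof (cases "y = 0")
        case False
        then have "y powr 1 \<le> y powr e" using True y0 e by (intro powr_mono') auto
        then show ?thesis using False y0 by simp
      qed simp
      then have "x\<^sup>2 * y \<le> x\<^sup>2 * y powr e" by (intro mult_left_mono) auto
      moreover have "\<bar>t\<bar> * \<bar>x\<bar> ^ 3 = x\<^sup>2 * y" by (simp add: y_def power3_eq_cube power2_eq_square)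
      moreover have "0 \<le> x\<^sup>2 * y powr e" by simp
      ultimately show ?thesis by linarith
    next
      case False
      then have "1 \<le> y powr e" using e by (intro ge_one_powr_ge_zero) auto
      then have "6 * x\<^sup>2 * 1 \<le> 6 * x\<^sup>2 * y powr e" by (intro mult_left_mono) auto
      then show ?thesis by linarith
    qed
    also have "6 * x\<^sup>2 * y powr e = 6 * \<bar>t\<bar> powr e * (x\<^sup>2 * \<bar>x\<bar> powr e)"
      unfolding y_def by (subst powr_mult) auto
    also have "x\<^sup>2 * \<bar>x\<bar> powr e \<le> 1 + \<bar>x\<bar> powr (2 + e0)"
    proof (cases "\<bar>x\<bar> \<le> 1")
      case True
      then have "x\<^sup>2 * \<bar>x\<bar> powr e \<le> 1 * 1" using e
        by (intro mult_mono) (auto simp: abs_square_le_1 powr_le1)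
      then show ?thesis by (simp add: add_increasing2)
    next
      case False
      then have "x\<^sup>2 * \<bar>x\<bar> powr e = \<bar>x\<bar> powr (2 + e)" by (simp add: powr_add)
      also have "\<dots> \<le> \<bar>x\<bar> powr (2 + e0)" using False e by (intro powr_mono) auto
      finally show ?thesis by simp
    qed
    finally show ?thesis by (simp add: mult_left_mono)
  qed
  have "norm (char (distr M borel X) t - (1 - t\<^sup>2 * 1 / 2)) \<le>
      (t\<^sup>2 / 6) * expectation (\<lambda>\<omega>. min (6 * (X \<omega>)\<^sup>2) (\<bar>t\<bar> * \<bar>X \<omega>\<bar> ^ 3))"
    using char_approx3'[OF rv integrable_of_moment[OF rv e0 int] square_integrable_of_moment[OF rv e0 int] mean var refl] by simp
  also have "expectation (\<lambda>\<omega>. min (6 * (X \<omega>)\<^sup>2) (\<bar>t\<bar> * \<bar>X \<omega>\<bar> ^ 3)) \<le>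
      expectation (\<lambda>\<omega>. 6 * \<bar>t\<bar> powr e * (1 + \<bar>X \<omega>\<bar> powr (2 + e0)))"
  proof (rule integral_mono)
    show "integrable M (\<lambda>\<omega>. min (6 * (X \<omega>)\<^sup>2) (\<bar>t\<bar> * \<bar>X \<omega>\<bar> ^ 3))"
      by (rule Bochner_Integration.integrable_bound[of M "\<lambda>\<omega>. 6 * (X \<omega>)\<^sup>2"])
         (use square_integrable_of_moment[OF rv e0 int] in auto)
  qed (use int m in auto)
  also have "\<dots> = 6 * \<bar>t\<bar> powr e * (1 + expectation (\<lambda>\<omega>. \<bar>X \<omega>\<bar> powr (2 + e0)))"
    using int by (simp add: prob_space)
  also have "\<dots> \<le> 6 * \<bar>t\<bar> powr e * (1 + K)" using K by (intro mult_left_mono) auto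
  also have "\<dots> \<le> 6 * (1 / 4)" using t unfolding e_def by linarith
  finally have "norm (char (distr M borel X) t - (1 - t\<^sup>2 / 2)) \<le> t\<^sup>2 / 6 * (6 * (1 / 4))"
    by (simp add: mult_left_mono)
  moreover have "norm (1 - complex_of_real (t\<^sup>2) / 2) = 1 - t\<^sup>2 / 2"
  proof -
    have "t\<^sup>2 \<le> 1" using t1 by (simp add: abs_square_le_1)
    moreover have "1 - complex_of_real (t\<^sup>2) / 2 = of_real (1 - t\<^sup>2 / 2)" by simp
    ultimately show ?thesis by (simp only: norm_of_real)
  qed
  moreover have "norm (char (distr M borel X) t) \<le> norm (char (distr M borel X) t - (1 - t\<^sup>2 / 2)) + norm (1 - complex_of_real (t\<^sup>2) / 2)"
    using norm_triangle_ineq[of "char (distr M borel X) t - (1 - t\<^sup>2 / 2)" "1 - t\<^sup>2 / 2"] by simp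
  ultimately have "norm (char (distr M borel X) t) \<le> 1 + (- t\<^sup>2 / 4)" by simp
  also have "\<dots> \<le> exp (- t\<^sup>2 / 4)" by (rule exp_ge_add_one_self)
  finally show ?thesis .
qed

text \<open>Values below \<open>1/2\<close> carry at most a quarter of the second moment, and so do values beyond \<open>A\<close>, by the higher
moment. The remaining half must come from values in between, where \<open>X\<^sup>2 \<le> A\<^sup>2\<close>.\<close>

lemma (in prob_space) prob_not_small:
  fixes X :: "'a \<Rightarrow> real" and e0 K A :: real
  assumes rv [measurable]: "random_variable borel X" and e0: "e0 > 0"
    and int: "integrable M (\<lambda>\<omega>. \<bar>X \<omega>\<bar> powr (2 + e0))" and K: "expectation (\<lambda>\<omega>. \<bar>X \<omega>\<bar> powr (2 + e0)) \<le> K"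
    and sq: "expectation (\<lambda>\<omega>. (X \<omega>)\<^sup>2) = 1"
    and A: "A > 0" "A powr (- e0) * K \<le> 1 / 4"
  shows "prob {\<omega> \<in> space M. \<bar>X \<omega>\<bar> \<ge> 1 / 2} \<ge> 1 / (2 * A\<^sup>2)"
proof -
  let ?L = "{\<omega> \<in> space M. \<bar>X \<omega>\<bar> \<ge> 1 / 2}"
  have pw: "x\<^sup>2 \<le> 1 / 4 + A\<^sup>2 * (if \<bar>x\<bar> \<ge> 1 / 2 then 1 else 0) + A powr (- e0) * \<bar>x\<bar> powr (2 + e0)" for x :: real
  proof -
    have nn: "0 \<le> A powr (- e0) * \<bar>x\<bar> powr (2 + e0)" by simp
    consider "\<bar>x\<bar> < 1 / 2" | "\<bar>x\<bar> \<ge> 1 / 2" "\<bar>x\<bar> \<le> A" | "\<bar>x\<bar> > A" "\<bar>x\<bar> \<ge> 1 / 2" by linarith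
    then show ?thesis
    proof cases
      case 1
      then have "\<bar>x\<bar>\<^sup>2 \<le> (1 / 2)\<^sup>2" by (intro power_mono) auto
      then have "x\<^sup>2 \<le> 1 / 4" by (simp add: power_divide)
      moreover have "A\<^sup>2 * (if \<bar>x\<bar> \<ge> 1 / 2 then 1 else 0) = 0" using 1 by simp
      ultimately show ?thesis using nn by linarith
    next
      case 2
      then have "\<bar>x\<bar>\<^sup>2 \<le> A\<^sup>2" by (intro power_mono) auto
      moreover have "A\<^sup>2 * (if \<bar>x\<bar> \<ge> 1 / 2 then 1 else 0) = A\<^sup>2" using 2 by simp
      ultimately show ?thesis using nn power2_abs[of x] by linarith
    next
      case 3
      have "x\<^sup>2 = \<bar>x\<bar> powr (2 + e0) * \<bar>x\<bar> powr (- e0)" using 3 A by (subst powr_add[symmetric]) simp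
      also have "\<dots> \<le> \<bar>x\<bar> powr (2 + e0) * A powr (- e0)"
        using 3 A e0 by (intro mult_left_mono powr_mono2') auto
      finally show ?thesis using 3 by (simp add: mult.commute add_increasing)
    qed
  qed
  have "1 = expectation (\<lambda>\<omega>. (X \<omega>)\<^sup>2)" using sq by simp
  also have "\<dots> \<le> expectation (\<lambda>\<omega>. 1 / 4 + A\<^sup>2 * indicator ?L \<omega> + A powr (- e0) * \<bar>X \<omega>\<bar> powr (2 + e0))"
  proof (rule integral_mono)
    show "integrable M (\<lambda>\<omega>. (X \<omega>)\<^sup>2)" by (rule square_integrable_of_moment[OF rv e0 int])
    show "integrable M (\<lambda>\<omega>. 1 / 4 + A\<^sup>2 * indicator ?L \<omega> + A powr (- e0) * \<bar>X \<omega>\<bar> powr (2 + e0))"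
      using int by (intro Bochner_Integration.integrable_add integrable_mult_right integrable_real_indicator) (auto simp: emeasure_eq_measure)
    fix \<omega> assume "\<omega> \<in> space M"
    then show "(X \<omega>)\<^sup>2 \<le> 1 / 4 + A\<^sup>2 * indicator ?L \<omega> + A powr (- e0) * \<bar>X \<omega>\<bar> powr (2 + e0)"
    proof -
      have "indicator ?L \<omega> = (if \<bar>X \<omega>\<bar> \<ge> 1 / 2 then 1 else 0 :: real)"
        using \<open>\<omega> \<in> space M\<close> by (simp add: indicator_def)
      then show ?thesis using pw[of "X \<omega>"] by (simp only:)
    qed
  qed
  also have "\<dots> = 1 / 4 + A\<^sup>2 * prob ?L + A powr (- e0) * expectation (\<lambda>\<omega>. \<bar>X \<omega>\<bar> powr (2 + e0))"
    using int by (subst Bochner_Integration.integral_add; (subst Bochner_Integration.integral_add)?)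
      (auto simp: prob_space emeasure_eq_measure intro!: integrable_real_indicator)
  also have "A powr (- e0) * expectation (\<lambda>\<omega>. \<bar>X \<omega>\<bar> powr (2 + e0)) \<le> A powr (- e0) * K"
    using K by (intro mult_left_mono) auto
  finally have "1 / 2 \<le> A\<^sup>2 * prob ?L" using A(2) by simp
  then show ?thesis using A(1) by (simp add: field_simps)
qed

section \<open>Sums of independent coefficients\<close>

text \<open>The three quantitative consequences of the moment condition on which the argument rests: unit variance,
Gaussian decay of the characteristic functions near 0, and a uniform lower bound for the probability of not being
small.\<close>

locale unit_sequence = prob_space M for M :: "'a measure" +
  fixes \<xi> :: "nat \<Rightarrow> 'a \<Rightarrow> real" and t0 p0 :: real
  assumes indep: "indep_vars (\<lambda>_. borel) \<xi> UNIV"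
    and mean: "\<And>j. expectation (\<xi> j) = 0"
    and square_integrable: "\<And>j. integrable M (\<lambda>\<omega>. (\<xi> j \<omega>)\<^sup>2)"
    and square: "\<And>j. expectation (\<lambda>\<omega>. (\<xi> j \<omega>)\<^sup>2) = 1"
    and t0: "t0 > 0"
    and char_le: "\<And>j t. \<bar>t\<bar> \<le> t0 \<Longrightarrow> norm (char (distr M borel (\<xi> j)) t) \<le> exp (- t\<^sup>2 / 4)"
    and p0: "0 < p0" "p0 \<le> 1"
    and not_small: "\<And>j. prob {\<omega> \<in> space M. \<bar>\<xi> j \<omega>\<bar> \<ge> 1 / 2} \<ge> p0"
begin

lemma rv [measurable]: "random_variable borel (\<xi> j)"
  using indep unfolding indep_vars_def by auto

lemma integrable_xi: "integrable M (\<xi> j)"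
  by (rule square_integrable_imp_integrable[OF rv square_integrable])

lemma indep_blocks:
  assumes "A \<inter> B = {}" and "F \<in> borel_measurable (PiM A (\<lambda>_. borel))" and "G \<in> borel_measurable (PiM B (\<lambda>_. borel))"
  shows "indep_var borel (\<lambda>\<omega>. F (\<lambda>i\<in>A. \<xi> i \<omega>)) borel (\<lambda>\<omega>. G (\<lambda>i\<in>B. \<xi> i \<omega>))"
  using indep_var_compose[OF indep_var_restrict[OF indep assms(1) subset_UNIV subset_UNIV] assms(2,3)]
  by (simp add: comp_def)

lemma indep_linear_blocks:
  assumes "A \<inter> B = {}" "finite A" "finite B"
  shows "indep_var borel (\<lambda>\<omega>. \<Sum>i\<in>A. c i * \<xi> i \<omega>) borel (\<lambda>\<omega>. \<Sum>i\<in>B. d i * \<xi> i \<omega>)"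
proof -
  have "indep_var borel (\<lambda>\<omega>. \<Sum>i\<in>A. c i * (\<lambda>i\<in>A. \<xi> i \<omega>) i) borel (\<lambda>\<omega>. \<Sum>i\<in>B. d i * (\<lambda>i\<in>B. \<xi> i \<omega>) i)"
    by (rule indep_blocks[OF assms(1), of "\<lambda>f. \<Sum>i\<in>A. c i * f i" "\<lambda>f. \<Sum>i\<in>B. d i * f i"]) measurable
  then show ?thesis by simp
qed

lemma cross_integrable: "integrable M (\<lambda>\<omega>. \<xi> i \<omega> * \<xi> j \<omega>)"
  and cross: "expectation (\<lambda>\<omega>. \<xi> i \<omega> * \<xi> j \<omega>) = (if i = j then 1 else 0)"
proof -
  have "integrable M (\<lambda>\<omega>. \<xi> i \<omega> * \<xi> j \<omega>) \<and> expectation (\<lambda>\<omega>. \<xi> i \<omega> * \<xi> j \<omega>) = (if i = j then 1 else 0)"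
  proof (cases "i = j")
    case True
    then show ?thesis using square_integrable[of j] square[of j] by (simp add: power2_eq_square)
  next
    case False
    then have "indep_var borel (\<xi> i) borel (\<xi> j)"
      using indep_linear_blocks[of "{i}" "{j}" "\<lambda>_. 1" "\<lambda>_. 1"] by simp
    from indep_var_lebesgue_integral[OF this integrable_xi integrable_xi] indep_var_integrable[OF this integrable_xi integrable_xi]
    show ?thesis using False mean by simp
  qed
  then show "integrable M (\<lambda>\<omega>. \<xi> i \<omega> * \<xi> j \<omega>)" "expectation (\<lambda>\<omega>. \<xi> i \<omega> * \<xi> j \<omega>) = (if i = j then 1 else 0)" by auto
qed

lemma
  assumes "finite A"
  shows linear_square_integrable: "integrable M (\<lambda>\<omega>. (\<Sum>i\<in>A. c i * \<xi> i \<omega>)\<^sup>2)"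
    and linear_square: "expectation (\<lambda>\<omega>. (\<Sum>i\<in>A. c i * \<xi> i \<omega>)\<^sup>2) = (\<Sum>i\<in>A. (c i)\<^sup>2)"
proof -
  have e: "(\<Sum>i\<in>A. c i * \<xi> i \<omega>)\<^sup>2 = (\<Sum>i\<in>A. \<Sum>j\<in>A. (c i * c j) * (\<xi> i \<omega> * \<xi> j \<omega>))" for \<omega>
    by (simp add: power2_eq_square sum_product mult_ac)
  show "integrable M (\<lambda>\<omega>. (\<Sum>i\<in>A. c i * \<xi> i \<omega>)\<^sup>2)"
    unfolding e by (intro Bochner_Integration.integrable_sum integrable_mult_right cross_integrable)
  have "expectation (\<lambda>\<omega>. (\<Sum>i\<in>A. c i * \<xi> i \<omega>)\<^sup>2) = (\<Sum>i\<in>A. \<Sum>j\<in>A. (c i * c j) * (if i = j then 1 else 0))"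
    unfolding e by (simp add: Bochner_Integration.integral_sum cross_integrable cross integrable_mult_right)
  also have "\<dots> = (\<Sum>i\<in>A. (c i)\<^sup>2)"
    using assms by (intro sum.cong) (auto simp: power2_eq_square if_distrib cong: if_cong)
  finally show "expectation (\<lambda>\<omega>. (\<Sum>i\<in>A. c i * \<xi> i \<omega>)\<^sup>2) = (\<Sum>i\<in>A. (c i)\<^sup>2)" .
qed

lemma prob_all_small:
  "prob {\<omega> \<in> space M. \<forall>j<J. \<bar>\<xi> j \<omega>\<bar> < 1 / 2} \<le> (1 - p0) ^ J"
proof (cases "J = 0")
  case False
  have "prob (\<Inter>j\<in>{..<J}. \<xi> j -` {-1/2<..<1/2} \<inter> space M) = (\<Prod>j<J. prob (\<xi> j -` {-1/2<..<1/2} \<inter> space M))"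
    by (rule indep_varsD[OF indep]) (use False in auto)
  also have "\<dots> \<le> (\<Prod>j<J. 1 - p0)"
  proof (rule prod_mono, safe)
    fix j
    have "\<xi> j -` {-1/2<..<1/2} \<inter> space M = space M - {\<omega> \<in> space M. \<bar>\<xi> j \<omega>\<bar> \<ge> 1 / 2}" by auto
    then have "prob (\<xi> j -` {-1/2<..<1/2} \<inter> space M) = 1 - prob {\<omega> \<in> space M. \<bar>\<xi> j \<omega>\<bar> \<ge> 1 / 2}"
      by (simp add: prob_compl)
    then show "prob (\<xi> j -` {-1/2<..<1/2} \<inter> space M) \<le> 1 - p0" using not_small[of j] by simp
  qed simp
  also have "(\<Inter>j\<in>{..<J}. \<xi> j -` {-1/2<..<1/2} \<inter> space M) = {\<omega> \<in> space M. \<forall>j<J. \<bar>\<xi> j \<omega>\<bar> < 1 / 2}"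
  proof -
    have "x \<in> {-1/2<..<1/2} \<longleftrightarrow> \<bar>x\<bar> < 1 / 2" for x :: real
      unfolding greaterThanLessThan_iff by linarith
    then show ?thesis using False by (auto simp del: greaterThanLessThan_iff)
  qed
  finally show ?thesis by simp
qed simp

text \<open>Kolmogorov's argument: on the event \<open>A k\<close> that level \<open>L\<close> is first reached at time \<open>k\<close>, the later increment \<open>V\<close>
is centred and independent of the past, so \<open>S N\<close> has on average at least the square \<open>L\<^sup>2\<close> there.\<close>

lemma kolmogorov_maximal:
  assumes L: "L > 0"
  shows "prob {\<omega> \<in> space M. \<exists>k\<le>N. \<bar>\<Sum>i\<le>k. \<xi> i \<omega>\<bar> \<ge> L} \<le> real (N + 1) / L\<^sup>2"
proof -
  define S where "S k \<omega> = (\<Sum>i\<le>k. \<xi> i \<omega>)" for k \<omega>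
  define A where "A k = {\<omega> \<in> space M. \<bar>S k \<omega>\<bar> \<ge> L \<and> (\<forall>j<k. \<bar>S j \<omega>\<bar> < L)}" for k
  have [measurable]: "S k \<in> borel_measurable M" for k unfolding S_def by measurable
  have A [measurable]: "A k \<in> sets M" for k unfolding A_def by measurable
  have Sint: "integrable M (\<lambda>\<omega>. (S k \<omega>)\<^sup>2)" for k
    using linear_square_integrable[of "{..k}" "\<lambda>_. 1"] by (simp add: S_def)
  have step: "L\<^sup>2 * prob (A k) \<le> expectation (\<lambda>\<omega>. (S N \<omega>)\<^sup>2 * indicator (A k) \<omega>)" if "k \<le> N" for k
  proof -
    define U where "U \<omega> = (if \<bar>S k \<omega>\<bar> \<ge> L \<and> (\<forall>j<k. \<bar>S j \<omega>\<bar> < L) then S k \<omega> else 0)" for \<omega>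
    define V where "V \<omega> = S N \<omega> - S k \<omega>" for \<omega>
    have V: "V \<omega> = (\<Sum>i\<in>{k<..N}. \<xi> i \<omega>)" for \<omega>
    proof -
      have "{..N} = {..k} \<union> {k<..N}" "{..k} \<inter> {k<..N} = {}" using that by auto
      then show ?thesis by (simp add: V_def S_def sum.union_disjoint)
    qed
    (* U as a function of the first coefficients only, to make the independence of U and V visible. *)
    define F where "F f = (if \<bar>\<Sum>i\<le>k. f i\<bar> \<ge> L \<and> (\<forall>j<k. \<bar>\<Sum>i\<le>j. f i\<bar> < L) then \<Sum>i\<le>k. f i else 0)" for f :: "nat \<Rightarrow> real"
    have m [measurable]: "(\<lambda>f. \<Sum>i\<le>j. f i) \<in> borel_measurable (PiM {..k} (\<lambda>_. borel :: real measure))" if "j \<le> k" for j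
      using that by (intro borel_measurable_sum measurable_component_singleton) auto
    have Fm: "F \<in> borel_measurable (PiM {..k} (\<lambda>_. borel))"
    proof -
      have "{f \<in> space (PiM {..k} (\<lambda>_. borel :: real measure)). \<bar>\<Sum>i\<le>k. f i\<bar> \<ge> L \<and> (\<forall>j\<in>{..<k}. \<bar>\<Sum>i\<le>j. f i\<bar> < L)} \<in> sets (PiM {..k} (\<lambda>_. borel))"
        by (intro sets.sets_Collect_conj sets.sets_Collect_finite_All borel_measurable_le borel_measurable_less borel_measurable_abs m) auto
      then show ?thesis unfolding F_def
        by (intro measurable_If m) (auto simp: Ball_def)
    qed
    have ind: "indep_var borel (\<lambda>\<omega>. F (\<lambda>i\<in>{..k}. \<xi> i \<omega>)) borel (\<lambda>\<omega>. \<Sum>i\<in>{k<..N}. (\<lambda>i\<in>{k<..N}. \<xi> i \<omega>) i)"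
      by (rule indep_blocks[OF _ Fm, of _ "\<lambda>f. \<Sum>i\<in>{k<..N}. f i"]) auto
    have FU: "F (\<lambda>i\<in>{..k}. \<xi> i \<omega>) = U \<omega>" for \<omega>
    proof -
      have e: "(\<Sum>i\<le>j. (\<lambda>i\<in>{..k}. \<xi> i \<omega>) i) = S j \<omega>" if "j \<le> k" for j
        unfolding S_def using that by (intro sum.cong) auto
      have "(\<forall>j<k. \<bar>\<Sum>i\<le>j. (\<lambda>i\<in>{..k}. \<xi> i \<omega>) i\<bar> < L) \<longleftrightarrow> (\<forall>j<k. \<bar>S j \<omega>\<bar> < L)"
        using e[OF less_imp_le] by (simp only: cong: all_cong imp_cong)
      then show ?thesis unfolding F_def U_def e[OF order_refl] by (rule arg_cong2[where f = "\<lambda>P x. if \<bar>S k \<omega>\<bar> \<ge> L \<and> P then x else 0"]) (rule refl)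
    qed
    have FV: "(\<Sum>i\<in>{k<..N}. (\<lambda>i\<in>{k<..N}. \<xi> i \<omega>) i) = V \<omega>" for \<omega>
      unfolding V by (intro sum.cong) auto
    have UV: "indep_var borel U borel V" using ind unfolding FU FV .
    have Si: "integrable M (S k)" for k
      unfolding S_def by (intro Bochner_Integration.integrable_sum integrable_xi)
    have Ui: "integrable M U"
      by (rule Bochner_Integration.integrable_bound[OF Si[of k] indep_var_rv1[OF UV]]) (simp add: U_def)
    have Vi: "integrable M V" unfolding V_def using Si by auto
    have EV: "expectation V = 0"
      unfolding V by (simp add: Bochner_Integration.integral_sum integrable_xi mean)
    have UVi: "integrable M (\<lambda>\<omega>. U \<omega> * V \<omega>)" by (rule indep_var_integrable[OF UV Ui Vi])
    have EUV: "expectation (\<lambda>\<omega>. U \<omega> * V \<omega>) = 0"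
      using indep_var_lebesgue_integral[OF UV Ui Vi] EV by simp
    have Ii: "integrable M (\<lambda>\<omega>. L\<^sup>2 * indicator (A k) \<omega> :: real)"
      by (intro integrable_mult_right integrable_real_indicator) (auto simp: emeasure_eq_measure)
    have "L\<^sup>2 * prob (A k) = expectation (\<lambda>\<omega>. L\<^sup>2 * indicator (A k) \<omega> + 2 * (U \<omega> * V \<omega>))"
      using Ii UVi EUV by (subst Bochner_Integration.integral_add) auto
    also have "\<dots> \<le> expectation (\<lambda>\<omega>. (S N \<omega>)\<^sup>2 * indicator (A k) \<omega>)"
    proof (rule integral_mono)
      show "integrable M (\<lambda>\<omega>. L\<^sup>2 * indicator (A k) \<omega> + 2 * (U \<omega> * V \<omega>))"
        using UVi by (intro Bochner_Integration.integrable_add[OF Ii]) auto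
      show "integrable M (\<lambda>\<omega>. (S N \<omega>)\<^sup>2 * indicator (A k) \<omega>)"
        using integrable_mult_indicator[OF A Sint[of N], of k] by (simp add: mult.commute)
      fix \<omega> assume "\<omega> \<in> space M"
      show "L\<^sup>2 * indicator (A k) \<omega> + 2 * (U \<omega> * V \<omega>) \<le> (S N \<omega>)\<^sup>2 * indicator (A k) \<omega>"
      proof (cases "\<omega> \<in> A k")
        case True
        have "L\<^sup>2 \<le> \<bar>S k \<omega>\<bar>\<^sup>2" using True L unfolding A_def by (intro power_mono) auto
        moreover have "(S N \<omega>)\<^sup>2 = (S k \<omega>)\<^sup>2 + 2 * (S k \<omega> * V \<omega>) + (V \<omega>)\<^sup>2"
          by (simp add: V_def power2_eq_square algebra_simps)
        moreover have "(V \<omega>)\<^sup>2 \<ge> 0" by simp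
        moreover have "U \<omega> * V \<omega> = S k \<omega> * V \<omega>" using True by (auto simp: U_def A_def)
        ultimately have "L\<^sup>2 + 2 * (U \<omega> * V \<omega>) \<le> (S N \<omega>)\<^sup>2" using power2_abs[of "S k \<omega>"] by linarith
        then show ?thesis using True by simp
      next
        case False
        then have "U \<omega> = 0" using \<open>\<omega> \<in> space M\<close> by (auto simp: U_def A_def)
        then show ?thesis using False by simp
      qed
    qed
    finally show ?thesis .
  qed
  have dis: "disjoint_family_on A {..N}"
    unfolding disjoint_family_on_def A_def by (auto simp: not_less) (metis not_less nat_neq_iff)
  have U: "{\<omega> \<in> space M. \<exists>k\<le>N. \<bar>S k \<omega>\<bar> \<ge> L} = (\<Union>k\<in>{..N}. A k)"
  proof safe
    fix \<omega> k assume *: "\<omega> \<in> space M" "k \<le> N" "\<bar>S k \<omega>\<bar> \<ge> L"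
    define l where "l = (LEAST k. \<bar>S k \<omega>\<bar> \<ge> L)"
    have l: "\<bar>S l \<omega>\<bar> \<ge> L" unfolding l_def by (rule LeastI) (rule *)
    have "l \<le> k" unfolding l_def by (rule Least_le) (rule *)
    moreover have "\<bar>S j \<omega>\<bar> < L" if "j < l" for j
      using not_less_Least[of j "\<lambda>k. \<bar>S k \<omega>\<bar> \<ge> L"] that unfolding l_def by (simp add: not_le)
    ultimately show "\<omega> \<in> (\<Union>k\<in>{..N}. A k)" using l * unfolding A_def by auto
  qed (auto simp: A_def)
  have "L\<^sup>2 * prob (\<Union>k\<in>{..N}. A k) = L\<^sup>2 * (\<Sum>k\<le>N. prob (A k))"
    by (subst finite_measure_finite_Union[OF _ _ dis]) (use A in auto)
  also have "\<dots> = (\<Sum>k\<le>N. L\<^sup>2 * prob (A k))" by (rule sum_distrib_left)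
  also have "\<dots> \<le> (\<Sum>k\<le>N. expectation (\<lambda>\<omega>. (S N \<omega>)\<^sup>2 * indicator (A k) \<omega>))"
    by (intro sum_mono step) auto
  also have "\<dots> = expectation (\<lambda>\<omega>. \<Sum>k\<le>N. (S N \<omega>)\<^sup>2 * indicator (A k) \<omega>)"
    using integrable_mult_indicator[OF A Sint[of N]]
    by (subst Bochner_Integration.integral_sum) (auto simp: mult.commute)
  also have "\<dots> \<le> expectation (\<lambda>\<omega>. (S N \<omega>)\<^sup>2)"
  proof (rule integral_mono)
    show "integrable M (\<lambda>\<omega>. \<Sum>k\<le>N. (S N \<omega>)\<^sup>2 * indicator (A k) \<omega>)"
      using integrable_mult_indicator[OF A Sint[of N]]
      by (intro Bochner_Integration.integrable_sum) (auto simp: mult.commute)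
    fix \<omega>
    have "(\<Sum>k\<le>N. (S N \<omega>)\<^sup>2 * indicator (A k) \<omega>) = (S N \<omega>)\<^sup>2 * indicator (\<Union>k\<in>{..N}. A k) \<omega>"
    proof -
      have "indicator (\<Union>k\<in>{..N}. A k) \<omega> = (\<Sum>k\<le>N. indicator (A k) \<omega> :: real)"
        by (rule indicator_UN_disjoint[OF _ dis]) simp
      then show ?thesis by (simp only: sum_distrib_left)
    qed
    also have "\<dots> \<le> (S N \<omega>)\<^sup>2" by (simp add: indicator_def)
    finally show "(\<Sum>k\<le>N. (S N \<omega>)\<^sup>2 * indicator (A k) \<omega>) \<le> (S N \<omega>)\<^sup>2" .
  qed (rule Sint)
  also have "\<dots> = real (N + 1)" using linear_square[of "{..N}" "\<lambda>_. 1"] by (simp add: S_def)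
  finally have "prob (\<Union>k\<in>{..N}. A k) \<le> real (N + 1) / L\<^sup>2"
    using L by (simp add: field_simps)
  then show ?thesis unfolding U[symmetric] S_def .
qed

end

section \<open>Small ball estimate for the random polynomial\<close>

text \<open>Given \<open>U\<close>, the sum is near \<open>a\<close> only when \<open>V\<close> is near \<open>(a - U)/\<rho>\<close>, so the new concentration is the mean of the
old weight, a Cauchy kernel of width \<open>\<sigma> = s \<rho>\<close> in \<open>U\<close>. For \<open>\<bar>a\<bar> \<le> s\<close> this mean is \<open>O(\<sigma>)\<close> because \<open>U\<close> is
spread out; for \<open>\<bar>a\<bar> > s\<close> it is \<open>O(1/a\<^sup>2)\<close> by Chebyshev's inequality. Both are multiples of the same weight with
gain \<open>\<kappa>\<close>, and the balance \<open>s \<rho> = 1/s\<^sup>2\<close> gives \<open>\<kappa>\<close> of order \<open>\<rho> powr (2/3)\<close>. Without the weight the values of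
\<open>V\<close> far from 0 could not be controlled.\<close>

lemma (in prob_space) small_ball_step:
  fixes U V :: "'a \<Rightarrow> real" and a \<rho> s \<tau> h T \<kappa> \<sigma> :: real
  assumes ind: "indep_var borel U borel V"
    and U2: "integrable M (\<lambda>\<omega>. (U \<omega>)\<^sup>2)" "expectation (\<lambda>\<omega>. (U \<omega>)\<^sup>2) \<le> 1"
    and ch: "\<And>t. \<bar>t\<bar> \<le> T \<Longrightarrow> norm (char (distr M borel U) t) \<le> exp (- t\<^sup>2 / 16)"
    and pos: "0 < \<rho>" "0 < s" "\<sigma> = s * \<rho>" "\<sigma> \<le> 1" "T > 0" "h \<ge> 0"
    and T: "4 / (T * \<sigma>) \<le> \<sigma>"
    and V: "\<And>v. prob {\<omega> \<in> space M. \<bar>V \<omega> - v\<bar> \<le> \<tau> / \<rho>} \<le> h / (1 + (v / s)\<^sup>2)"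
    and \<kappa>: "18 * \<sigma> \<le> \<kappa>" "16 / s\<^sup>2 \<le> \<kappa>"
  shows "prob {\<omega> \<in> space M. \<bar>U \<omega> + \<rho> * V \<omega> - a\<bar> \<le> \<tau>} \<le> h * \<kappa> / (1 + (a / s)\<^sup>2)"
proof -
  have [measurable]: "U \<in> borel_measurable M" "V \<in> borel_measurable M"
    using indep_var_rv1[OF ind] indep_var_rv2[OF ind] by auto
  define \<mu> where "\<mu> = distr M borel U"
  define \<nu> where "\<nu> = distr M borel V"
  interpret mu: real_distribution \<mu> unfolding \<mu>_def by (rule real_distribution_distr) simp
  interpret nu: real_distribution \<nu> unfolding \<nu>_def by (rule real_distribution_distr) simp
  have \<sigma>: "\<sigma> > 0" using pos by simp
  define k where "k u = 1 / (1 + ((u - a) / \<sigma>)\<^sup>2)" for u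
  have k01: "0 \<le> k u" "k u \<le> 1" for u
  proof -
    have "1 \<le> 1 + ((u - a) / \<sigma>)\<^sup>2" by simp
    then have "0 < 1 + ((u - a) / \<sigma>)\<^sup>2" by linarith
    with \<open>1 \<le> 1 + ((u - a) / \<sigma>)\<^sup>2\<close> show "0 \<le> k u" "k u \<le> 1" by (simp_all add: k_def divide_le_eq_1)
  qed
  have [measurable]: "k \<in> borel_measurable borel" unfolding k_def by measurable
  have kint: "integrable \<mu> k"
    by (rule mu.integrable_const_bound[of _ 1]) (use k01 in \<open>auto simp: \<mu>_def\<close>)
  define E where "E = {z :: real \<times> real. \<bar>fst z + \<rho> * snd z - a\<bar> \<le> \<tau>}"
  have E [measurable]: "E \<in> sets (borel \<Otimes>\<^sub>M borel)"
  proof -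
    have "E = {z \<in> space (borel \<Otimes>\<^sub>M borel). \<bar>fst z + \<rho> * snd z - a\<bar> \<le> \<tau>}" by (simp add: E_def space_pair_measure)
    also have "\<dots> \<in> sets (borel \<Otimes>\<^sub>M borel)" by measurable
    finally show ?thesis .
  qed
  have slice: "emeasure \<nu> (Pair u -` E) \<le> ennreal (h * k u)" for u
  proof -
    have "Pair u -` E = {v. \<bar>v - (a - u) / \<rho>\<bar> \<le> \<tau> / \<rho>}"
    proof -
      have "\<bar>u + \<rho> * v - a\<bar> \<le> \<tau> \<longleftrightarrow> \<bar>v - (a - u) / \<rho>\<bar> \<le> \<tau> / \<rho>" for v
      proof -
        have "\<bar>v - (a - u) / \<rho>\<bar> = \<bar>u + \<rho> * v - a\<bar> / \<rho>"
        proof -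
          have "v - (a - u) / \<rho> = (u + \<rho> * v - a) / \<rho>" using pos by (simp add: field_simps)
          then show ?thesis using pos by simp
        qed
        then show ?thesis using pos by (simp add: divide_le_cancel)
      qed
      then show ?thesis by (auto simp: E_def)
    qed
    then have "emeasure \<nu> (Pair u -` E) = emeasure M (V -` {v. \<bar>v - (a - u) / \<rho>\<bar> \<le> \<tau> / \<rho>} \<inter> space M)"
      unfolding \<nu>_def by (simp add: emeasure_distr)
    also have "V -` {v. \<bar>v - (a - u) / \<rho>\<bar> \<le> \<tau> / \<rho>} \<inter> space M = {\<omega> \<in> space M. \<bar>V \<omega> - (a - u) / \<rho>\<bar> \<le> \<tau> / \<rho>}" by auto
    also have "emeasure M \<dots> \<le> ennreal (h / (1 + ((a - u) / \<rho> / s)\<^sup>2))"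
      unfolding emeasure_eq_measure by (intro ennreal_leI V)
    also have "h / (1 + ((a - u) / \<rho> / s)\<^sup>2) = h * k u"
    proof -
      have "(a - u) / \<rho> / s = - ((u - a) / \<sigma>)" using pos by (simp add: minus_divide_left mult.commute)
      then show ?thesis by (simp add: k_def)
    qed
    finally show ?thesis .
  qed
  have "emeasure M {\<omega> \<in> space M. \<bar>U \<omega> + \<rho> * V \<omega> - a\<bar> \<le> \<tau>} = emeasure (distr M (borel \<Otimes>\<^sub>M borel) (\<lambda>\<omega>. (U \<omega>, V \<omega>))) E"
    by (subst emeasure_distr[OF _ E]) (auto simp: E_def intro!: arg_cong[where f = "emeasure M"])
  also have "distr M (borel \<Otimes>\<^sub>M borel) (\<lambda>\<omega>. (U \<omega>, V \<omega>)) = \<mu> \<Otimes>\<^sub>M \<nu>"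
    using ind unfolding indep_var_distribution_eq \<mu>_def \<nu>_def by simp
  also have "emeasure (\<mu> \<Otimes>\<^sub>M \<nu>) E = (\<integral>\<^sup>+u. emeasure \<nu> (Pair u -` E) \<partial>\<mu>)"
  proof (rule nu.emeasure_pair_measure_alt)
    show "E \<in> sets (\<mu> \<Otimes>\<^sub>M \<nu>)" using E by (simp add: \<mu>_def \<nu>_def cong: sets_pair_measure_cong)
  qed
  also have "\<dots> \<le> (\<integral>\<^sup>+u. ennreal (h * k u) \<partial>\<mu>)" by (intro nn_integral_mono slice)
  also have "\<dots> = ennreal (\<integral>u. h * k u \<partial>\<mu>)"
    using kint k01 pos by (intro nn_integral_eq_integral) auto
  also have "(\<integral>u. h * k u \<partial>\<mu>) = h * (\<integral>u. k u \<partial>\<mu>)" by simp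
  finally have 1: "prob {\<omega> \<in> space M. \<bar>U \<omega> + \<rho> * V \<omega> - a\<bar> \<le> \<tau>} \<le> h * (\<integral>u. k u \<partial>\<mu>)"
    unfolding emeasure_eq_measure using pos k01 by (subst (asm) ennreal_le_iff) (auto intro!: mult_nonneg_nonneg integral_nonneg_AE)
  have "(\<integral>u. k u \<partial>\<mu>) \<le> \<kappa> / (1 + (a / s)\<^sup>2)"
  proof (cases "\<bar>a\<bar> \<le> s")
    case True
    have "(\<integral>u. k u \<partial>\<mu>) \<le> 8 * \<sigma> + 4 / (T * \<sigma>)"
      unfolding k_def by (rule mu.cauchy_kernel_bound[OF \<sigma> pos(5)]) (use ch in \<open>simp add: \<mu>_def\<close>)
    also have "\<dots> \<le> \<kappa> / 2" using T \<kappa> by linarith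
    also have "\<dots> \<le> \<kappa> / (1 + (a / s)\<^sup>2)"
    proof (rule divide_left_mono)
      have "\<bar>a / s\<bar> \<le> 1" using True pos by simp
      then show "1 + (a / s)\<^sup>2 \<le> 2" by (simp add: abs_square_le_1)
      show "0 \<le> \<kappa>" using \<kappa> \<sigma> by linarith
      show "0 < 2 * (1 + (a / s)\<^sup>2)" by (intro mult_pos_pos add_pos_nonneg) auto
    qed
    finally show ?thesis .
  next
    case False
    have a0: "a\<^sup>2 > 0" using False pos by (auto intro!: zero_less_power2[THEN iffD2])
    have pw: "k u \<le> 4 / a\<^sup>2 * u\<^sup>2 + 4 / a\<^sup>2" for u
    proof (cases "\<bar>u\<bar> > \<bar>a\<bar> / 2")
      case True
      have "(\<bar>a\<bar> / 2)\<^sup>2 \<le> \<bar>u\<bar>\<^sup>2" using True by (intro power_mono) auto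
      then have "1 \<le> 4 / a\<^sup>2 * u\<^sup>2" using a0 by (simp add: power_divide field_simps)
      moreover have "0 \<le> 4 / a\<^sup>2" using a0 by simp
      ultimately show ?thesis using k01(2)[of u] by linarith
    next
      case far: False
      have "\<bar>u - a\<bar> \<ge> \<bar>a\<bar> / 2" using far by linarith
      then have "(\<bar>a\<bar> / 2)\<^sup>2 \<le> \<bar>u - a\<bar>\<^sup>2" by (intro power_mono) auto
      then have ua: "a\<^sup>2 / 4 \<le> (u - a)\<^sup>2" by (simp add: power_divide)
      then have ua0: "(u - a)\<^sup>2 > 0" using a0 by linarith
      have "\<sigma>\<^sup>2 \<le> 1" using \<sigma> pos by (simp add: power_le_one)
      have "(u - a)\<^sup>2 \<le> ((u - a) / \<sigma>)\<^sup>2"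
        unfolding power_divide using \<open>\<sigma>\<^sup>2 \<le> 1\<close> \<sigma> ua0 by (simp add: field_simps)
      then have "a\<^sup>2 / 4 \<le> 1 + ((u - a) / \<sigma>)\<^sup>2" using ua by linarith
      then have "k u \<le> 1 / (a\<^sup>2 / 4)" unfolding k_def using a0
        by (intro divide_left_mono mult_pos_pos) (auto intro!: add_pos_nonneg)
      then have "k u \<le> 4 / a\<^sup>2" by simp
      moreover have "0 \<le> 4 / a\<^sup>2 * u\<^sup>2" by simp
      ultimately show ?thesis by (intro add_increasing)
    qed
    have Uint: "integrable \<mu> (\<lambda>u. u\<^sup>2)" "(\<integral>u. u\<^sup>2 \<partial>\<mu>) \<le> 1"
      using U2 unfolding \<mu>_def by (auto simp: integrable_distr_eq integral_distr)
    have "(\<integral>u. k u \<partial>\<mu>) \<le> (\<integral>u. 4 / a\<^sup>2 * u\<^sup>2 + 4 / a\<^sup>2 \<partial>\<mu>)"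
      using kint Uint pw by (intro integral_mono) auto
    also have "\<dots> = 4 / a\<^sup>2 * (\<integral>u. u\<^sup>2 \<partial>\<mu>) + 4 / a\<^sup>2"
      using Uint mu.prob_space by (subst Bochner_Integration.integral_add) auto
    also have "\<dots> \<le> 4 / a\<^sup>2 * 1 + 4 / a\<^sup>2"
      using Uint a0 by (intro add_right_mono mult_left_mono) auto
    also have "\<dots> = (16 / s\<^sup>2) / (2 * (a / s)\<^sup>2)" using pos a0 by (simp add: power_divide)
    also have "\<dots> \<le> \<kappa> / (2 * (a / s)\<^sup>2)" using \<kappa> by (intro divide_right_mono) auto
    also have "\<dots> \<le> \<kappa> / (1 + (a / s)\<^sup>2)"
    proof (rule divide_left_mono)
      have "\<bar>a / s\<bar> \<ge> 1" using False pos by simp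
      then have "1 ^ 2 \<le> \<bar>a / s\<bar> ^ 2" by (intro power_mono) auto
      then have ge: "1 \<le> (a / s)\<^sup>2" by (simp only: power_one power2_abs)
      then show "1 + (a / s)\<^sup>2 \<le> 2 * (a / s)\<^sup>2" by linarith
      have "0 < 2 * (a / s)\<^sup>2" using ge by linarith
      then show "0 < 2 * (a / s)\<^sup>2 * (1 + (a / s)\<^sup>2)" by (intro mult_pos_pos add_pos_nonneg) auto
      show "0 \<le> \<kappa>" using \<kappa> \<sigma> by linarith
    qed
    finally show ?thesis .
  qed
  then have "h * (\<integral>u. k u \<partial>\<mu>) \<le> h * (\<kappa> / (1 + (a / s)\<^sup>2))" using pos by (intro mult_left_mono) auto
  then show ?thesis using 1 by simp
qed

lemma (in prob_space) char_distr_scale: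
  assumes [measurable]: "random_variable borel X"
  shows "char (distr M borel (\<lambda>\<omega>. c * X \<omega>)) t = char (distr M borel X) (c * t)"
  unfolding char_def by (simp add: integral_distr mult_ac)

context unit_sequence
begin

text \<open>The factor \<open>sqrt (1 - x)\<close> and the shift of the exponents normalise every block so that its variance is at most
1, wherever it starts.\<close>

definition window :: "real \<Rightarrow> nat \<Rightarrow> nat \<Rightarrow> 'a \<Rightarrow> real" where
  "window x k l \<omega> = (\<Sum>i\<in>{k..<l}. (sqrt (1 - x) * x ^ (i - k)) * \<xi> i \<omega>)"

lemma window_measurable [measurable]: "window x k l \<in> borel_measurable M"
  unfolding window_def by measurable

lemma window_coeff_sum:
  assumes "0 \<le> x" "x < 1"
  shows "(\<Sum>i\<in>{k..<l}. (sqrt (1 - x) * x ^ (i - k))\<^sup>2) = (1 - (x\<^sup>2) ^ (l - k)) / (1 + x)"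
proof -
  have "(\<Sum>i\<in>{k..<l}. (sqrt (1 - x) * x ^ (i - k))\<^sup>2) = (\<Sum>i<l - k. (sqrt (1 - x) * x ^ i)\<^sup>2)"
    by (rule sum.reindex_bij_witness[of _ "\<lambda>i. i + k" "\<lambda>i. i - k"]) auto
  also have "\<dots> = (1 - x) * (\<Sum>i<l - k. (x\<^sup>2) ^ i)"
    using assms by (simp add: sum_distrib_left power_mult_distrib power_mult[symmetric] mult.commute)
  also have "\<dots> = (1 - x) * ((1 - (x\<^sup>2) ^ (l - k)) / (1 - x\<^sup>2))"
    using assms by (subst sum_gp_strict) (auto simp: power2_eq_1_iff)
  also have "1 - x\<^sup>2 = (1 - x) * (1 + x)" by (simp add: power2_eq_square algebra_simps)
  finally show ?thesis using assms by simp
qed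

lemma
  assumes "0 \<le> x" "x < 1"
  shows window_square_integrable: "integrable M (\<lambda>\<omega>. (window x k l \<omega>)\<^sup>2)"
    and window_square: "expectation (\<lambda>\<omega>. (window x k l \<omega>)\<^sup>2) \<le> 1"
proof -
  show "integrable M (\<lambda>\<omega>. (window x k l \<omega>)\<^sup>2)"
    unfolding window_def by (rule linear_square_integrable) simp
  have "expectation (\<lambda>\<omega>. (window x k l \<omega>)\<^sup>2) = (1 - (x\<^sup>2) ^ (l - k)) / (1 + x)"
    unfolding window_def by (subst linear_square) (auto simp only: window_coeff_sum[OF assms] finite_atLeastLessThan)
  also have "\<dots> \<le> 1"
  proof -
    have "(1 - y) / (1 + x) \<le> 1" if "y \<ge> 0" for y using that assms by (simp add: divide_le_eq)
    then show ?thesis by simp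
  qed
  finally show "expectation (\<lambda>\<omega>. (window x k l \<omega>)\<^sup>2) \<le> 1" .
qed

text \<open>The coefficients of the block are at most \<open>sqrt (1 - x)\<close>, which keeps all frequencies within the range where the
individual bounds hold, and \<open>x ^ D \<le> 1/2\<close> makes the variance at least \<open>1/4\<close>.\<close>

lemma window_char:
  assumes x: "0 \<le> x" "x < 1" and D: "x ^ D \<le> 1 / 2" and t: "\<bar>t\<bar> \<le> t0 / sqrt (1 - x)"
  shows "norm (char (distr M borel (window x k (k + D))) t) \<le> exp (- t\<^sup>2 / 16)"
proof -
  define c where "c i = sqrt (1 - x) * x ^ (i - k)" for i
  have c: "0 \<le> c i" "c i \<le> sqrt (1 - x)" for i
    using x by (auto simp: c_def mult_left_le power_le_one)
  have "indep_vars (\<lambda>_. borel) (\<lambda>i \<omega>. c i * \<xi> i \<omega>) {k..<k + D}"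
    by (rule indep_vars_compose2[OF indep_vars_subset[OF indep subset_UNIV]]) simp
  from char_distr_sum[OF this]
  have "char (distr M borel (window x k (k + D))) t = (\<Prod>i\<in>{k..<k + D}. char (distr M borel (\<lambda>\<omega>. c i * \<xi> i \<omega>)) t)"
    unfolding window_def[abs_def] c_def by simp
  also have "\<dots> = (\<Prod>i\<in>{k..<k + D}. char (distr M borel (\<xi> i)) (c i * t))"
    by (simp add: char_distr_scale)
  also have "norm \<dots> \<le> (\<Prod>i\<in>{k..<k + D}. exp (- (c i * t)\<^sup>2 / 4))"
    unfolding prod_norm[symmetric]
  proof (rule prod_mono, safe)
    fix i
    have "\<bar>c i * t\<bar> \<le> sqrt (1 - x) * (t0 / sqrt (1 - x))"
      unfolding abs_mult using c[of i] t x by (intro mult_mono) auto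
    then show "norm (char (distr M borel (\<xi> i)) (c i * t)) \<le> exp (- (c i * t)\<^sup>2 / 4)"
      using x by (intro char_le) simp
  qed simp
  also have "\<dots> = exp (- (t\<^sup>2 / 4) * (\<Sum>i\<in>{k..<k + D}. (c i)\<^sup>2))"
    by (simp add: exp_sum[symmetric] sum_distrib_left power_mult_distrib sum_negf[symmetric] mult_ac)
  also have "\<dots> \<le> exp (- t\<^sup>2 / 16)"
  proof -
    have "(x ^ D)\<^sup>2 \<le> (1 / 2)\<^sup>2" using D x by (intro power_mono) auto
    then have "(x\<^sup>2) ^ D \<le> 1 / 4" by (simp add: power_divide power_mult[symmetric] mult.commute)
    then have "1 / 4 \<le> (1 - (x\<^sup>2) ^ D) / (1 + x)" using x by (simp add: le_divide_eq)
    then have "1 / 4 \<le> (\<Sum>i\<in>{k..<k + D}. (c i)\<^sup>2)"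
      unfolding c_def using window_coeff_sum[OF x, of k "k + D"] by simp
    then have "(t\<^sup>2 / 4) * (1 / 4) \<le> (t\<^sup>2 / 4) * (\<Sum>i\<in>{k..<k + D}. (c i)\<^sup>2)" by (intro mult_left_mono) auto
    then show ?thesis by simp
  qed
  finally show ?thesis .
qed

lemma window_split:
  assumes "k + D \<le> l"
  shows "window x k l \<omega> = window x k (k + D) \<omega> + x ^ D * window x (k + D) l \<omega>"
proof -
  have "{k..<l} = {k..<k + D} \<union> {k + D..<l}" "{k..<k + D} \<inter> {k + D..<l} = {}" using assms by auto
  then have "window x k l \<omega> = window x k (k + D) \<omega> + (\<Sum>i\<in>{k + D..<l}. (sqrt (1 - x) * x ^ (i - k)) * \<xi> i \<omega>)"
    unfolding window_def by (simp add: sum.union_disjoint)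
  also have "(\<Sum>i\<in>{k + D..<l}. (sqrt (1 - x) * x ^ (i - k)) * \<xi> i \<omega>) = x ^ D * window x (k + D) l \<omega>"
    unfolding window_def sum_distrib_left
  proof (rule sum.cong[OF refl])
    fix i assume "i \<in> {k + D..<l}"
    then have "i - k = D + (i - (k + D))" by auto
    then show "(sqrt (1 - x) * x ^ (i - k)) * \<xi> i \<omega> = x ^ D * ((sqrt (1 - x) * x ^ (i - (k + D))) * \<xi> i \<omega>)"
      by (metis power_add mult.assoc mult.left_commute)
  qed
  finally show ?thesis .
qed

text \<open>Induction over the blocks. The constants instantiate \<open>small_ball_step\<close> with \<open>x ^ D\<close> between \<open>2\<^sup>-\<^sup>7\<^sup>6\<close> and
\<open>r = 2\<^sup>-\<^sup>7\<^sup>5\<close>, \<open>s = r powr (-1/3) = 2\<^sup>2\<^sup>5\<close> and gain \<open>18 r powr (2/3)\<close>. For \<open>J = 0\<close> the estimate is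
Chebyshev's inequality.\<close>

lemma window_small_ball:
  assumes x: "0 < x" "x < 1" and D: "1 / 2 ^ 76 \<le> x ^ D" "x ^ D \<le> 1 / 2 ^ 75"
    and T: "t0 / sqrt (1 - x) \<ge> 2 ^ 104"
    and l: "k + J * D \<le> l"
  shows "prob {\<omega> \<in> space M. \<bar>window x k l \<omega> - v\<bar> \<le> (x ^ D) ^ J} \<le> 5 * (18 / 2 ^ 50) ^ J / (1 + (v / 2 ^ 25)\<^sup>2)"
  using l
proof (induction J arbitrary: k v)
  case 0
  have pos: "1 + (v / 2 ^ 25)\<^sup>2 > 0" by (intro add_pos_nonneg) auto
  show ?case
  proof (cases "\<bar>v\<bar> \<le> 2")
    case True
    have "(\<bar>v\<bar> / 2 ^ 25)\<^sup>2 \<le> 1\<^sup>2" using True by (intro power_mono) auto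
    then have "1 \<le> 5 / (1 + (v / 2 ^ 25)\<^sup>2)" using pos by (simp add: le_divide_eq power_divide)
    then show ?thesis using order_trans[OF prob_le_1] by simp
  next
    case False
    let ?E = "{\<omega> \<in> space M. \<bar>window x k l \<omega> - v\<bar> \<le> (x ^ D) ^ 0}"
    let ?F = "{\<omega> \<in> space M. (window x k l \<omega>)\<^sup>2 \<ge> (v / 2)\<^sup>2}"
    have "?E \<subseteq> ?F"
    proof safe
      fix \<omega> assume "\<bar>window x k l \<omega> - v\<bar> \<le> (x ^ D) ^ 0"
      then have "\<bar>v / 2\<bar> \<le> \<bar>window x k l \<omega>\<bar>" using False by auto
      then show "(v / 2)\<^sup>2 \<le> (window x k l \<omega>)\<^sup>2" by (simp only: abs_le_square_iff)
    qed
    then have "prob ?E \<le> prob ?F" by (intro finite_measure_mono) auto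
    also have "\<dots> \<le> expectation (\<lambda>\<omega>. (window x k l \<omega>)\<^sup>2) / (v / 2)\<^sup>2"
      using False x by (intro integral_Markov_inequality_measure[of _ _ "{}"] window_square_integrable) auto
    also have "\<dots> \<le> 1 / (v / 2)\<^sup>2" using x by (intro divide_right_mono window_square) auto
    also have "\<dots> \<le> 5 / (1 + (v / 2 ^ 25)\<^sup>2)"
    proof -
      have "2\<^sup>2 \<le> \<bar>v\<bar>\<^sup>2" using False by (intro power_mono) auto
      then show ?thesis using pos False by (simp add: divide_simps power_divide)
    qed
    finally show ?thesis by simp
  qed
next
  case (Suc J)
  define \<rho> where "\<rho> = x ^ D"
  have \<rho>: "\<rho> > 0" "1 / 2 ^ 76 \<le> \<rho>" "\<rho> \<le> 1 / 2 ^ 75" using x D by (auto simp: \<rho>_def)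
  have kl: "k + D \<le> l" "k + D + J * D \<le> l" using Suc.prems by auto
  let ?h = "5 * (18 / 2 ^ 50) ^ J :: real"
  have IH: "prob {\<omega> \<in> space M. \<bar>window x (k + D) l \<omega> - v\<bar> \<le> \<rho> ^ Suc J / \<rho>} \<le> ?h / (1 + (v / 2 ^ 25)\<^sup>2)" for v
    using Suc.IH[OF kl(2), of v] \<rho>(1) by (simp add: \<rho>_def[symmetric])
  have "prob {\<omega> \<in> space M. \<bar>window x k (k + D) \<omega> + \<rho> * window x (k + D) l \<omega> - v\<bar> \<le> \<rho> ^ Suc J}
     \<le> ?h * (18 / 2 ^ 50) / (1 + (v / 2 ^ 25)\<^sup>2)"
  proof (rule small_ball_step[where T = "t0 / sqrt (1 - x)" and \<sigma> = "2 ^ 25 * \<rho>", OF _ _ _ _ \<rho>(1) _ refl _ _ _ _ IH])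
    show "indep_var borel (window x k (k + D)) borel (window x (k + D) l)"
      unfolding window_def[abs_def] by (rule indep_linear_blocks) auto
    show "integrable M (\<lambda>\<omega>. (window x k (k + D) \<omega>)\<^sup>2)" "expectation (\<lambda>\<omega>. (window x k (k + D) \<omega>)\<^sup>2) \<le> 1"
      using x by (auto intro: window_square_integrable window_square)
    show "norm (char (distr M borel (window x k (k + D))) t) \<le> exp (- t\<^sup>2 / 16)" if "\<bar>t\<bar> \<le> t0 / sqrt (1 - x)" for t
      using x \<rho>(3) that by (intro window_char) (auto simp: \<rho>_def)
    have \<sigma>: "2 ^ 25 * \<rho> \<ge> 1 / 2 ^ 51" using \<rho>(2) by simp
    (* The width \<sigma> is at least 2^(-51), and the frequency range is assumed to exceed 4 / \<sigma>^2. *)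
    have "4 \<le> 2 ^ 104 * ((1 / 2 ^ 51) * (1 / 2 ^ 51 :: real))" by simp
    also have "\<dots> \<le> t0 / sqrt (1 - x) * ((2 ^ 25 * \<rho>) * (2 ^ 25 * \<rho>))"
      using \<sigma> T by (intro mult_mono) auto
    finally have four: "4 \<le> t0 / sqrt (1 - x) * (2 ^ 25 * \<rho>) * (2 ^ 25 * \<rho>)" by (simp only: mult.assoc)
    show "t0 / sqrt (1 - x) > 0" using t0 x by simp
    then have "t0 / sqrt (1 - x) * (2 ^ 25 * \<rho>) > 0" by (rule mult_pos_pos) (use \<rho>(1) in simp)
    then show "4 / (t0 / sqrt (1 - x) * (2 ^ 25 * \<rho>)) \<le> 2 ^ 25 * \<rho>"
      using four by (simp only: pos_divide_le_eq mult.commute)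
    show "2 ^ 25 * \<rho> \<le> 1" "18 * (2 ^ 25 * \<rho>) \<le> 18 / 2 ^ 50" using \<rho>(3) by auto
  qed auto
  then show ?case unfolding \<rho>_def[symmetric] window_split[OF kl(1)] by (simp add: mult.commute)
qed

end

context unit_sequence
begin

text \<open>The number \<open>J\<close> of blocks is the largest with \<open>\<tau> \<le> x\<^sup>D\<^sup>J\<close>; the hypothesis on \<open>ln (1/\<tau>)\<close> ensures that \<open>J\<close> blocks
fit into the first \<open>n\<close> coefficients. The constant \<open>r = 2\<^sup>-\<^sup>7\<^sup>5\<close> is so small that the gain per block,
\<open>18 r powr (2/3)\<close>, is below \<open>(r/2) powr (3/5)\<close>; this is where the exponent \<open>3/5\<close> comes from.\<close>

lemma small_ball_at_point:
  assumes x: "1 / 2 \<le> x" "x < 1" and T: "t0 / sqrt (1 - x) \<ge> 2 ^ 104"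
    and \<tau>: "0 < \<tau>" "\<tau> < 1" "ln (1 / \<tau>) \<le> real n * (1 - x)"
  shows "prob {\<omega> \<in> space M. \<bar>\<Sum>i\<le>n. \<xi> i \<omega> * x ^ i\<bar> \<le> \<tau> / sqrt (1 - x)} \<le> 2 ^ 49 * \<tau> powr (3 / 5)"
proof -
  define D where "D = (LEAST D. x ^ D \<le> 1 / 2 ^ 75)"
  obtain D0 where "x ^ D0 < 1 / 2 ^ 75" using real_arch_pow_inv[of "1 / 2 ^ 75" x] x by auto
  then have D1: "x ^ D \<le> 1 / 2 ^ 75" unfolding D_def
    by (rule LeastI[where P = "\<lambda>D. x ^ D \<le> 1 / 2 ^ 75", OF less_imp_le])
  have "D \<noteq> 0" using D1 by (intro notI) simp
  then have "\<not> x ^ (D - 1) \<le> 1 / 2 ^ 75"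
    using not_less_Least[of "D - 1" "\<lambda>D. x ^ D \<le> 1 / 2 ^ 75"] unfolding D_def by auto
  then have "1 / 2 * (1 / 2 ^ 75) \<le> x * x ^ (D - 1)" using x by (intro mult_mono) auto
  also have "x * x ^ (D - 1) = x ^ D" using \<open>D \<noteq> 0\<close> by (simp add: power_eq_if)
  finally have D2: "1 / 2 ^ 76 \<le> x ^ D" by simp
  define \<rho> where "\<rho> = x ^ D"
  have \<rho>: "0 < \<rho>" "\<rho> < 1" "1 / 2 ^ 76 \<le> \<rho>"
    using x D1 D2 unfolding \<rho>_def by (auto intro: le_less_trans)
  have ln\<rho>: "ln \<rho> < 0" and ln\<tau>: "ln \<tau> < 0" using \<rho> \<tau> by auto
  define q where "q = ln \<tau> / ln \<rho>"
  define J where "J = nat \<lfloor>q\<rfloor>"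
  have q: "0 \<le> q" using ln\<rho> ln\<tau> by (simp add: q_def divide_nonpos_neg)
  have "real J = real_of_int \<lfloor>q\<rfloor>" using q by (simp add: J_def)
  then have J: "real J \<le> q" "q < real (Suc J)"
    using of_int_floor_le[of q] real_of_int_floor_add_one_gt[of q] unfolding of_nat_Suc by linarith+
  have qq: "q * ln \<rho> = ln \<tau>" using ln\<rho> by (simp add: q_def)
  have J1: "ln \<tau> \<le> real J * ln \<rho>" using mult_right_mono_neg[OF J(1), of "ln \<rho>"] ln\<rho> qq by simp
  have J2: "real (Suc J) * ln \<rho> < ln \<tau>" using mult_strict_right_mono_neg[OF J(2) ln\<rho>] qq by simp
  have e: "exp (real k * ln \<rho>) = \<rho> ^ k" for k using \<rho> by (simp add: exp_of_nat_mult)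
  have "exp (ln \<tau>) \<le> exp (real J * ln \<rho>)" using J1 by simp
  then have \<tau>\<rho>: "\<tau> \<le> \<rho> ^ J" using \<tau> unfolding e by simp
  have "exp (real (Suc J) * ln \<rho>) < exp (ln \<tau>)" using J2 by (simp only: exp_less_cancel_iff)
  then have "\<rho> * \<rho> ^ J < \<tau>" unfolding e using \<tau> by simp
  moreover have "1 / 2 ^ 76 * \<rho> ^ J \<le> \<rho> * \<rho> ^ J" using \<rho> by (intro mult_right_mono) auto
  ultimately have \<rho>\<tau>: "\<rho> ^ J \<le> 2 ^ 76 * \<tau>" by simp
  have JD: "J * D \<le> n"
  proof -
    have lx: "ln x < 0" "ln x \<le> x - 1" using x ln_le_minus_one[of x] by auto
    have "ln \<tau> \<le> real J * (real D * ln x)" using J1 x by (simp add: \<rho>_def ln_realpow)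
    then have "real (J * D) * (- ln x) \<le> ln (1 / \<tau>)" using \<tau> by (simp add: ln_div mult.assoc)
    also have "\<dots> \<le> real n * (1 - x)" by (rule \<tau>)
    also have "\<dots> \<le> real n * (- ln x)" using lx by (intro mult_left_mono) auto
    finally have "real (J * D) \<le> real n" using lx by (simp only: mult_le_cancel_right_pos neg_0_less_iff_less)
    then show ?thesis by (simp only: of_nat_le_iff)
  qed
  have "{\<omega> \<in> space M. \<bar>\<Sum>i\<le>n. \<xi> i \<omega> * x ^ i\<bar> \<le> \<tau> / sqrt (1 - x)} \<subseteq> {\<omega> \<in> space M. \<bar>window x 0 (Suc n) \<omega> - 0\<bar> \<le> (x ^ D) ^ J}"
  proof safe
    fix \<omega> assume *: "\<bar>\<Sum>i\<le>n. \<xi> i \<omega> * x ^ i\<bar> \<le> \<tau> / sqrt (1 - x)"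
    have sq: "sqrt (1 - x) > 0" using x by simp
    have "window x 0 (Suc n) \<omega> = sqrt (1 - x) * (\<Sum>i\<le>n. \<xi> i \<omega> * x ^ i)"
      unfolding window_def sum_distrib_left
      by (intro sum.cong) (auto simp: mult_ac)
    then have "\<bar>window x 0 (Suc n) \<omega>\<bar> = \<bar>\<Sum>i\<le>n. \<xi> i \<omega> * x ^ i\<bar> * sqrt (1 - x)"
      using sq by (simp add: abs_mult mult.commute)
    also have "\<dots> \<le> \<tau>" using * sq by (simp only: pos_le_divide_eq)
    also have "\<dots> \<le> (x ^ D) ^ J" using \<tau>\<rho> by (simp add: \<rho>_def)
    finally show "\<bar>window x 0 (Suc n) \<omega> - 0\<bar> \<le> (x ^ D) ^ J" by simp
  qed
  then have "prob {\<omega> \<in> space M. \<bar>\<Sum>i\<le>n. \<xi> i \<omega> * x ^ i\<bar> \<le> \<tau> / sqrt (1 - x)} \<le> prob {\<omega> \<in> space M. \<bar>window x 0 (Suc n) \<omega> - 0\<bar> \<le> (x ^ D) ^ J}"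
    by (intro finite_measure_mono) auto
  also have "\<dots> \<le> 5 * (18 / 2 ^ 50) ^ J / (1 + (0 / 2 ^ 25)\<^sup>2)"
    by (rule window_small_ball) (use x D1 D2 T JD in auto)
  also have "\<dots> = 5 * (18 / 2 ^ 50) ^ J" by simp
  also have "(18 / 2 ^ 50) ^ J \<le> (\<rho> powr (3 / 5)) ^ J"
  proof (rule power_mono)
    have "(18 / 2 ^ 50) ^ 5 \<le> (1 / 2 ^ 76 :: real) ^ 3" by (simp add: power_divide)
    also have "\<dots> \<le> \<rho> ^ 3" using \<rho> by (intro power_mono) auto
    finally have "((18 / 2 ^ 50) ^ 5) powr (1 / 5) \<le> (\<rho> ^ 3) powr (1 / 5)" by (intro powr_mono2) auto
    moreover have "((18 / 2 ^ 50 :: real) ^ 5) powr (1 / 5) = 18 / 2 ^ 50"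
    proof -
      have "(y ^ 5) powr (1 / 5) = y" if "y > 0" for y :: real
        using that by (simp add: powr_powr flip: powr_numeral)
      then show ?thesis by simp
    qed
    moreover have "(\<rho> ^ 3) powr (1 / 5) = \<rho> powr (3 / 5)"
      using \<rho> by (simp add: powr_powr flip: powr_numeral)
    ultimately show "18 / 2 ^ 50 \<le> \<rho> powr (3 / 5)" by simp
  qed simp
  also have "(\<rho> powr (3 / 5)) ^ J = (\<rho> ^ J) powr (3 / 5)"
    using \<rho> by (simp add: powr_realpow[symmetric] powr_powr mult.commute)
  also have "\<dots> \<le> (2 ^ 76 * \<tau>) powr (3 / 5)" using \<rho>\<tau> \<rho> by (intro powr_mono2) auto
  also have "\<dots> = (2 ^ 76) powr (3 / 5) * \<tau> powr (3 / 5)" by (rule powr_mult)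
  also have "(2 ^ 76 :: real) powr (3 / 5) \<le> 2 ^ 46"
  proof -
    have "(2 ^ 76 :: real) powr (3 / 5) = 2 powr (228 / 5)"
    proof -
      have "(y ^ 76) powr (3 / 5) = y powr (228 / 5)" if "y > 0" for y :: real
        using that by (simp add: powr_powr flip: powr_numeral)
      then show ?thesis by (simp only: zero_less_numeral)
    qed
    also have "\<dots> \<le> 2 powr (real 46)" by (intro powr_mono) auto
    also have "\<dots> = 2 ^ 46" by (rule powr_realpow) simp
    finally show ?thesis .
  qed
  finally have "prob {\<omega> \<in> space M. \<bar>\<Sum>i\<le>n. \<xi> i \<omega> * x ^ i\<bar> \<le> \<tau> / sqrt (1 - x)} \<le> 5 * (2 ^ 46 * \<tau> powr (3 / 5))"
    by (simp add: mult_right_mono)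
  also have "\<dots> \<le> 2 ^ 49 * \<tau> powr (3 / 5)" by simp
  finally show ?thesis .
qed

lemma small_ball:
  obtains u0 where "0 < u0" "u0 \<le> 1 / 2"
    "\<And>x \<tau> n. 0 < 1 - x \<Longrightarrow> 1 - x \<le> u0 \<Longrightarrow> 0 < \<tau> \<Longrightarrow> \<tau> < 1 \<Longrightarrow> ln (1 / \<tau>) \<le> real n * (1 - x) \<Longrightarrow>
       prob {\<omega> \<in> space M. \<bar>\<Sum>i\<le>n. \<xi> i \<omega> * x ^ i\<bar> \<le> \<tau> / sqrt (1 - x)} \<le> 2 ^ 49 * \<tau> powr (3 / 5)"
proof -
  define u0 where "u0 = min (1 / 2) ((t0 / 2 ^ 104)\<^sup>2)"
  show ?thesis
  proof (rule that[of u0])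
    show "0 < u0" "u0 \<le> 1 / 2" using t0 by (auto simp: u0_def)
    fix x \<tau> :: real and n assume x: "0 < 1 - x" "1 - x \<le> u0" and \<tau>: "0 < \<tau>" "\<tau> < 1" "ln (1 / \<tau>) \<le> real n * (1 - x)"
    have "sqrt (1 - x) \<le> sqrt ((t0 / 2 ^ 104)\<^sup>2)" using x unfolding u0_def by (intro real_sqrt_le_mono) auto
    also have "\<dots> = t0 / 2 ^ 104" using t0 by (simp only: real_sqrt_abs) simp
    finally have "2 ^ 104 \<le> t0 / sqrt (1 - x)" using x by (simp add: field_simps)
    then show "prob {\<omega> \<in> space M. \<bar>\<Sum>i\<le>n. \<xi> i \<omega> * x ^ i\<bar> \<le> \<tau> / sqrt (1 - x)} \<le> 2 ^ 49 * \<tau> powr (3 / 5)"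
      using x \<tau> by (intro small_ball_at_point) (auto simp: u0_def)
  qed
qed

text \<open>The maximal inequality on dyadic ranges of indices costs the same probability on each, hence the logarithm.\<close>

lemma partial_sums_growth:
  assumes y: "y > 0"
  shows "prob {\<omega> \<in> space M. \<exists>j\<le>N. \<bar>\<Sum>i\<le>j. \<xi> i \<omega>\<bar> > y * sqrt (real (j + 1))} \<le> 2 * (log 2 (real (N + 1)) + 1) / y\<^sup>2"
proof -
  define L where "L = nat \<lfloor>log 2 (real (N + 1))\<rfloor>"
  define F where "F l = {\<omega> \<in> space M. \<exists>k\<le>2 ^ (l + 1) - 1. \<bar>\<Sum>i\<le>k. \<xi> i \<omega>\<bar> \<ge> y * sqrt (2 ^ l)}" for l :: nat
  have [measurable]: "F l \<in> sets M" for l unfolding F_def by measurable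
  have "{\<omega> \<in> space M. \<exists>j\<le>N. \<bar>\<Sum>i\<le>j. \<xi> i \<omega>\<bar> > y * sqrt (real (j + 1))} \<subseteq> (\<Union>l\<le>L. F l)"
  proof safe
    fix \<omega> j assume \<omega>: "\<omega> \<in> space M" and j: "j \<le> N" and gt: "y * sqrt (real (j + 1)) < \<bar>\<Sum>i\<le>j. \<xi> i \<omega>\<bar>"
    obtain l where l: "2 ^ l \<le> j + 1" "j + 1 < 2 ^ (l + 1)" using ex_power_ivl1[of 2 "j + 1"] by auto
    have "2 powr real l = real (2 ^ l)" by (simp add: powr_realpow)
    also have "\<dots> \<le> real (N + 1)" using l(1) j by (intro of_nat_mono) linarith
    finally have "real l \<le> log 2 (real (N + 1))" by (subst le_log_iff) auto
    then have "l \<le> L" unfolding L_def by (simp add: le_nat_floor)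
    moreover have "y * sqrt (2 ^ l) \<le> y * sqrt (real (j + 1))"
    proof -
      have "real (2 ^ l) \<le> real (j + 1)" using l(1) by (rule of_nat_mono)
      then show ?thesis using y by (intro mult_left_mono real_sqrt_le_mono) auto
    qed
    then have "\<omega> \<in> F l" using \<omega> gt l(2) unfolding F_def by (auto intro!: exI[of _ j])
    ultimately show "\<omega> \<in> (\<Union>l\<le>L. F l)" by auto
  qed
  then have "prob {\<omega> \<in> space M. \<exists>j\<le>N. \<bar>\<Sum>i\<le>j. \<xi> i \<omega>\<bar> > y * sqrt (real (j + 1))} \<le> prob (\<Union>l\<le>L. F l)"
    by (intro finite_measure_mono) auto
  also have "\<dots> \<le> (\<Sum>l\<le>L. prob (F l))" by (intro finite_measure_subadditive_finite) auto
  also have "\<dots> \<le> (\<Sum>l\<le>L. 2 / y\<^sup>2)"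
  proof (rule sum_mono)
    fix l
    have "prob (F l) \<le> real (2 ^ (l + 1) - 1 + 1) / (y * sqrt (2 ^ l))\<^sup>2"
      unfolding F_def using y by (intro kolmogorov_maximal) simp
    also have "\<dots> = 2 / y\<^sup>2" using y by (simp add: power_mult_distrib)
    finally show "prob (F l) \<le> 2 / y\<^sup>2" .
  qed
  also have "\<dots> = 2 * (real L + 1) / y\<^sup>2" by simp
  also have "\<dots> \<le> 2 * (log 2 (real (N + 1)) + 1) / y\<^sup>2"
  proof -
    have "0 \<le> log 2 (real (N + 1))" by simp
    then have "real L \<le> log 2 (real (N + 1))" unfolding L_def by simp
    then show ?thesis by (intro divide_right_mono) auto
  qed
  finally show ?thesis .
qed

end

section \<open>Stability of the number of real roots\<close>

lemma geometric_grid_top: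
  fixes us u0 \<delta> :: real
  assumes "0 < us" "us \<le> u0" "0 < \<delta>" "\<delta> < 1"
  obtains K where "us * (1 + \<delta>) ^ K \<le> u0" "u0 / 2 \<le> us * (1 + \<delta>) ^ K"
proof -
  obtain m0 where "u0 / us < (1 + \<delta>) ^ m0" using real_arch_pow[of "1 + \<delta>" "u0 / us"] assms by auto
  then have m0: "u0 < us * (1 + \<delta>) ^ m0" using assms by (simp add: divide_less_eq mult.commute)
  define m where "m = (LEAST m. u0 < us * (1 + \<delta>) ^ m)"
  have m: "u0 < us * (1 + \<delta>) ^ m" unfolding m_def by (rule LeastI[of "\<lambda>m. u0 < us * (1 + \<delta>) ^ m", OF m0])
  then have "m \<noteq> 0" using assms by (intro notI) simp
  then obtain K where K: "m = Suc K" by (cases m) auto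
  have "\<not> u0 < us * (1 + \<delta>) ^ K"
    using not_less_Least[of K "\<lambda>m. u0 < us * (1 + \<delta>) ^ m"] K unfolding m_def[symmetric] by simp
  then have 1: "us * (1 + \<delta>) ^ K \<le> u0" by simp
  have "u0 < (us * (1 + \<delta>) ^ K) * (1 + \<delta>)" using m unfolding K by (simp add: mult_ac)
  also have "\<dots> \<le> (us * (1 + \<delta>) ^ K) * 2" using assms by (intro mult_left_mono) auto
  finally have 2: "u0 / 2 \<le> us * (1 + \<delta>) ^ K" by simp
  show ?thesis by (rule that[OF 1 2])
qed

text \<open>A geometric progression with ratio \<open>1 + \<delta>\<close> needs about \<open>ln (1/us) / \<delta>\<close> steps from \<open>us\<close> to 1.\<close>

lemma geometric_grid_length:
  fixes us \<delta> :: real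
  assumes "0 < us" "0 < \<delta>" "\<delta> < 1 / 2" and le: "us * (1 + \<delta>) ^ K \<le> 1"
  shows "real K \<le> 2 * ln (1 / us) / \<delta>"
proof -
  have "\<delta> - \<delta>\<^sup>2 \<le> ln (1 + \<delta>)" using assms by (intro ln_one_plus_pos_lower_bound) auto
  moreover have "\<delta> * \<delta> \<le> \<delta> * (1 / 2)" using assms by (intro mult_left_mono) auto
  ultimately have l: "\<delta> / 2 \<le> ln (1 + \<delta>)" by (simp add: power2_eq_square)
  have "ln (us * (1 + \<delta>) ^ K) \<le> ln 1" using assms by (intro ln_mono) auto
  then have "real K * ln (1 + \<delta>) \<le> ln (1 / us)" using assms by (simp add: ln_mult ln_realpow ln_div)
  moreover have "real K * (\<delta> / 2) \<le> real K * ln (1 + \<delta>)" using l by (intro mult_left_mono) auto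
  ultimately have "real K * \<delta> \<le> 2 * ln (1 / us)" by simp
  then show ?thesis using assms by (simp add: pos_le_divide_eq)
qed

context unit_sequence
begin

text \<open>Three ways to fail: large partial sums, a small value at a grid point, or only small coefficients among the
first \<open>J0\<close>. The grid has at most \<open>(2L + 1) n powr b\<close> points and each fails with probability of order
\<open>\<tau> powr (3/5) = n powr (-57b/50)\<close>, which leaves \<open>n powr (-b/10)\<close> after the logarithm is absorbed.\<close>

lemma exceptional_set_bound:
  fixes n N K J0 :: nat and \<alpha> b c s u0 us \<delta> \<tau> \<eta> L :: real and u :: "nat \<Rightarrow> real"
  assumes small_ball: "\<And>x \<tau> n. 0 < 1 - x \<Longrightarrow> 1 - x \<le> u0 \<Longrightarrow> 0 < \<tau> \<Longrightarrow> \<tau> < 1 \<Longrightarrow> ln (1 / \<tau>) \<le> real n * (1 - x) \<Longrightarrow>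
       prob {\<omega> \<in> space M. \<bar>\<Sum>i\<le>n. \<xi> i \<omega> * x ^ i\<bar> \<le> \<tau> / sqrt (1 - x)} \<le> 2 ^ 49 * \<tau> powr (3 / 5)"
    and u0: "u0 \<le> 1 / 2"
    and L: "L = ln (real n)" "n \<ge> 2" and \<alpha>: "0 < \<alpha>" and b: "b = \<alpha> / 10" and s: "0 < s" and \<eta>: "0 < \<eta>"
    and us: "us = \<alpha> * L / real n" and \<delta>: "\<delta> = real n powr (- b)" "\<delta> < 1 / 2" and \<tau>: "\<tau> = real n powr (- (19 / 10 * b))"
    and u: "u = (\<lambda>i. us * (1 + \<delta>) ^ i)" "u K \<le> u0" and J0: "\<eta> * L \<le> real J0"
    and n5: "2 * (log 2 (real (N + 1)) + 1) \<le> real n powr s"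
    and n6: "2 ^ 49 * (2 * L + 1) \<le> real n powr (b / 25)" and n7: "1 \<le> \<alpha> * L"
  defines "E \<equiv> {\<omega> \<in> space M. \<exists>j\<le>N. \<bar>\<Sum>i\<le>j. \<xi> i \<omega>\<bar> > real n powr s * sqrt (real (j + 1))}
      \<union> (\<Union>i\<le>K. {\<omega> \<in> space M. \<bar>\<Sum>j\<le>n. \<xi> j \<omega> * (1 - u i) ^ j\<bar> \<le> \<tau> / sqrt (u i)})
      \<union> {\<omega> \<in> space M. \<forall>j<J0. \<bar>\<xi> j \<omega>\<bar> < 1 / 2}"
  shows "E \<in> sets M" and "prob E \<le> real n powr (- s) + real n powr (- (b / 10)) + real n powr (- (p0 * \<eta>))"
proof -
  define E1 where "E1 = {\<omega> \<in> space M. \<exists>j\<le>N. \<bar>\<Sum>i\<le>j. \<xi> i \<omega>\<bar> > real n powr s * sqrt (real (j + 1))}"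
  define E2 where "E2 i = {\<omega> \<in> space M. \<bar>\<Sum>j\<le>n. \<xi> j \<omega> * (1 - u i) ^ j\<bar> \<le> \<tau> / sqrt (u i)}" for i
  define E3 where "E3 = {\<omega> \<in> space M. \<forall>j<J0. \<bar>\<xi> j \<omega>\<bar> < 1 / 2}"
  have [measurable]: "E1 \<in> sets M" "E2 i \<in> sets M" "E3 \<in> sets M" for i
    unfolding E1_def E2_def E3_def by measurable
  have E: "E = E1 \<union> (\<Union>i\<le>K. E2 i) \<union> E3" unfolding E_def E1_def E2_def E3_def ..
  show "E \<in> sets M" unfolding E by measurable
  have n: "real n \<ge> 2" "real n > 0" "real n \<ge> 1" using L by auto
  have L0: "L > 0" using L by simp
  have us0: "us > 0" using us \<alpha> L0 n by simp
  have b0: "b > 0" using b \<alpha> by simp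
  have nL: "real n powr y = exp (y * L)" for y using n L by (simp add: powr_def)
  have \<delta>0: "\<delta> > 0" using \<delta> n by simp
  have "prob E1 \<le> 2 * (log 2 (real (N + 1)) + 1) / (real n powr s)\<^sup>2"
    unfolding E1_def using n by (intro partial_sums_growth) simp
  also have "\<dots> \<le> real n powr s / (real n powr s)\<^sup>2"
    using n5 by (intro divide_right_mono) auto
  also have "\<dots> = real n powr (- s)"
    using n by (simp add: power2_eq_square powr_minus_divide)
  finally have 1: "prob E1 \<le> real n powr (- s)" .
  have 2: "prob (\<Union>i\<le>K. E2 i) \<le> real n powr (- (b / 10))"
  proof -
    have "prob (\<Union>i\<le>K. E2 i) \<le> (\<Sum>i\<le>K. prob (E2 i))"
      by (intro finite_measure_subadditive_finite) auto
    also have "\<dots> \<le> (\<Sum>i\<le>K. 2 ^ 49 * \<tau> powr (3 / 5))"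
    proof (rule sum_mono)
      fix i assume "i \<in> {..K}"
      then have i: "i \<le> K" by simp
      have "us * 1 \<le> us * (1 + \<delta>) ^ i" using us0 \<delta>0 by (intro mult_left_mono one_le_power) auto
      then have ui: "us \<le> u i" by (simp add: u(1))
      have "u i \<le> u K" unfolding u(1) using us0 \<delta>0 i by (intro mult_left_mono power_increasing) auto
      then have ui2: "u i \<le> u0" using u(2) by linarith
      have "prob {\<omega> \<in> space M. \<bar>\<Sum>j\<le>n. \<xi> j \<omega> * (1 - u i) ^ j\<bar> \<le> \<tau> / sqrt (1 - (1 - u i))} \<le> 2 ^ 49 * \<tau> powr (3 / 5)"
      proof (rule small_ball)
        show "0 < 1 - (1 - u i)" "1 - (1 - u i) \<le> u0" using ui ui2 us0 by auto
        show "0 < \<tau>" using n \<tau> by simp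
        show "\<tau> < 1" unfolding \<tau> using n b0 by (simp add: nL L0)
        have "ln (1 / \<tau>) = 19 / 10 * b * L" unfolding \<tau> nL by (simp add: exp_minus[symmetric] ln_div)
        also have "\<dots> \<le> \<alpha> * L" using b \<alpha> L0 by simp
        also have "\<dots> = real n * us" using n by (simp add: us)
        also have "\<dots> \<le> real n * u i" using ui by (intro mult_left_mono) auto
        finally show "ln (1 / \<tau>) \<le> real n * (1 - (1 - u i))" by simp
      qed
      then show "prob (E2 i) \<le> 2 ^ 49 * \<tau> powr (3 / 5)" unfolding E2_def by simp
    qed
    also have "\<dots> = (real K + 1) * (2 ^ 49 * \<tau> powr (3 / 5))" by simp
    also have "\<dots> \<le> ((2 * L + 1) * real n powr b) * (2 ^ 49 * \<tau> powr (3 / 5))"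
    proof (rule mult_right_mono)
      have "real K \<le> 2 * ln (1 / us) / \<delta>"
        using u u0 by (intro geometric_grid_length us0 \<delta>0 \<delta>(2)) auto
      also have "ln (1 / us) \<le> L"
      proof -
        have "1 / us \<le> real n" using n7 n us0 by (simp add: us field_simps)
        then have "ln (1 / us) \<le> ln (real n)" using us0 by (intro ln_mono) auto
        then show ?thesis by (simp add: L)
      qed
      also have "2 * L / \<delta> = 2 * L * real n powr b" by (simp add: \<delta> powr_minus_divide)
      finally have "real K \<le> 2 * L * real n powr b" using \<delta>0 by (simp add: divide_right_mono)
      moreover have "1 \<le> real n powr b" using n b0 by (intro ge_one_powr_ge_zero) auto
      ultimately show "real K + 1 \<le> (2 * L + 1) * real n powr b" by (simp add: algebra_simps)
    qed simp
    also have "\<dots> = (2 ^ 49 * (2 * L + 1)) * (real n powr b * \<tau> powr (3 / 5))" by (simp only: mult_ac)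
    also have "\<dots> \<le> real n powr (b / 25) * (real n powr b * \<tau> powr (3 / 5))"
      by (intro mult_right_mono n6) simp
    also have "\<dots> = real n powr (- (b / 10))"
      unfolding \<tau> by (simp add: powr_powr powr_add[symmetric])
    finally show ?thesis .
  qed
  have 3: "prob E3 \<le> real n powr (- (p0 * \<eta>))"
  proof -
    have "prob E3 \<le> (1 - p0) ^ J0" unfolding E3_def by (rule prob_all_small)
    also have "\<dots> \<le> exp (- p0) ^ J0" using p0 exp_ge_add_one_self[of "- p0"] by (intro power_mono) auto
    also have "\<dots> = exp (- (p0 * real J0))" by (simp add: exp_of_nat_mult[symmetric] mult.commute)
    also have "\<dots> \<le> exp (- (p0 * (\<eta> * L)))" using p0 J0 by simp
    also have "\<dots> = real n powr (- (p0 * \<eta>))" by (simp add: nL)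
    finally show ?thesis .
  qed
  have "prob E \<le> prob (E1 \<union> (\<Union>i\<le>K. E2 i)) + prob E3"
    unfolding E by (intro measure_Un_le) auto
  also have "prob (E1 \<union> (\<Union>i\<le>K. E2 i)) \<le> prob E1 + prob (\<Union>i\<le>K. E2 i)"
    by (intro measure_Un_le) auto
  finally show "prob E \<le> real n powr (- s) + real n powr (- (b / 10)) + real n powr (- (p0 * \<eta>))"
    using 1 2 3 by linarith
qed

text \<open>The constants are chosen in the order \<open>u0\<close> (range of the small ball estimate), \<open>q\<close> and \<open>\<rho>\<close> (Jensen's
inequality at distance \<open>u0/2\<close> from 1), \<open>\<alpha>\<close> and \<open>b\<close>, and finally \<open>s\<close> and \<open>\<eta>\<close>, which must be small compared
with \<open>\<epsilon> ln (1/q)\<close>. For the finitely many small \<open>n\<close> the bound holds because \<open>A n powr (-c1) \<ge> 1\<close>.\<close>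

theorem root_count_stability:
  fixes \<epsilon> c :: real
  assumes \<epsilon>: "\<epsilon> > 0" and c: "c > 1"
  shows "\<exists>c\<^sub>1 > 0. \<exists>A > 0. \<forall>n::nat. n \<ge> 1 \<longrightarrow>
    prob {\<omega> \<in> space M.
      (MAX k\<in>{k::nat. n \<le> k \<and> real k \<le> c * real n}.
         \<bar>real (root_count {0..1} (initial_poly (\<lambda>j. \<xi> j \<omega>) k)) - real (root_count {0..1} (initial_poly (\<lambda>j. \<xi> j \<omega>) n))\<bar>)
      \<ge> \<epsilon> * ln (real n)}
    \<le> A * real n powr (- c\<^sub>1)"
proof -
  obtain u0 where u0: "0 < u0" "u0 \<le> 1 / 2"
    and small_ball: "\<And>x \<tau> n. 0 < 1 - x \<Longrightarrow> 1 - x \<le> u0 \<Longrightarrow> 0 < \<tau> \<Longrightarrow> \<tau> < 1 \<Longrightarrow> ln (1 / \<tau>) \<le> real n * (1 - x) \<Longrightarrow>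
       prob {\<omega> \<in> space M. \<bar>\<Sum>i\<le>n. \<xi> i \<omega> * x ^ i\<bar> \<le> \<tau> / sqrt (1 - x)} \<le> 2 ^ 49 * \<tau> powr (3 / 5)"
    using small_ball by blast
  define w where "w = u0 / 2"
  have w: "0 < w" "w \<le> 1 / 4" using u0 by (auto simp: w_def)
  obtain \<rho> q where q: "0 < \<rho>" "\<rho> < 1 - w / 2" "0 < q" "q < 1" "(1 - w / 2) * ((1 - w) + \<rho>) \<le> q * ((1 - w / 2)\<^sup>2 - (1 - w) * \<rho>)"
    using jensen_constants[of "1 - w" "1 - w / 2"] w by auto
  define \<alpha> where "\<alpha> = \<epsilon> / (16 * c)"
  have \<alpha>: "0 < \<alpha>" "\<alpha> * c \<le> \<epsilon> / 16" using \<epsilon> c by (auto simp: \<alpha>_def)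
  define b where "b = \<alpha> / 10"
  have b: "b > 0" using \<alpha> by (simp add: b_def)
  define \<kappa> where "\<kappa> = \<epsilon> * ln (1 / q) / 16"
  have \<kappa>: "\<kappa> > 0" using q \<epsilon> by (simp add: \<kappa>_def)
  define s where "s = min (b / 20) \<kappa>"
  have s: "0 < s" "s \<le> b / 20" "s \<le> \<kappa>" using b \<kappa> by (auto simp: s_def)
  have l\<rho>: "ln (1 / \<rho>) > 0" using q w by simp
  define \<eta> where "\<eta> = min (1 / 2) (\<kappa> / ln (1 / \<rho>))"
  have \<eta>: "0 < \<eta>" "\<eta> \<le> 1 / 2" "\<eta> * ln (1 / \<rho>) \<le> \<kappa>"
  proof -
    show "0 < \<eta>" using \<kappa> l\<rho> by (simp add: \<eta>_def)
    show "\<eta> \<le> 1 / 2" unfolding \<eta>_def by (rule min.cobounded1)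
    have "\<eta> \<le> \<kappa> / ln (1 / \<rho>)" by (simp add: \<eta>_def)
    then show "\<eta> * ln (1 / \<rho>) \<le> \<kappa>" using l\<rho> by (simp only: pos_le_divide_eq)
  qed
  define C4 where "C4 = ln (2 * (sqrt (2 / w) * (4 / w + 1)))"
  have ev: "eventually (\<lambda>n::nat. 2 \<le> n
      \<and> 48 \<le> real n powr (b / 20)
      \<and> 4 * sqrt (c + 1) \<le> real n powr (\<alpha> / 4)
      \<and> 2 * sqrt (\<alpha> * (c + 1) * ln (real n)) * (3 * \<alpha> * c * ln (real n) + 1) \<le> real n powr (\<epsilon> / 16)
      \<and> C4 \<le> \<kappa> * ln (real n)
      \<and> 2 * (log 2 (c * real n + 1) + 1) \<le> real n powr s
      \<and> 2 ^ 49 * (2 * ln (real n) + 1) \<le> real n powr (b / 25)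
      \<and> 1 \<le> \<alpha> * ln (real n)
      \<and> \<alpha> * ln (real n) / real n \<le> u0
      \<and> 1 \<le> ln (real n)) sequentially"
  proof (intro eventually_conj)
    show "eventually (\<lambda>n::nat. 2 \<le> n) sequentially" by (rule eventually_ge_at_top)
    show "eventually (\<lambda>n::nat. 48 \<le> real n powr (b / 20)) sequentially" using b by real_asymp
    show "eventually (\<lambda>n::nat. 4 * sqrt (c + 1) \<le> real n powr (\<alpha> / 4)) sequentially" using \<alpha> c by real_asymp
    show "eventually (\<lambda>n::nat. 2 * sqrt (\<alpha> * (c + 1) * ln (real n)) * (3 * \<alpha> * c * ln (real n) + 1) \<le> real n powr (\<epsilon> / 16)) sequentially"
      using \<alpha>(1) c \<epsilon> by real_asymp
    show "eventually (\<lambda>n::nat. C4 \<le> \<kappa> * ln (real n)) sequentially" using \<kappa> by real_asymp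
    show "eventually (\<lambda>n::nat. 2 * (log 2 (c * real n + 1) + 1) \<le> real n powr s) sequentially" using c s(1) by real_asymp
    show "eventually (\<lambda>n::nat. 2 ^ 49 * (2 * ln (real n) + 1) \<le> real n powr (b / 25)) sequentially" using b by real_asymp
    show "eventually (\<lambda>n::nat. 1 \<le> \<alpha> * ln (real n)) sequentially" using \<alpha>(1) by real_asymp
    show "eventually (\<lambda>n::nat. \<alpha> * ln (real n) / real n \<le> u0) sequentially" using \<alpha>(1) u0(1) by real_asymp
    show "eventually (\<lambda>n::nat. 1 \<le> ln (real n)) sequentially" by real_asymp
  qed
  then obtain n0 where n0: "\<And>n. n \<ge> n0 \<Longrightarrow> 2 \<le> n
      \<and> 48 \<le> real n powr (b / 20)
      \<and> 4 * sqrt (c + 1) \<le> real n powr (\<alpha> / 4)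
      \<and> 2 * sqrt (\<alpha> * (c + 1) * ln (real n)) * (3 * \<alpha> * c * ln (real n) + 1) \<le> real n powr (\<epsilon> / 16)
      \<and> C4 \<le> \<kappa> * ln (real n)
      \<and> 2 * (log 2 (c * real n + 1) + 1) \<le> real n powr s
      \<and> 2 ^ 49 * (2 * ln (real n) + 1) \<le> real n powr (b / 25)
      \<and> 1 \<le> \<alpha> * ln (real n)
      \<and> \<alpha> * ln (real n) / real n \<le> u0
      \<and> 1 \<le> ln (real n)"
    unfolding eventually_sequentially by blast
  define c1 where "c1 = min (min s (b / 10)) (p0 * \<eta>)"
  have c1: "c1 > 0" "c1 \<le> s" "c1 \<le> b / 10" "c1 \<le> p0 * \<eta>" using s b p0 \<eta> by (auto simp: c1_def)
  define A where "A = max 3 (real n0 powr c1)"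
  have A: "A \<ge> 3" "A \<ge> real n0 powr c1" by (auto simp: A_def)
  have main: "prob {\<omega> \<in> space M.
      (MAX k\<in>{k::nat. n \<le> k \<and> real k \<le> c * real n}.
         \<bar>real (root_count {0..1} (initial_poly (\<lambda>j. \<xi> j \<omega>) k)) - real (root_count {0..1} (initial_poly (\<lambda>j. \<xi> j \<omega>) n))\<bar>)
      \<ge> \<epsilon> * ln (real n)} \<le> A * real n powr (- c1)" (is "prob ?B \<le> _") if n1: "n \<ge> 1" for n :: nat
  proof (cases "n \<ge> n0")
    case False
    then have "real n powr c1 \<le> real n0 powr c1" using c1 by (intro powr_mono2) auto
    then have "real n powr c1 \<le> A" using A by linarith
    then have "1 \<le> A * real n powr (- c1)" using n1 by (simp add: powr_minus_divide le_divide_eq)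
    then show ?thesis using order_trans[OF prob_le_1] by blast
  next
    case True
    define L where "L = ln (real n)"
    note N = n0[OF True, folded L_def]
    have n: "n \<ge> 2" "real n \<ge> 1" using N by auto
    have L1: "L \<ge> 1" using N by simp
    define us where "us = \<alpha> * L / real n"
    define \<delta> where "\<delta> = real n powr (- b)"
    define \<tau> where "\<tau> = real n powr (- (19 / 10 * b))"
    have us: "0 < us" "us \<le> u0" using N \<alpha> L1 n unfolding us_def by auto
    have "real n powr (b / 20) \<le> real n powr b" using b n by (intro powr_mono) auto
    then have "48 \<le> real n powr b" using N by linarith
    then have "1 / real n powr b \<le> 1 / 48" using n by (intro divide_left_mono) auto
    then have \<delta>2: "\<delta> < 1 / 2" unfolding \<delta>_def powr_minus_divide by linarith
    have \<delta>0: "0 < \<delta>" using n by (simp add: \<delta>_def)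
    obtain K where K: "us * (1 + \<delta>) ^ K \<le> u0" "u0 / 2 \<le> us * (1 + \<delta>) ^ K"
      using geometric_grid_top[OF us \<delta>0] \<delta>2 by auto
    define u where "u = (\<lambda>i. us * (1 + \<delta>) ^ i)"
    define N0 where "N0 = nat \<lfloor>c * real n\<rfloor>"
    have N0: "real N0 \<le> c * real n" using c n by (simp add: N0_def)
    define J0 where "J0 = nat \<lceil>\<eta> * L\<rceil>"
    have J0: "\<eta> * L \<le> real J0" unfolding J0_def by linarith
    have J0': "real j \<le> \<eta> * L" if "j < J0" for j
      using that unfolding J0_def by linarith
    define E where "E = {\<omega> \<in> space M. \<exists>j\<le>N0. \<bar>\<Sum>i\<le>j. \<xi> i \<omega>\<bar> > real n powr s * sqrt (real (j + 1))}
      \<union> (\<Union>i\<le>K. {\<omega> \<in> space M. \<bar>\<Sum>j\<le>n. \<xi> j \<omega> * (1 - u i) ^ j\<bar> \<le> \<tau> / sqrt (u i)})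
      \<union> {\<omega> \<in> space M. \<forall>j<J0. \<bar>\<xi> j \<omega>\<bar> < 1 / 2}"
    have n5: "2 * (log 2 (real (N0 + 1)) + 1) \<le> real n powr s"
    proof -
      have "log 2 (real (N0 + 1)) \<le> log 2 (c * real n + 1)" using N0 by (intro log_mono) auto
      then have "2 * (log 2 (real (N0 + 1)) + 1) \<le> 2 * (log 2 (c * real n + 1) + 1)"
        by (intro mult_left_mono add_right_mono) auto
      also have "\<dots> \<le> real n powr s" using N by blast
      finally show ?thesis .
    qed
    have E: "E \<in> sets M" "prob E \<le> real n powr (- s) + real n powr (- (b / 10)) + real n powr (- (p0 * \<eta>))"
      unfolding E_def
      using N by (intro exceptional_set_bound[OF small_ball u0(2) L_def n(1) \<alpha>(1) b_def s(1) \<eta>(1) us_def \<delta>_def \<delta>2 \<tau>_def u_def _ J0 n5]; simp add: u_def K)+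
    have "?B \<subseteq> E"
    proof (rule ccontr)
      assume "\<not> ?B \<subseteq> E"
      then obtain \<omega> where \<omega>: "\<omega> \<in> ?B" "\<omega> \<notin> E" by blast
      let ?a = "\<lambda>j. \<xi> j \<omega>"
      have sp: "\<omega> \<in> space M" using \<omega> by simp
      have fin: "finite {k::nat. n \<le> k \<and> real k \<le> c * real n}"
        by (rule finite_subset[of _ "{..N0}"]) (auto simp: N0_def le_nat_floor)
      have "n \<in> {k::nat. n \<le> k \<and> real k \<le> c * real n}" using c n by simp
      then have ne: "{k::nat. n \<le> k \<and> real k \<le> c * real n} \<noteq> {}" by blast
      have "\<epsilon> * ln (real n) \<le> (MAX k\<in>{k::nat. n \<le> k \<and> real k \<le> c * real n}.
         \<bar>real (root_count {0..1} (initial_poly ?a k)) - real (root_count {0..1} (initial_poly ?a n))\<bar>)"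
        using \<omega>(1) by simp
      then obtain k where k: "n \<le> k" "real k \<le> c * real n"
        and gt: "\<epsilon> * L \<le> \<bar>real (root_count {0..1} (initial_poly ?a k)) - real (root_count {0..1} (initial_poly ?a n))\<bar>"
        unfolding L_def using fin ne by (subst (asm) Max_ge_iff) auto
      have kN: "k \<le> N0" using k unfolding N0_def by (simp add: le_nat_floor)
      obtain J where J: "J < J0" "\<bar>\<xi> J \<omega>\<bar> \<ge> 1 / 2"
        using \<omega>(2) sp unfolding E_def by (auto simp: not_less)
      have Jn: "J \<le> n"
      proof -
        have "real J \<le> \<eta> * L" by (rule J0'[OF J(1)])
        also have "\<dots> \<le> 1 / 2 * L" using \<eta> L1 by (intro mult_right_mono) auto
        also have "\<dots> \<le> real n" using ln_le_minus_one[of "real n"] n L1 unfolding L_def by linarith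
        finally show ?thesis by simp
      qed
      have "\<bar>real (root_count {0..1} (initial_poly ?a k)) - real (root_count {0..1} (initial_poly ?a n))\<bar> \<le> \<epsilon> / 2 * L"
      proof (rule root_count_comparison[OF L_def n(1) \<epsilon> c \<alpha> b_def s us_def \<delta>_def \<tau>_def u_def _ _ w(1) q \<kappa>_def \<eta>(3) _ _ _ _ k])
        show "u K \<le> 1 / 2" "w \<le> u K" using K u0 by (auto simp: u_def w_def)
        show "\<bar>\<Sum>i\<le>j. \<xi> i \<omega>\<bar> \<le> real n powr s * sqrt (real (j + 1))" if "j \<le> k" for j
          using \<omega>(2) sp that kN unfolding E_def by (auto simp: not_less)
        show "\<tau> / sqrt (u i) < \<bar>poly (initial_poly ?a n) (1 - u i)\<bar>" if "i \<le> K" for i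
          using \<omega>(2) sp that unfolding E_def poly_initial_poly by (auto simp: not_le)
        show "real J \<le> \<eta> * L" by (rule J0'[OF J(1)])
      qed (use N J Jn in \<open>auto simp: C4_def\<close>)
      moreover have "\<epsilon> / 2 * L < \<epsilon> * L" using \<epsilon> L1 by simp
      ultimately show False using gt by linarith
    qed
    then have "prob ?B \<le> prob E" by (rule finite_measure_mono[OF _ E(1)])
    also have "\<dots> \<le> real n powr (- c1) + real n powr (- c1) + real n powr (- c1)"
    proof -
      have "real n powr (- s) \<le> real n powr (- c1)" "real n powr (- (b / 10)) \<le> real n powr (- c1)"
        "real n powr (- (p0 * \<eta>)) \<le> real n powr (- c1)"
        using c1 n by (auto intro!: powr_mono)
      then show ?thesis using E(2) by linarith
    qed
    also have "\<dots> = 3 * real n powr (- c1)" by simp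
    also have "\<dots> \<le> A * real n powr (- c1)" using A by (intro mult_right_mono) auto
    finally show ?thesis .
  qed
  have "A > 0" using A by linarith
  with c1(1) main show ?thesis by blast
qed

end

theorem lemma2p4:
  fixes M :: "'a measure"
    and \<xi> :: "nat \<Rightarrow> 'a \<Rightarrow> real"
    and \<epsilon>\<^sub>0 \<epsilon> c :: real
  assumes "prob_space M"
    and "prob_space.indep_vars M (\<lambda>_. borel) \<xi> UNIV"
    and "\<And>j. prob_space.expectation M (\<xi> j) = 0"
    and "\<And>j. prob_space.variance M (\<xi> j) = 1"
    and "\<epsilon>\<^sub>0 > 0"
    and "(SUP j. \<integral>\<^sup>+ \<omega>. ennreal (\<bar>\<xi> j \<omega>\<bar> powr (2 + \<epsilon>\<^sub>0)) \<partial>M) < \<infinity>"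
    and "\<epsilon> > 0"
    and "c > 1"
  shows "\<exists>c\<^sub>1 > 0. \<exists>A > 0. \<forall>n::nat. n \<ge> 1 \<longrightarrow>
    measure M {\<omega> \<in> space M.
      (MAX k\<in>{k::nat. n \<le> k \<and> real k \<le> c * real n}.
         \<bar>real (num_real_roots \<xi> k {0..1} \<omega>) - real (num_real_roots \<xi> n {0..1} \<omega>)\<bar>)
      \<ge> \<epsilon> * ln (real n)}
    \<le> A * real n powr (- c\<^sub>1)"
proof -
  interpret prob_space M by (rule assms(1))
  have rv [measurable]: "random_variable borel (\<xi> j)" for j
    using assms(2) unfolding indep_vars_def by auto
  obtain K where K: "0 \<le> K" "(SUP j. \<integral>\<^sup>+ \<omega>. ennreal (\<bar>\<xi> j \<omega>\<bar> powr (2 + \<epsilon>\<^sub>0)) \<partial>M) = ennreal K"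
    using assms(6) by (cases "(SUP j. \<integral>\<^sup>+ \<omega>. ennreal (\<bar>\<xi> j \<omega>\<bar> powr (2 + \<epsilon>\<^sub>0)) \<partial>M)") auto
  have nn: "(\<integral>\<^sup>+ \<omega>. ennreal (\<bar>\<xi> j \<omega>\<bar> powr (2 + \<epsilon>\<^sub>0)) \<partial>M) \<le> ennreal K" for j
    unfolding K(2)[symmetric] by (rule SUP_upper) simp
  have int: "integrable M (\<lambda>\<omega>. \<bar>\<xi> j \<omega>\<bar> powr (2 + \<epsilon>\<^sub>0))" for j
    using nn[of j] by (intro integrableI_nonneg) (auto intro: le_less_trans)
  have EK: "expectation (\<lambda>\<omega>. \<bar>\<xi> j \<omega>\<bar> powr (2 + \<epsilon>\<^sub>0)) \<le> K" for j
  proof -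
    have "ennreal (expectation (\<lambda>\<omega>. \<bar>\<xi> j \<omega>\<bar> powr (2 + \<epsilon>\<^sub>0))) \<le> ennreal K"
      using nn[of j] nn_integral_eq_integral[OF int[of j]] by simp
    then show ?thesis using K(1) by simp
  qed
  have sq: "expectation (\<lambda>\<omega>. (\<xi> j \<omega>)\<^sup>2) = 1" for j
    using assms(4)[of j] assms(3)[of j] by simp
  define e where "e = min \<epsilon>\<^sub>0 1"
  have e: "e > 0" using assms(5) by (simp add: e_def)
  (* The thresholds solve the smallness conditions of the two moment lemmas with equality. *)
  define t0 where "t0 = min 1 ((1 / (4 * (1 + K))) powr (1 / e))"
  have t0: "t0 > 0" using K by (simp add: t0_def)
  define A where "A = (4 * (1 + K)) powr (1 / \<epsilon>\<^sub>0)"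
  have A: "A > 0" "A powr (- \<epsilon>\<^sub>0) * K \<le> 1 / 4"
  proof -
    show "A > 0" using K by (simp add: A_def)
    have "A powr (- \<epsilon>\<^sub>0) = 1 / (4 * (1 + K))"
      using K assms(5) by (simp add: A_def powr_powr powr_minus_divide)
    then have "A powr (- \<epsilon>\<^sub>0) * K = K / (4 * (1 + K))" by (simp only: times_divide_eq_left mult_1)
    also have "\<dots> \<le> 1 / 4" using K(1) by (simp add: divide_le_eq)
    finally show "A powr (- \<epsilon>\<^sub>0) * K \<le> 1 / 4" .
  qed
  define p0 where "p0 = 1 / (2 * A\<^sup>2)"
  have ns: "p0 \<le> prob {\<omega> \<in> space M. \<bar>\<xi> j \<omega>\<bar> \<ge> 1 / 2}" for j
    unfolding p0_def by (rule prob_not_small[OF rv assms(5) int EK sq A])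
  interpret unit_sequence M \<xi> t0 p0
  proof
    show "indep_vars (\<lambda>_. borel) \<xi> UNIV" by (rule assms(2))
    show "norm (char (distr M borel (\<xi> j)) t) \<le> exp (- t\<^sup>2 / 4)" if "\<bar>t\<bar> \<le> t0" for j t
    proof (rule char_bound_near_zero[OF rv assms(5) int EK assms(3,4)])
      show "\<bar>t\<bar> \<le> 1" using that by (simp add: t0_def)
      have "\<bar>t\<bar> powr e \<le> ((1 / (4 * (1 + K))) powr (1 / e)) powr e"
        using that e by (intro powr_mono2) (auto simp: t0_def)
      also have "\<dots> = 1 / (4 * (1 + K))" using e K by (simp add: powr_powr)
      finally show "\<bar>t\<bar> powr min \<epsilon>\<^sub>0 1 * (1 + K) \<le> 1 / 4"
        using K by (simp add: e_def field_simps)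
    qed
    show "p0 \<le> 1" using order_trans[OF ns prob_le_1] .
  qed (use assms(3) sq t0 ns A in \<open>auto simp: p0_def intro: square_integrable_of_moment[OF rv assms(5) int]\<close>)
  have "num_real_roots \<xi> k {0..1} \<omega> = root_count {0..1} (initial_poly (\<lambda>j. \<xi> j \<omega>) k)" for k \<omega>
    by (simp add: num_real_roots_def rand_poly_def root_count_def initial_poly_def)
  then show ?thesis using root_count_stability[OF assms(7,8)] by simp
qed

end
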